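(* Let $G$ be a finitely generated residually finite virtually solvable group. Let $(G, X, 0)$ be an expansive pointed dynamical system with the shadowing property and dense homoclinic points. Then every asymptotically nilpotent endomorphism $f : X \to X$ is nilpotent.
   Context: A group is virtually solvable if it has a solvable subgroup of finite index. A pointed dynamical system $(G,X,0)$ consists of a discrete group $G$, a compact metric space $(X,d_X)$, a continuous left action of $G$ on $X$, and a point $0 \in X$ with $g\cdot 0 = 0$ for all $g \in G$. It is expansive if there is $0<\Delta\le 1$ such that $d_X(g\cdot x, g\cdot y)\le \Delta$ for all $g\in G$ implies $x=y$. A point $x \in X$ is homoclinic if for every $\epsilon>0$ there is a finite $E\subseteq G$ with $d_X(g\cdot x,0)<\epsilon$ for all $g\in G\setminus E$. The system has dense homoclinic points if the homoclinic points are dense in $X$. For $G$ generated by a finite set $S$, the system has the shadowing property if for all $\epsilon>0$ there exists $\delta>0$ such that for all functions $x:G\to X$ with $d_X(s\cdot x(g),x(sg))<\delta$ for all $g\in G$ and $s\in S$, there exists $y\in X$ with $d_X(x(g),g\cdot y)<\epsilon$ for all $g\in G$. An endomorphism is a continuous map $f:X\to X$ with $f(0)=0$ and $f(g\cdot x)=g\cdot f(x)$ for all $g\in G$, $x\in X$. It is asymptotically nilpotent if $\lim_{n\to\infty}f^n(x)=0$ for all $x\in X$, and nilpotent if $f^n(X)=\{0\}$ for some $n\in\mathbb{N}$. *)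

theory Defs
  imports "HOL-Analysis.Analysis" "HOL-Algebra.Solvable_Groups" "HOL-Algebra.Group_Action"
begin

definition finite_index :: "('g, 'm) monoid_scheme \<Rightarrow> 'g set \<Rightarrow> bool" where
  "finite_index G H \<longleftrightarrow> finite (rcosets\<^bsub>G\<^esub> H)"

definition virtually_solvable :: "('g, 'm) monoid_scheme \<Rightarrow> bool" where
  "virtually_solvable G \<longleftrightarrow>
     (\<exists>H. subgroup H G \<and> finite_index G H \<and> solvable (G\<lparr>carrier := H\<rparr>))"

definition residually_finite :: "('g, 'm) monoid_scheme \<Rightarrow> bool" where
  "residually_finite G \<longleftrightarrow>
     (\<forall>g\<in>carrier G. g \<noteq> \<one>\<^bsub>G\<^esub> \<longrightarrow> (\<exists>N. N \<lhd> G \<and> finite_index G N \<and> g \<notin> N))"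

definition generating_set :: "('g, 'm) monoid_scheme \<Rightarrow> 'g set \<Rightarrow> bool" where
  "generating_set G S \<longleftrightarrow> S \<subseteq> carrier G \<and> generate G S = carrier G"

text \<open>
  The phase space is a compact subset \<open>X\<close> of the ambient metric type, with the restricted
  metric; topological notions are relative to \<open>X\<close>. As the group is discrete, joint continuity
  of the action is continuity of each \<open>act g\<close>. The library's locale \<open>group_action\<close> normalises
  each \<open>act g\<close> to be \<open>undefined\<close> outside \<open>X\<close>.
\<close>

locale pointed_dynamical_system = group_action G X act
  for G :: "('g, 'm) monoid_scheme" (structure)
    and X :: "'x::metric_space set"
    and act :: "'g \<Rightarrow> 'x \<Rightarrow> 'x" +
  fixes zero :: 'x
  assumes compact_space: "compact X"
    and continuous_act: "g \<in> carrier G \<Longrightarrow> continuous_on X (act g)"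
    and zero_in: "zero \<in> X"
    and act_zero: "g \<in> carrier G \<Longrightarrow> act g zero = zero"

definition expansive ::
  "('g, 'm) monoid_scheme \<Rightarrow> 'x::metric_space set \<Rightarrow> ('g \<Rightarrow> 'x \<Rightarrow> 'x) \<Rightarrow> bool" where
  "expansive G X act \<longleftrightarrow>
     (\<exists>\<Delta>::real. 0 < \<Delta> \<and> \<Delta> \<le> 1 \<and>
        (\<forall>x\<in>X. \<forall>y\<in>X. (\<forall>g\<in>carrier G. dist (act g x) (act g y) \<le> \<Delta>) \<longrightarrow> x = y))"

definition homoclinic_points ::
  "('g, 'm) monoid_scheme \<Rightarrow> 'x::metric_space set \<Rightarrow> ('g \<Rightarrow> 'x \<Rightarrow> 'x) \<Rightarrow> 'x \<Rightarrow> 'x set" where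
  "homoclinic_points G X act zero =
     {x \<in> X. \<forall>\<epsilon>>0. \<exists>E. finite E \<and> E \<subseteq> carrier G \<and>
                    (\<forall>g\<in>carrier G - E. dist (act g x) zero < \<epsilon>)}"

definition dense_homoclinic_points ::
  "('g, 'm) monoid_scheme \<Rightarrow> 'x::metric_space set \<Rightarrow> ('g \<Rightarrow> 'x \<Rightarrow> 'x) \<Rightarrow> 'x \<Rightarrow> bool" where
  "dense_homoclinic_points G X act zero \<longleftrightarrow> X \<subseteq> closure (homoclinic_points G X act zero)"

definition shadowing_property ::
  "('g, 'm) monoid_scheme \<Rightarrow> 'g set \<Rightarrow> 'x::metric_space set \<Rightarrow> ('g \<Rightarrow> 'x \<Rightarrow> 'x) \<Rightarrow> bool" where
  "shadowing_property G S X act \<longleftrightarrow>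
     (\<forall>\<epsilon>>0. \<exists>\<delta>>0. \<forall>x\<in>carrier G \<rightarrow> X.
        (\<forall>g\<in>carrier G. \<forall>s\<in>S. dist (act s (x g)) (x (s \<otimes>\<^bsub>G\<^esub> g)) < \<delta>) \<longrightarrow>
        (\<exists>y\<in>X. \<forall>g\<in>carrier G. dist (x g) (act g y) < \<epsilon>))"

definition system_endomorphism ::
  "('g, 'm) monoid_scheme \<Rightarrow> 'x::metric_space set \<Rightarrow> ('g \<Rightarrow> 'x \<Rightarrow> 'x) \<Rightarrow> 'x \<Rightarrow> ('x \<Rightarrow> 'x) \<Rightarrow> bool"
  where
  "system_endomorphism G X act zero f \<longleftrightarrow>
     f \<in> X \<rightarrow> X \<and> continuous_on X f \<and> f zero = zero \<and>
     (\<forall>g\<in>carrier G. \<forall>x\<in>X. f (act g x) = act g (f x))"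

definition asymptotically_nilpotent ::
  "'x::metric_space set \<Rightarrow> 'x \<Rightarrow> ('x \<Rightarrow> 'x) \<Rightarrow> bool" where
  "asymptotically_nilpotent X zero f \<longleftrightarrow> (\<forall>x\<in>X. (\<lambda>n. (f ^^ n) x) \<longlonglongrightarrow> zero)"

definition nilpotent_on :: "'x set \<Rightarrow> 'x \<Rightarrow> ('x \<Rightarrow> 'x) \<Rightarrow> bool" where
  "nilpotent_on X zero f \<longleftrightarrow> (\<exists>n. (f ^^ n) ` X = {zero})"

end

theory Submission
  imports Defs "HOL-Algebra.SndIsomorphismGrp"
begin

text \<open>
  Fix an expansivity constant \<open>\<Delta>\<close>. The \<^emph>\<open>support\<close> of a point \<open>x\<close> is the set of all \<open>g\<close> for which
  \<open>g x\<close> is more than \<open>\<Delta>\<close> away from \<open>zero\<close>. By compactness it behaves like the support of a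
  configuration in a symbolic system: only \<open>zero\<close> has empty support, \<open>h x\<close> has the support of \<open>x\<close>
  translated by \<open>inv h\<close> on the right, the endomorphism enlarges supports by finitely many left factors only,
  and the shadowing property glues any family of points whose supports are far apart.

  \<^emph>\<open>From finite supports to all points.\<close> Suppose that the points of finite support are nilpotent. Then
  \<open>zero\<close> is stable: a point of finite support that vanishes on a suitable finite set stays zero at the
  identity forever (\<open>stability_of_nilpotent_points\<close>). Indeed, Baire's theorem on the closure of these
  points yields one of them, \<open>u\<close>, near which all points are silent at the identity from some time \<open>N\<close> on; but
  a point \<open>x\<close> that is zero on a huge set and still becomes visible does so only after \<open>N\<close> and after \<open>u\<close>
  has died, so gluing it to \<open>u\<close> gives a contradiction. As every orbit converges to \<open>zero\<close>, stability,
  compactness and the density of homoclinic points bound the time of death of all points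
  (\<open>nilpotent_if_homoclinic_nilpotent\<close>).

  \<^emph>\<open>Stability along a subgroup.\<close> The same argument works modulo a subgroup \<open>H\<close>, for nilpotent points whose support is
  finite modulo \<open>H\<close>. Points of finite support can be repeated periodically along subgroups \<open>L\<close> of finite index in
  \<open>H\<close> that are sparse enough, by residual finiteness. So if \<open>L\<close>-periodic points with support finite modulo
  \<open>L\<close> are nilpotent for these \<open>L\<close>, then a point of finite support that vanishes on some \<open>B H\<close> stays zero at the
  identity (\<open>periodic_stability\<close>). Translating, a support contained in \<open>F H\<close> remains in some \<open>F' H\<close> for all time
  (\<open>confinement\<close>): the dynamics takes place along \<open>H\<close>. If \<open>H\<close> is trivial, this means that the
  support stays in a finite set, where convergence to \<open>zero\<close> forces nilpotency.

  \<^emph>\<open>Descent.\<close> A residually finite virtually solvable group has a series of normal subgroups from one of finite index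
  down to the trivial one with abelian quotients, all closed in the profinite topology. Nilpotency of
  periodic points is carried down this series (\<open>abelian_step\<close>): confinement along the upper member \<open>D\<close>
  reduces to an abelian group \<open>M/K\<close>, of which only a finitely generated part matters for a given
  support. Its generators are removed one by one (\<open>cyclic_step\<close>), so that everything rests on a
  one-dimensional problem: points confined to slabs indexed by the powers of a single element \<open>a\<close>.

  \<^emph>\<open>The one-dimensional problem.\<close> Baire's theorem provides a pattern \<open>w\<close> that silences a whole stretch
  of slabs from some time on, whatever surrounds it. Copies of \<open>w\<close> repeated with a period form a point \<open>q\<close> which dies:
  \<open>f\<^sup>m q = 0\<close>. Replace finitely many of these copies by an arbitrary pattern \<open>v\<close> to get \<open>y\<close>. Then \<open>f\<^sup>m y\<close>
  has finite support modulo the periods, and it is trapped forever between two copies of \<open>w\<close>, hence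
  nilpotent (\<open>interrupted_bricks\<close>). The stability result applies to the points \<open>f\<^sup>m y\<close>, all with the same
  \<open>m\<close>, and gives the stability of \<open>zero\<close> under the patterns \<open>v\<close> themselves (\<open>stable_between_walls\<close>).
\<close>

section \<open>Sets that are finite modulo a subgroup\<close>

context group begin

lemma mem_set_mult: "x \<in> A <#> B \<longleftrightarrow> (\<exists>a\<in>A. \<exists>b\<in>B. x = a \<otimes> b)"
  by (auto simp: set_mult_def)

text \<open>
  Equivalently, \<open>Z\<close> meets only finitely many left cosets of \<open>H\<close>. As supports are translated on the right, this is
  the natural finiteness condition for supports of \<open>H\<close>-periodic points.
\<close>
definition bounded_mod :: "'a set \<Rightarrow> 'a set \<Rightarrow> bool" where
  "bounded_mod H Z \<longleftrightarrow> (\<exists>F. finite F \<and> F \<subseteq> carrier G \<and> Z \<subseteq> F <#> H)"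

definition invs :: "'a set \<Rightarrow> 'a set" where "invs A = m_inv G ` A"

lemma set_multI: "a \<in> A \<Longrightarrow> b \<in> B \<Longrightarrow> a \<otimes> b \<in> A <#> B"
  by (auto simp: set_mult_def)

lemma invsI: "a \<in> A \<Longrightarrow> inv a \<in> invs A"
  by (auto simp: invs_def)

lemma finite_invs [simp]: "finite A \<Longrightarrow> finite (invs A)"
  by (simp add: invs_def)

lemma invs_closed [simp]: "A \<subseteq> carrier G \<Longrightarrow> invs A \<subseteq> carrier G"
  by (auto simp: invs_def)

lemma finite_set_mult [simp]: "finite A \<Longrightarrow> finite B \<Longrightarrow> finite (A <#> B)"
  by (auto simp: set_mult_def)

lemma inv_mult_cancel_left: "a \<in> carrier G \<Longrightarrow> b \<in> carrier G \<Longrightarrow> inv a \<otimes> (a \<otimes> b) = b"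
  by (metis inv_closed l_inv l_one m_assoc)

lemma mult_inv_cancel_left: "a \<in> carrier G \<Longrightarrow> b \<in> carrier G \<Longrightarrow> a \<otimes> (inv a \<otimes> b) = b"
  by (metis inv_closed r_inv l_one m_assoc)

lemma bounded_mod_subset: "bounded_mod H Z \<Longrightarrow> Z' \<subseteq> Z \<Longrightarrow> bounded_mod H Z'"
  unfolding bounded_mod_def by blast

lemma bounded_modI: "finite F \<Longrightarrow> F \<subseteq> carrier G \<Longrightarrow> Z \<subseteq> F <#> H \<Longrightarrow> bounded_mod H Z"
  unfolding bounded_mod_def by blast

lemma bounded_mod_empty [simp]: "bounded_mod H {}"
  unfolding bounded_mod_def by blast

lemma bounded_mod_Un:
  assumes "bounded_mod H Y" "bounded_mod H Z" shows "bounded_mod H (Y \<union> Z)"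
proof -
  obtain E F where "finite E" "E \<subseteq> carrier G" "Y \<subseteq> E <#> H" "finite F" "F \<subseteq> carrier G" "Z \<subseteq> F <#> H"
    using assms unfolding bounded_mod_def by blast
  then show ?thesis by (intro bounded_modI[of "E \<union> F"]) (auto simp: set_mult_def)
qed

lemma bounded_mod_UN:
  assumes "finite I" "\<And>i. i \<in> I \<Longrightarrow> bounded_mod H (Z i)" shows "bounded_mod H (\<Union>i\<in>I. Z i)"
  using assms by (induction I rule: finite_induct) (auto intro: bounded_mod_Un)

lemma bounded_mod_mono: "bounded_mod H Z \<Longrightarrow> H \<subseteq> H' \<Longrightarrow> bounded_mod H' Z"
  unfolding bounded_mod_def by (meson mono_set_mult order.trans order.refl)

lemma bounded_mod_finite:
  assumes "finite Z" "Z \<subseteq> carrier G" "subgroup H G" shows "bounded_mod H Z"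
proof (rule bounded_modI[OF assms(1,2)])
  show "Z \<subseteq> Z <#> H"
  proof
    fix z assume "z \<in> Z"
    moreover have "z = z \<otimes> \<one>" using \<open>z \<in> Z\<close> assms(2) by auto
    ultimately show "z \<in> Z <#> H" using subgroup.one_closed[OF assms(3)] mem_set_mult by blast
  qed
qed

lemma bounded_mod_mult:
  assumes "finite C" "C \<subseteq> carrier G" "bounded_mod H Z" "H \<subseteq> carrier G"
  shows "bounded_mod H (C <#> Z)"
proof -
  obtain F where F: "finite F" "F \<subseteq> carrier G" "Z \<subseteq> F <#> H"
    using assms unfolding bounded_mod_def by blast
  have "C <#> Z \<subseteq> C <#> (F <#> H)" using F(3) by (intro mono_set_mult) auto
  also have "\<dots> = (C <#> F) <#> H" using assms F by (simp add: set_mult_assoc)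
  finally show ?thesis using F assms by (intro bounded_modI[of "C <#> F"]) (auto simp: set_mult_closed)
qed

lemma bounded_mod_carrier: "bounded_mod H Z \<Longrightarrow> H \<subseteq> carrier G \<Longrightarrow> Z \<subseteq> carrier G"
  unfolding bounded_mod_def using set_mult_closed by blast

lemma bounded_mod_index:
  assumes "bounded_mod L H" "bounded_mod H Z" "L \<subseteq> carrier G"
  shows "bounded_mod L Z"
proof -
  obtain F where F: "finite F" "F \<subseteq> carrier G" "Z \<subseteq> F <#> H"
    using assms unfolding bounded_mod_def by blast
  show ?thesis
    by (rule bounded_mod_subset[OF bounded_mod_mult[OF F(1,2) assms(1,3)] F(3)])
qed

lemma bounded_mod_rcoset:
  assumes "bounded_mod H Z" "a \<in> carrier G" "H \<subseteq> carrier G" "\<And>h. h \<in> H \<Longrightarrow> inv a \<otimes> h \<otimes> a \<in> H"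
  shows "bounded_mod H (Z #> a)"
proof -
  obtain F where F: "finite F" "F \<subseteq> carrier G" "Z \<subseteq> F <#> H"
    using assms unfolding bounded_mod_def by blast
  show ?thesis
  proof (rule bounded_modI[of "F #> a"])
    show "finite (F #> a)" using F by (simp add: r_coset_def)
    show "F #> a \<subseteq> carrier G" using F assms by (simp add: r_coset_subset_G)
    show "Z #> a \<subseteq> F #> a <#> H"
    proof
      fix x assume "x \<in> Z #> a"
      then obtain f h where fh: "f \<in> F" "h \<in> H" "x = f \<otimes> h \<otimes> a"
        using F(3) by (auto simp: r_coset_def set_mult_def)
      then have c: "f \<in> carrier G" "h \<in> carrier G" using F assms by auto
      have "x = (f \<otimes> a) \<otimes> (inv a \<otimes> h \<otimes> a)"
        unfolding fh(3) using c assms(2) by (simp add: m_assoc mult_inv_cancel_left)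
      then show "x \<in> F #> a <#> H" using fh assms(4) by (auto simp: r_coset_def set_mult_def)
    qed
  qed
qed

text \<open>
  A condition that a neighbourhood \<open>C A\<close> of a support should miss \<open>Z'\<close> becomes a condition on \<open>A\<close> alone by
  moving \<open>C\<close> to the other side. All requirements to be "far away" are stated in this form.
\<close>
lemma bounded_mod_avoid:
  assumes "finite C" "C \<subseteq> carrier G" "bounded_mod H Z'" "subgroup H G"
  obtains Z where "bounded_mod H Z" "\<And>A. A \<subseteq> carrier G \<Longrightarrow> A \<inter> Z = {} \<Longrightarrow> (C <#> A) \<inter> Z' = {}"
proof -
  have H: "H \<subseteq> carrier G" using assms(4) subgroup.subset by blast
  have Z': "Z' \<subseteq> carrier G" using bounded_mod_carrier[OF assms(3) H] .
  show ?thesis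
  proof
    show "bounded_mod H (invs C <#> Z')" using assms H by (intro bounded_mod_mult) auto
    fix A assume A: "A \<subseteq> carrier G" "A \<inter> (invs C <#> Z') = {}"
    show "(C <#> A) \<inter> Z' = {}"
    proof (rule ccontr)
      assume "(C <#> A) \<inter> Z' \<noteq> {}"
      then obtain c a where ca: "c \<in> C" "a \<in> A" "c \<otimes> a \<in> Z'" by (auto simp: set_mult_def)
      then have "a = inv c \<otimes> (c \<otimes> a)" using A assms(2) by (simp add: inv_mult_cancel_left subset_iff)
      then have "a \<in> invs C <#> Z'" using ca by (auto simp: invs_def set_mult_def)
      then show False using A ca by blast
    qed
  qed
qed

lemma bounded_mod_pow_finite:
  assumes "subgroup L G" "a \<in> carrier G" "\<And>i::int. i \<noteq> 0 \<Longrightarrow> a [^] i \<notin> L"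
    and "finite C" "C \<subseteq> carrier G"
  shows "finite {i::int. a [^] i \<in> C <#> L}"
proof (rule finite_imageD)
  define c where "c i = (SOME x. x \<in> C \<and> (\<exists>l\<in>L. a [^] i = x \<otimes> l))" for i :: int
  have c: "c i \<in> C \<and> (\<exists>l\<in>L. a [^] i = c i \<otimes> l)" if "a [^] i \<in> C <#> L" for i
    unfolding c_def by (rule someI_ex) (use that in \<open>auto simp: set_mult_def\<close>)
  show "finite (c ` {i. a [^] i \<in> C <#> L})"
    by (rule finite_subset[OF _ assms(4)]) (use c in auto)
  show "inj_on c {i. a [^] i \<in> C <#> L}"
  proof
    fix i j :: int assume ij: "i \<in> {i. a [^] i \<in> C <#> L}" "j \<in> {i. a [^] i \<in> C <#> L}" "c i = c j"
    obtain l where l: "l \<in> L" "a [^] i = c i \<otimes> l" using c[of i] ij by auto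
    obtain l' where l': "l' \<in> L" "a [^] j = c i \<otimes> l'" using c[of j] ij by auto
    have cc: "c i \<in> carrier G" using c ij assms(5) by auto
    have lc: "l \<in> carrier G" "l' \<in> carrier G" using l l' subgroup.subset[OF assms(1)] by auto
    have "a [^] (- i + j) = inv (a [^] i) \<otimes> a [^] j"
      using assms(2) by (simp only: int_pow_mult[OF assms(2)] int_pow_neg)
    also have "\<dots> = inv l \<otimes> l'"
      using cc lc unfolding l(2) l'(2) by (simp add: inv_mult_group m_assoc inv_mult_cancel_left)
    also have "\<dots> \<in> L"
      using l l' assms(1) by (simp add: subgroup.m_closed subgroup.m_inv_closed)
    finally show "i = j" using assms(3)[of "- i + j"] by auto
  qed
qed

text \<open>
  Each left coset of \<open>L\<close> contains at most one power of \<open>a\<close>, so the translates \<open>A a\<^sup>i\<close> drift away from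
  every set that is finite modulo \<open>L\<close>.
\<close>
lemma slab_separation:
  assumes "subgroup L G" "a \<in> carrier G" "\<And>i::int. i \<noteq> 0 \<Longrightarrow> a [^] i \<notin> L"
    and norm: "\<And>i::int. \<And>l. l \<in> L \<Longrightarrow> inv (a [^] i) \<otimes> l \<otimes> a [^] i \<in> L"
    and "bounded_mod L A" "bounded_mod L B"
  obtains r :: int where "r \<ge> 0" "\<And>i. (A #> a [^] i) \<inter> B \<noteq> {} \<Longrightarrow> \<bar>i\<bar> \<le> r"
proof -
  obtain E where E: "finite E" "E \<subseteq> carrier G" "A \<subseteq> E <#> L" using assms unfolding bounded_mod_def by blast
  obtain F where F: "finite F" "F \<subseteq> carrier G" "B \<subseteq> F <#> L" using assms unfolding bounded_mod_def by blast
  have L: "L \<subseteq> carrier G" using assms(1) subgroup.subset by blast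
  let ?I = "{i::int. a [^] i \<in> (invs E <#> F) <#> L}"
  have fin: "finite ?I"
    using E F by (intro bounded_mod_pow_finite assms) (auto simp: set_mult_closed)
  then obtain r where r: "\<And>i. i \<in> ?I \<Longrightarrow> \<bar>i\<bar> \<le> r"
    using bdd_above_finite[of "abs ` ?I"] by (auto simp: bdd_above_def)
  show ?thesis
  proof
    show "max r 0 \<ge> 0" by simp
    fix i :: int assume "(A #> a [^] i) \<inter> B \<noteq> {}"
    then obtain e l f k where efl: "e \<in> E" "l \<in> L" "f \<in> F" "k \<in> L" "e \<otimes> l \<otimes> a [^] i = f \<otimes> k"
      using E(3) F(3) by (fastforce simp: r_coset_def set_mult_def)
    have c: "e \<in> carrier G" "l \<in> carrier G" "f \<in> carrier G" "k \<in> carrier G"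
      using efl E F L by auto
    have ac: "a [^] i \<in> carrier G" using assms(2) by simp
    obtain m where m: "m \<in> L" "l \<otimes> a [^] i = a [^] i \<otimes> m"
    proof
      show "inv (a [^] i) \<otimes> l \<otimes> a [^] i \<in> L" using norm efl by blast
      show "l \<otimes> a [^] i = a [^] i \<otimes> (inv (a [^] i) \<otimes> l \<otimes> a [^] i)"
        using c ac by (simp add: m_assoc mult_inv_cancel_left)
    qed
    have mc: "m \<in> carrier G" using L m by blast
    have "e \<otimes> (a [^] i \<otimes> m) = f \<otimes> k"
      using efl(5) c ac m(2) by (simp add: m_assoc)
    then have "inv e \<otimes> (f \<otimes> k) = a [^] i \<otimes> m"
      using inv_mult_cancel_left[OF c(1) m_closed[OF ac mc]] by simp
    then have "a [^] i = (inv e \<otimes> (f \<otimes> k)) \<otimes> inv m"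
      using c ac mc by (simp add: m_assoc)
    then have "a [^] i = inv e \<otimes> f \<otimes> (k \<otimes> inv m)"
      using c mc by (simp add: m_assoc)
    moreover have "k \<otimes> inv m \<in> L" using assms(1) efl(4) m by (simp add: subgroup.m_closed subgroup.m_inv_closed)
    ultimately have "i \<in> ?I" using efl by (auto intro: set_multI invsI)
    then show "\<bar>i\<bar> \<le> max r 0" using r by fastforce
  qed
qed

lemma subset_set_mult_one: "\<one> \<in> J \<Longrightarrow> V \<subseteq> carrier G \<Longrightarrow> V \<subseteq> J <#> V"
  by (force simp: mem_set_mult)

text \<open>
  From \<open>z m \<in> A\<close> one gets \<open>m \<in> H c H\<close> with \<open>c\<close> in a finite set, and the double coset is the coset \<open>c H\<close> since \<open>M\<close>
  normalizes \<open>H\<close>.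
\<close>
lemma confinement_algebra:
  assumes "subgroup H G" "subgroup M G" "H \<subseteq> M" and norm: "\<And>m h. m \<in> M \<Longrightarrow> h \<in> H \<Longrightarrow> inv m \<otimes> h \<otimes> m \<in> H"
    and "finite T" "T \<subseteq> carrier G" "bounded_mod H Z" "bounded_mod H A"
  obtains B where "bounded_mod H B"
    "\<And>t m z. t \<in> T \<Longrightarrow> m \<in> M \<Longrightarrow> z \<in> Z \<Longrightarrow> z \<otimes> m \<in> A \<Longrightarrow> t \<otimes> m \<in> B"
proof -
  obtain E where E: "finite E" "E \<subseteq> carrier G" "Z \<subseteq> E <#> H" using assms unfolding bounded_mod_def by blast
  obtain F where F: "finite F" "F \<subseteq> carrier G" "A \<subseteq> F <#> H" using assms unfolding bounded_mod_def by blast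
  have H: "H \<subseteq> carrier G" and M: "M \<subseteq> carrier G" using assms subgroup.subset by blast+
  show ?thesis
  proof
    show "bounded_mod H ((T <#> (invs E <#> F)) <#> H)"
      by (rule bounded_modI[OF _ _ order.refl]) (use E F assms in \<open>auto simp: set_mult_closed\<close>)
    fix t m z assume *: "t \<in> T" "m \<in> M" "z \<in> Z" "z \<otimes> m \<in> A"
    obtain e h where eh: "e \<in> E" "h \<in> H" "z = e \<otimes> h" 
      using subsetD[OF E(3) *(3)] unfolding mem_set_mult by blast
    obtain p k where pk: "p \<in> F" "k \<in> H" "z \<otimes> m = p \<otimes> k" 
      using subsetD[OF F(3) *(4)] unfolding mem_set_mult by blast
    have c: "e \<in> carrier G" "h \<in> carrier G" "p \<in> carrier G" "k \<in> carrier G" "m \<in> carrier G" "t \<in> carrier G"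
      using eh pk E F H M * assms by auto
    define d where "d = inv e \<otimes> p"
    have dc: "d \<in> carrier G" using c by (simp add: d_def)
    have "inv e \<otimes> (e \<otimes> (h \<otimes> m)) = inv e \<otimes> (p \<otimes> k)" using pk(3) eh(3) c by (simp add: m_assoc)
    then have hm: "h \<otimes> m = d \<otimes> k" using c by (simp add: inv_mult_cancel_left d_def m_assoc)
    then have "d = h \<otimes> m \<otimes> inv k" using c dc by (simp add: m_assoc)
    then have dM: "d \<in> M"
      using eh pk * assms(2,3) by (metis subgroup.m_closed subgroup.m_inv_closed subsetD)
    have "m = inv h \<otimes> (d \<otimes> k)" using hm c by (metis inv_mult_cancel_left)
    then have "t \<otimes> m = (t \<otimes> d) \<otimes> (inv d \<otimes> inv h \<otimes> d \<otimes> k)"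
      using c dc by (simp add: m_assoc mult_inv_cancel_left)
    moreover have "inv d \<otimes> inv h \<otimes> d \<otimes> k \<in> H"
      using norm[OF dM subgroup.m_inv_closed[OF assms(1) eh(2)]] pk(2) subgroup.m_closed[OF assms(1)] by blast
    moreover have "t \<otimes> d \<in> T <#> (invs E <#> F)"
      using * eh pk by (auto simp: d_def intro!: set_multI invsI)
    ultimately show "t \<otimes> m \<in> (T <#> (invs E <#> F)) <#> H" by (metis set_multI)
  qed
qed

text \<open>
  The coset representatives can be chosen in \<open>A\<close>, once those cosets of \<open>B\<close> that miss \<open>A\<close> are discarded.
\<close>
lemma bounded_mod_Int:
  assumes "subgroup A G" "subgroup B G" "bounded_mod B A"
  shows "bounded_mod (A \<inter> B) A"
proof -
  obtain F where F: "finite F" "F \<subseteq> carrier G" "A \<subseteq> F <#> B" using assms unfolding bounded_mod_def by blast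
  have A: "A \<subseteq> carrier G" and B: "B \<subseteq> carrier G" using assms subgroup.subset by blast+
  define r where "r x = (SOME a. a \<in> A \<and> (\<exists>b\<in>B. a = x \<otimes> b))" for x
  have r: "r x \<in> A \<and> (\<exists>b\<in>B. r x = x \<otimes> b)" if "a \<in> A" "b \<in> B" "a = x \<otimes> b" for a b x
    unfolding r_def by (rule someI_ex) (use that in blast)
  let ?R = "r ` {x \<in> F. \<exists>a\<in>A. \<exists>b\<in>B. a = x \<otimes> b}"
  show ?thesis
  proof (rule bounded_modI)
    show "finite ?R" using F by simp
    show "?R \<subseteq> carrier G" using r A by blast
    show "A \<subseteq> ?R <#> (A \<inter> B)"
    proof
      fix a assume a: "a \<in> A"
      then obtain x b where xb: "x \<in> F" "b \<in> B" "a = x \<otimes> b"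
        using subsetD[OF F(3) a] unfolding mem_set_mult by blast
      obtain b' where b': "r x \<in> A" "b' \<in> B" "r x = x \<otimes> b'" using r[OF a xb(2,3)] by blast
      have c: "x \<in> carrier G" "b \<in> carrier G" "b' \<in> carrier G" "r x \<in> carrier G" "a \<in> carrier G"
        using a xb b' F A B by auto
      have "inv (r x) \<otimes> a = inv b' \<otimes> b"
        unfolding b'(3) xb(3) using c by (simp add: inv_mult_group m_assoc inv_mult_cancel_left)
      then have "inv (r x) \<otimes> a \<in> B"
        using subgroup.m_closed[OF assms(2) subgroup.m_inv_closed[OF assms(2) b'(2)] xb(2)] by simp
      then have "inv (r x) \<otimes> a \<in> A \<inter> B"
        using subgroup.m_closed[OF assms(1) subgroup.m_inv_closed[OF assms(1) b'(1)] a] by simp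
      moreover have "r x \<in> ?R" using a xb by blast
      ultimately have "r x \<otimes> (inv (r x) \<otimes> a) \<in> ?R <#> (A \<inter> B)" by (intro set_multI)
      then show "a \<in> ?R <#> (A \<inter> B)" using c by (simp add: mult_inv_cancel_left)
    qed
  qed
qed

lemma mult_coset_absorb:
  assumes "subgroup H G" "B \<subseteq> carrier G" "g \<in> carrier G" "h \<in> H" "g \<otimes> h \<in> B <#> H"
  shows "g \<in> B <#> H"
proof -
  obtain b k where bk: "b \<in> B" "k \<in> H" "g \<otimes> h = b \<otimes> k" using assms(5) unfolding mem_set_mult by blast
  have c: "h \<in> carrier G" "b \<in> carrier G" "k \<in> carrier G"
    using assms(2,4) bk subgroup.subset[OF assms(1)] by auto
  have "g = b \<otimes> (k \<otimes> inv h)" using bk(3) c assms(3) by (simp add: m_assoc[symmetric] inv_solve_right)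
  moreover have "k \<otimes> inv h \<in> H" using assms(1,4) bk by (simp add: subgroup.m_closed subgroup.m_inv_closed)
  ultimately show ?thesis using bk(1) by (simp add: set_multI)
qed

lemma quotient_in_subgroup:
  assumes "subgroup H G" "p \<in> carrier G" "p' \<in> carrier G" "g \<in> carrier G"
    and "l \<in> H" "l' \<in> H" "k \<in> H" "k' \<in> H" "g \<otimes> l = p \<otimes> k" "g \<otimes> l' = p' \<otimes> k'"
  shows "inv p \<otimes> p' \<in> H"
proof -
  have c: "l \<in> carrier G" "l' \<in> carrier G" "k \<in> carrier G" "k' \<in> carrier G"
    using assms subgroup.subset[OF assms(1)] by auto
  have p: "p = g \<otimes> (l \<otimes> inv k)" using assms(2,4,9) c by (simp add: m_assoc[symmetric] inv_solve_right)
  have p': "p' = g \<otimes> (l' \<otimes> inv k')" using assms(3,4,10) c by (simp add: m_assoc[symmetric] inv_solve_right)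
  have "inv p \<otimes> p' = inv (l \<otimes> inv k) \<otimes> (l' \<otimes> inv k')"
    unfolding p p' using c assms(4) by (simp add: inv_mult_group m_assoc inv_mult_cancel_left)
  also have "\<dots> \<in> H" using assms(1,5-8) by (simp add: subgroup.m_closed subgroup.m_inv_closed)
  finally show ?thesis .
qed

lemma cyclic_extension:
  assumes H: "subgroup H G" and M: "subgroup M G" and HM: "H \<subseteq> M" and a: "a \<in> M"
    and norm: "\<And>m h. m \<in> M \<Longrightarrow> h \<in> H \<Longrightarrow> inv m \<otimes> h \<otimes> m \<in> H"
  shows "subgroup {h \<otimes> a [^] i | h i. h \<in> H \<and> i \<in> (UNIV :: int set)} G" (is "subgroup ?H' G")
proof -
  have Hc: "H \<subseteq> carrier G" and ac: "a \<in> carrier G" using H M a subgroup.subset by blast+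
  have pM: "a [^] (i::int) \<in> M" for i using a M by (simp add: subgroup_int_pow_closed)
  have sw: "\<exists>h'\<in>H. a [^] i \<otimes> h = h' \<otimes> a [^] i" if h: "h \<in> H" for h and i :: int
  proof (rule bexI)
    show "a [^] i \<otimes> h \<otimes> inv (a [^] i) \<in> H"
      using norm[OF subgroup.m_inv_closed[OF M pM] h] ac by simp
    show "a [^] i \<otimes> h = a [^] i \<otimes> h \<otimes> inv (a [^] i) \<otimes> a [^] i" using h Hc ac by (simp add: m_assoc subset_iff)
  qed
  show ?thesis
  proof (rule subgroupI)
    show "?H' \<subseteq> carrier G" using Hc ac by auto
    have "\<one> \<otimes> a [^] (0::int) \<in> ?H'" using subgroup.one_closed[OF H] by blast
    then show "?H' \<noteq> {}" by blast
  next
    fix x assume "x \<in> ?H'"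
    then obtain h i where hi: "h \<in> H" "x = h \<otimes> a [^] (i::int)" by blast
    obtain h' where h': "h' \<in> H" "a [^] (- i) \<otimes> inv h = h' \<otimes> a [^] (- i)"
      using sw[OF subgroup.m_inv_closed[OF H hi(1)]] by blast
    have "inv x = a [^] (- i) \<otimes> inv h" using hi Hc ac by (simp add: inv_mult_group int_pow_neg subset_iff)
    then show "inv x \<in> ?H'" using h' by auto
  next
    fix x y assume "x \<in> ?H'" "y \<in> ?H'"
    then obtain h i k j where hi: "h \<in> H" "x = h \<otimes> a [^] (i::int)" "k \<in> H" "y = k \<otimes> a [^] (j::int)" by blast
    obtain k' where k': "k' \<in> H" "a [^] i \<otimes> k = k' \<otimes> a [^] i" using sw[OF hi(3)] by blast
    have c: "h \<in> carrier G" "k \<in> carrier G" "k' \<in> carrier G" using hi k' Hc by auto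
    have "x \<otimes> y = h \<otimes> (a [^] i \<otimes> k) \<otimes> a [^] j" using hi c ac by (simp add: m_assoc)
    also have "\<dots> = (h \<otimes> k') \<otimes> a [^] (i + j)" unfolding k'(2) using c ac by (simp add: m_assoc int_pow_mult)
    finally show "x \<otimes> y \<in> ?H'" using subgroup.m_closed[OF H hi(1) k'(1)] by blast
  qed
qed

end

section \<open>Closed subgroups in the profinite topology\<close>

context group begin

definition finite_index_normal :: "'a set \<Rightarrow> bool" where
  "finite_index_normal N \<longleftrightarrow> N \<lhd> G \<and> bounded_mod N (carrier G)"

text \<open>
  Closedness of \<open>K\<close> is what periodization needs: passing from \<open>K\<close> to \<open>K N\<close> with \<open>N\<close> of finite index, any given
  finite set can be kept free of new elements.
\<close>
definition profinitely_closed :: "'a set \<Rightarrow> bool" where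
  "profinitely_closed K \<longleftrightarrow> (\<forall>g\<in>carrier G - K. \<exists>N. finite_index_normal N \<and> g \<notin> K <#> N)"

lemma finite_index_normal_Int:
  assumes "finite_index_normal A" "finite_index_normal B" shows "finite_index_normal (A \<inter> B)"
proof -
  have sub: "subgroup A G" "subgroup B G" using assms by (auto simp: finite_index_normal_def normal_imp_subgroup)
  have "bounded_mod B A"
    using assms bounded_mod_subset subgroup.subset[OF sub(1)] unfolding finite_index_normal_def by blast
  then have "bounded_mod (A \<inter> B) A" by (rule bounded_mod_Int[OF sub])
  then have "bounded_mod (A \<inter> B) (carrier G)"
    using bounded_mod_index[of "A \<inter> B" A "carrier G"] assms subgroup.subset[OF sub(1)]
    unfolding finite_index_normal_def by blast
  moreover have "A \<inter> B \<lhd> G"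
    using assms unfolding finite_index_normal_def normal_inv_iff by (auto intro: subgroups_Inter_pair)
  ultimately show ?thesis by (simp add: finite_index_normal_def)
qed

lemma finite_index_normal_carrier: "finite_index_normal (carrier G)"
proof -
  have "carrier G \<subseteq> {\<one>} <#> carrier G" by (force simp: mem_set_mult)
  then have "bounded_mod (carrier G) (carrier G)" by (intro bounded_modI[of "{\<one>}"]) auto
  then show ?thesis by (simp add: finite_index_normal_def normal_self)
qed

lemma profinitely_closed_separates:
  assumes "profinitely_closed K" "K \<subseteq> carrier G" "finite Q" "Q \<subseteq> carrier G"
  obtains N where "finite_index_normal N" "\<And>q. q \<in> Q \<Longrightarrow> q \<in> K <#> N \<Longrightarrow> q \<in> K"
proof -
  have "\<exists>N. finite_index_normal N \<and> (\<forall>q\<in>Q. q \<in> K <#> N \<longrightarrow> q \<in> K)"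
    using assms(3,4)
  proof (induction Q rule: finite_induct)
    case empty then show ?case using finite_index_normal_carrier by blast
  next
    case (insert x Q)
    then obtain N where N: "finite_index_normal N" "\<forall>q\<in>Q. q \<in> K <#> N \<longrightarrow> q \<in> K" by auto
    have "\<exists>N'. finite_index_normal N' \<and> (x \<in> K <#> N' \<longrightarrow> x \<in> K)"
      using assms(1) insert.prems finite_index_normal_carrier unfolding profinitely_closed_def by blast
    then obtain N' where N': "finite_index_normal N'" "x \<in> K <#> N' \<longrightarrow> x \<in> K" by blast
    have "K <#> (N \<inter> N') \<subseteq> K <#> N" "K <#> (N \<inter> N') \<subseteq> K <#> N'"
      by (intro mono_set_mult; blast)+
    then show ?case using N N' finite_index_normal_Int by (intro exI[of _ "N \<inter> N'"]) blast
  qed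
  then show ?thesis using that by blast
qed

lemma profinitely_closed_Int:
  assumes "profinitely_closed A" "profinitely_closed B"
  shows "profinitely_closed (A \<inter> B)"
  unfolding profinitely_closed_def
proof
  fix g assume g: "g \<in> carrier G - A \<inter> B"
  have "A \<inter> B <#> N \<subseteq> A <#> N" "A \<inter> B <#> N \<subseteq> B <#> N" for N by (intro mono_set_mult; blast)+
  then show "\<exists>N. finite_index_normal N \<and> g \<notin> A \<inter> B <#> N"
    using assms g unfolding profinitely_closed_def by (cases "g \<in> A") blast+
qed

lemma profinitely_closed_mult:
  assumes K: "K \<lhd> G" and N: "finite_index_normal N" shows "profinitely_closed (K <#> N)"
  unfolding profinitely_closed_def
proof
  fix g assume g: "g \<in> carrier G - (K <#> N)"
  have Ns: "subgroup N G" using N by (simp add: finite_index_normal_def normal_imp_subgroup)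
  have "(K <#> N) <#> N = K <#> (N <#> N)"
    using K Ns by (simp add: set_mult_assoc subgroup.subset normal_imp_subgroup)
  also have "N <#> N = N" using subgroup_mult_id[OF Ns] .
  finally have "g \<notin> (K <#> N) <#> N" using g by simp
  then show "\<exists>N'. finite_index_normal N' \<and> g \<notin> (K <#> N) <#> N'" using N by blast
qed

lemma normal_Int:
  assumes "A \<lhd> G" "B \<lhd> G" shows "A \<inter> B \<lhd> G"
  using assms unfolding normal_inv_iff by (auto intro: subgroups_Inter_pair)

text \<open>
  The commutator is computed in the quotient by \<open>N\<close>.
\<close>
lemma commutator_mult_closed:
  assumes P: "P \<lhd> G" and N: "N \<lhd> G" and xy: "x \<in> P <#> N" "y \<in> P <#> N"
    and Q: "\<And>p q. p \<in> P \<Longrightarrow> q \<in> P \<Longrightarrow> p \<otimes> q \<otimes> inv p \<otimes> inv q \<in> Q" and Qc: "Q \<subseteq> carrier G"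
  shows "x \<otimes> y \<otimes> inv x \<otimes> inv y \<in> Q <#> N"
proof -
  interpret N: normal N G by (rule N)
  have Pc: "P \<subseteq> carrier G" using P by (simp add: normal_imp_subgroup subgroup.subset)
  obtain p n where pn: "p \<in> P" "n \<in> N" "x = p \<otimes> n" using xy(1) unfolding mem_set_mult by (elim bexE)
  obtain q m where qm: "q \<in> P" "m \<in> N" "y = q \<otimes> m" using xy(2) unfolding mem_set_mult by (elim bexE)
  have c: "p \<in> carrier G" "q \<in> carrier G" "n \<in> carrier G" "m \<in> carrier G" using pn qm Pc N.subset by auto
  have xyc: "x \<in> carrier G" "y \<in> carrier G" using pn qm c by auto
  have coset: "N #> (u \<otimes> v) = N #> u" if "u \<in> carrier G" "v \<in> N" for u v
  proof -
    have "u \<otimes> v \<in> N #> u" using that N.coset_eq by (auto simp: l_coset_def)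
    then show ?thesis using repr_independence[OF _ that(1) N.subgroup_axioms] by simp
  qed
  have X: "N #> x = N #> p" "N #> y = N #> q" using coset c pn qm by auto
  have I: "N #> inv x = N #> inv p" "N #> inv y = N #> inv q"
    using N.rcos_inv X xyc c by metis+
  have "N #> (x \<otimes> y \<otimes> inv x \<otimes> inv y) = ((N #> x) <#> (N #> y)) <#> (N #> inv x) <#> (N #> inv y)"
    using xyc by (simp add: N.rcos_sum)
  also have "\<dots> = N #> (p \<otimes> q \<otimes> inv p \<otimes> inv q)" unfolding X I using c by (simp add: N.rcos_sum)
  finally have eq: "N #> (x \<otimes> y \<otimes> inv x \<otimes> inv y) = N #> (p \<otimes> q \<otimes> inv p \<otimes> inv q)" .
  have "x \<otimes> y \<otimes> inv x \<otimes> inv y \<in> N #> (x \<otimes> y \<otimes> inv x \<otimes> inv y)"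
    using xyc by (intro rcos_self[OF _ N.subgroup_axioms]) auto
  then have "x \<otimes> y \<otimes> inv x \<otimes> inv y \<in> (p \<otimes> q \<otimes> inv p \<otimes> inv q) <# N"
    unfolding eq using N.coset_eq c by simp
  then obtain k where "k \<in> N" "x \<otimes> y \<otimes> inv x \<otimes> inv y = (p \<otimes> q \<otimes> inv p \<otimes> inv q) \<otimes> k"
    unfolding l_coset_def by blast
  then show ?thesis using Q[OF pn(1) qm(1)] by (simp add: set_multI)
qed

lemma finite_index_bounded_mod:
  assumes H: "subgroup H G" and fin: "finite_index G H"
  shows "bounded_mod H (carrier G)"
proof -
  have Hc: "H \<subseteq> carrier G" using H by (rule subgroup.subset)
  define r where "r c = (SOME x. x \<in> carrier G \<and> c = H #> x)" for c
  have r: "r c \<in> carrier G \<and> c = H #> r c" if "c \<in> rcosets H" for c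
    unfolding r_def by (rule someI_ex) (use that in \<open>auto simp: RCOSETS_def\<close>)
  show ?thesis
  proof (rule bounded_modI[of "invs (r ` (rcosets H))"])
    show "finite (invs (r ` (rcosets H)))" using fin by (simp add: finite_index_def)
    show "invs (r ` (rcosets H)) \<subseteq> carrier G" using r by (intro invs_closed) blast
    show "carrier G \<subseteq> invs (r ` (rcosets H)) <#> H"
    proof
      fix g assume g: "g \<in> carrier G"
      define c where "c = H #> inv g"
      have c: "c \<in> rcosets H" unfolding c_def using g Hc by (intro rcosetsI) auto
      have "inv g \<in> H #> r c" using r[OF c] rcos_self[OF _ H, of "inv g"] g c_def by simp
      then obtain h where h: "h \<in> H" "inv g = h \<otimes> r c" by (auto simp: r_coset_def)
      have hc: "h \<in> carrier G" "r c \<in> carrier G" using h Hc r[OF c] by auto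
      have "g = inv (h \<otimes> r c)" using h(2) g by (metis inv_inv)
      then have "g = inv (r c) \<otimes> inv h" using hc by (simp add: inv_mult_group)
      then show "g \<in> invs (r ` (rcosets H)) <#> H"
        using c h(1) H by (simp add: set_multI invsI subgroup.m_inv_closed)
    qed
  qed
qed

text \<open>
  For \<open>x = u h\<close> with \<open>h \<in> H\<close>, the conjugates of \<open>H\<close> by \<open>x\<close> and by \<open>u\<close> agree. So the intersection of all
  conjugates is one over finitely many representatives \<open>u\<close>, and has finite index.
\<close>
lemma normal_core:
  assumes H: "subgroup H G" and fin: "bounded_mod H (carrier G)"
  obtains C where "finite_index_normal C" "C \<subseteq> H"
proof -
  have Hc: "H \<subseteq> carrier G" using H by (rule subgroup.subset)
  obtain F where F: "finite F" "F \<subseteq> carrier G" "carrier G \<subseteq> F <#> H" using fin unfolding bounded_mod_def by blast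
  define conj where "conj x = {g \<in> carrier G. inv x \<otimes> g \<otimes> x \<in> H}" for x
  have conj: "subgroup (conj x) G \<and> bounded_mod (conj x) (carrier G)" if x: "x \<in> carrier G" for x
  proof
    show "subgroup (conj x) G"
    proof (rule subgroupI)
      show "conj x \<subseteq> carrier G" by (auto simp: conj_def)
      have "\<one> \<in> conj x" using x subgroup.one_closed[OF H] by (simp add: conj_def)
      then show "conj x \<noteq> {}" by blast
    next
      fix g assume "g \<in> conj x"
      then have g: "g \<in> carrier G" "inv x \<otimes> g \<otimes> x \<in> H" by (auto simp: conj_def)
      have "inv (inv x \<otimes> g \<otimes> x) = inv x \<otimes> inv g \<otimes> x" using g(1) x by (simp add: inv_mult_group m_assoc)
      then show "inv g \<in> conj x" using g subgroup.m_inv_closed[OF H g(2)] by (simp add: conj_def)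
    next
      fix g h assume "g \<in> conj x" "h \<in> conj x"
      then have gh: "g \<in> carrier G" "inv x \<otimes> g \<otimes> x \<in> H" "h \<in> carrier G" "inv x \<otimes> h \<otimes> x \<in> H" by (auto simp: conj_def)
      have "(inv x \<otimes> g \<otimes> x) \<otimes> (inv x \<otimes> h \<otimes> x) = inv x \<otimes> (g \<otimes> h) \<otimes> x"
        using gh(1,3) x by (simp add: m_assoc mult_inv_cancel_left)
      then show "g \<otimes> h \<in> conj x" using gh subgroup.m_closed[OF H gh(2,4)] by (simp add: conj_def)
    qed
    show "bounded_mod (conj x) (carrier G)"
    proof (rule bounded_modI[of "F #> inv x"])
      show "finite (F #> inv x)" using F by (simp add: r_coset_def)
      show "F #> inv x \<subseteq> carrier G" using F x by (simp add: r_coset_subset_G)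
      show "carrier G \<subseteq> (F #> inv x) <#> conj x"
      proof
        fix g assume g: "g \<in> carrier G"
        have "g \<otimes> x \<in> F <#> H" using F(3) g x by auto
        then obtain u h where uh: "u \<in> F" "h \<in> H" "g \<otimes> x = u \<otimes> h" unfolding mem_set_mult by (elim bexE)
        have c: "u \<in> carrier G" "h \<in> carrier G" using uh F Hc by auto
        have "g = g \<otimes> x \<otimes> inv x" using g x by (simp add: m_assoc)
        also have "\<dots> = (u \<otimes> inv x) \<otimes> (x \<otimes> h \<otimes> inv x)" unfolding uh(3) using c x by (simp add: m_assoc inv_mult_cancel_left)
        finally have "g = (u \<otimes> inv x) \<otimes> (x \<otimes> h \<otimes> inv x)" .
        moreover have "x \<otimes> h \<otimes> inv x \<in> conj x" using c x uh(2) by (simp add: conj_def m_assoc inv_mult_cancel_left)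
        moreover have "u \<otimes> inv x \<in> F #> inv x" using uh(1) by (auto simp: r_coset_def)
        ultimately show "g \<in> (F #> inv x) <#> conj x" by (simp add: set_multI)
      qed
    qed
  qed
  have fin_conj: "\<exists>C. subgroup C G \<and> bounded_mod C (carrier G) \<and> C = {g \<in> carrier G. \<forall>x\<in>B. inv x \<otimes> g \<otimes> x \<in> H}"
    if "finite B" "B \<subseteq> carrier G" for B
    using that
  proof (induction B rule: finite_induct)
    case empty
    show ?case using finite_index_normal_carrier subgroup_self by (auto simp: finite_index_normal_def)
  next
    case (insert x B)
    then obtain C where C: "subgroup C G" "bounded_mod C (carrier G)" "C = {g \<in> carrier G. \<forall>x\<in>B. inv x \<otimes> g \<otimes> x \<in> H}" by auto
    have x: "x \<in> carrier G" using insert.prems by simp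
    have Cc: "C \<subseteq> carrier G" using C(1) by (rule subgroup.subset)
    have sub: "subgroup (C \<inter> conj x) G" using C(1) conj[OF x] subgroups_Inter_pair by blast
    have "bounded_mod (conj x) C" using bounded_mod_subset[OF conjunct2[OF conj[OF x]] Cc] .
    then have "bounded_mod (C \<inter> conj x) C" using C(1) conj[OF x] by (intro bounded_mod_Int) auto
    then have "bounded_mod (C \<inter> conj x) (carrier G)"
      using bounded_mod_index[OF _ C(2)] sub subgroup.subset by blast
    moreover have "C \<inter> conj x = {g \<in> carrier G. \<forall>x\<in>insert x B. inv x \<otimes> g \<otimes> x \<in> H}"
      unfolding C(3) conj_def by auto
    ultimately show ?case using sub by blast
  qed
  obtain C where C: "subgroup C G" "bounded_mod C (carrier G)" "C = {g \<in> carrier G. \<forall>x\<in>F. inv x \<otimes> g \<otimes> x \<in> H}"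
    using fin_conj[OF F(1,2)] by blast
  have all: "inv x \<otimes> g \<otimes> x \<in> H" if g: "g \<in> C" and x: "x \<in> carrier G" for g x
  proof -
    obtain u h where uh: "u \<in> F" "h \<in> H" "x = u \<otimes> h" using subsetD[OF F(3) x] unfolding mem_set_mult by (elim bexE)
    have c: "u \<in> carrier G" "h \<in> carrier G" "g \<in> carrier G" using uh F Hc g C(3) by auto
    have "inv u \<otimes> g \<otimes> u \<in> H" using g uh(1) C(3) by blast
    then have "inv h \<otimes> (inv u \<otimes> g \<otimes> u) \<otimes> h \<in> H" using uh(2) H by (simp add: subgroup.m_closed subgroup.m_inv_closed)
    also have "inv h \<otimes> (inv u \<otimes> g \<otimes> u) \<otimes> h = inv x \<otimes> g \<otimes> x" unfolding uh(3) using c by (simp add: inv_mult_group m_assoc)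
    finally show ?thesis .
  qed
  have "C \<lhd> G"
    unfolding normal_inv_iff
  proof (intro conjI ballI C(1))
    fix x g assume x: "x \<in> carrier G" and g: "g \<in> C"
    have gc: "g \<in> carrier G" using g C(3) by blast
    have "inv z \<otimes> (x \<otimes> g \<otimes> inv x) \<otimes> z \<in> H" if z: "z \<in> F" for z
    proof -
      have zc: "z \<in> carrier G" using z F by blast
      have "inv (inv x \<otimes> z) \<otimes> g \<otimes> (inv x \<otimes> z) \<in> H" using x zc by (intro all[OF g]) auto
      then show ?thesis using x zc gc by (simp add: inv_mult_group m_assoc)
    qed
    then show "x \<otimes> g \<otimes> inv x \<in> C" using x gc C(3) by auto
  qed
  moreover have "C \<subseteq> H"
  proof
    fix g assume g: "g \<in> C"
    have "inv \<one> \<otimes> g \<otimes> \<one> \<in> H" by (rule all[OF g one_closed])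
    then show "g \<in> H" using g C(3) by simp
  qed
  ultimately show ?thesis using that C(2) by (simp add: finite_index_normal_def)
qed

text \<open>
  The terms of the derived series need not be closed. Their closures are, and consecutive quotients remain abelian by
  \<open>profinite_closure_commutator\<close>.
\<close>
definition profinite_closure :: "'a set \<Rightarrow> 'a set" where
  "profinite_closure P = {g \<in> carrier G. \<forall>N. finite_index_normal N \<longrightarrow> g \<in> P <#> N}"

lemma profinite_closure_subset: "profinite_closure P \<subseteq> P <#> N" if "finite_index_normal N"
  using that by (auto simp: profinite_closure_def)

lemma subset_profinite_closure:
  assumes "P \<subseteq> carrier G" shows "P \<subseteq> profinite_closure P"
proof
  fix g assume g: "g \<in> P"
  have "g \<in> P <#> N" if "finite_index_normal N" for N
  proof -
    have "\<one> \<in> N" using that by (simp add: finite_index_normal_def normal_imp_subgroup subgroup.one_closed)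
    then have "g \<otimes> \<one> \<in> P <#> N" using g by (rule set_multI[rotated])
    then show ?thesis using g assms by (simp add: subset_iff)
  qed
  then show "g \<in> profinite_closure P" using g assms by (auto simp: profinite_closure_def)
qed

lemma profinite_closure_closed:
  assumes "P \<subseteq> carrier G" shows "profinitely_closed (profinite_closure P)"
  unfolding profinitely_closed_def
proof
  fix g assume "g \<in> carrier G - profinite_closure P"
  then obtain N where N: "finite_index_normal N" "g \<notin> P <#> N" by (auto simp: profinite_closure_def)
  have Ns: "subgroup N G" using N(1) by (simp add: finite_index_normal_def normal_imp_subgroup)
  have "profinite_closure P <#> N \<subseteq> (P <#> N) <#> N"
    by (rule mono_set_mult[OF profinite_closure_subset[OF N(1)] order.refl])
  also have "\<dots> = P <#> (N <#> N)" using assms Ns by (simp add: set_mult_assoc subgroup.subset)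
  also have "N <#> N = N" by (rule subgroup_mult_id[OF Ns])
  finally show "\<exists>N. finite_index_normal N \<and> g \<notin> profinite_closure P <#> N" using N by blast
qed

lemma profinite_closure_normal:
  assumes P: "P \<lhd> G" shows "profinite_closure P \<lhd> G"
proof -
  have PN: "P <#> N \<lhd> G" if "finite_index_normal N" for N
    using that normal_subgroup_set_mult_closed[OF P] by (simp add: finite_index_normal_def)
  have eq: "profinite_closure P = \<Inter> ((\<lambda>N. P <#> N) ` {N. finite_index_normal N})"
  proof
    show "\<Inter> ((\<lambda>N. P <#> N) ` {N. finite_index_normal N}) \<subseteq> profinite_closure P"
    proof
      fix g assume g: "g \<in> \<Inter> ((\<lambda>N. P <#> N) ` {N. finite_index_normal N})"
      then have "g \<in> P <#> carrier G" using finite_index_normal_carrier by blast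
      then have "g \<in> carrier G"
        using set_mult_closed[of P "carrier G"] P by (auto simp: normal_imp_subgroup subgroup.subset)
      then show "g \<in> profinite_closure P" using g by (auto simp: profinite_closure_def)
    qed
  qed (auto simp: profinite_closure_def)
  show ?thesis
    unfolding normal_inv_iff
  proof (intro conjI ballI)
    show "subgroup (profinite_closure P) G"
      unfolding eq
    proof (rule subgroups_Inter)
      show "(\<lambda>N. P <#> N) ` {N. finite_index_normal N} \<noteq> {}" using finite_index_normal_carrier by blast
    qed (use PN in \<open>auto intro: normal_imp_subgroup\<close>)
    fix x g assume "x \<in> carrier G" "g \<in> profinite_closure P"
    then show "x \<otimes> g \<otimes> inv x \<in> profinite_closure P"
      unfolding eq using PN by (auto simp: normal_inv_iff)
  qed
qed

lemma profinite_closure_mono: "P \<subseteq> Q \<Longrightarrow> profinite_closure P \<subseteq> profinite_closure Q"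
  using mono_set_mult[of P Q] by (fastforce simp: profinite_closure_def)

lemma derived_normal:
  assumes "C \<lhd> G" shows "(derived G ^^ n) C \<lhd> G"
  using assms by (induction n) (auto intro: derived_is_normal)

lemma commutator_in_derived:
  assumes "x \<in> P" "y \<in> P" shows "x \<otimes> y \<otimes> inv x \<otimes> inv y \<in> derived G P"
  unfolding derived_def using assms by (intro generate.incl) blast

lemma profinite_closure_commutator:
  assumes P: "P \<lhd> G" and xy: "x \<in> profinite_closure P" "y \<in> profinite_closure P"
  shows "x \<otimes> y \<otimes> inv x \<otimes> inv y \<in> profinite_closure (derived G P)"
proof -
  have c: "x \<in> carrier G" "y \<in> carrier G" using xy by (auto simp: profinite_closure_def)
  have Pc: "P \<subseteq> carrier G" using P by (simp add: normal_imp_subgroup subgroup.subset)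
  have "x \<otimes> y \<otimes> inv x \<otimes> inv y \<in> derived G P <#> N" if N: "finite_index_normal N" for N
  proof (rule commutator_mult_closed[OF P _ _ _ commutator_in_derived])
    show "N \<lhd> G" using N by (simp add: finite_index_normal_def)
    show "x \<in> P <#> N" "y \<in> P <#> N" using xy profinite_closure_subset[OF N] by auto
    show "derived G P \<subseteq> carrier G" by (rule derived_in_carrier[OF Pc])
  qed
  then show ?thesis using c by (simp add: profinite_closure_def)
qed

lemma derived_series_restrict:
  assumes "subgroup H G" shows "(derived (G\<lparr>carrier := H\<rparr>) ^^ n) H = (derived G ^^ n) H"
proof (induction n)
  case (Suc n)
  have "(derived G ^^ n) H \<subseteq> H"
  proof (induction n)
    case (Suc n) then show ?case using derived_incl[OF _ assms] by simp
  qed simp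
  then show ?case using Suc derived_consistent[OF _ assms] by simp
qed simp

lemma virtually_solvable_core:
  assumes "virtually_solvable G"
  obtains C n where "finite_index_normal C" "(derived G ^^ n) C \<subseteq> {\<one>}"
proof -
  obtain H where H: "subgroup H G" "finite_index G H" "solvable (G\<lparr>carrier := H\<rparr>)"
    using assms by (auto simp: virtually_solvable_def)
  interpret H: group "G\<lparr>carrier := H\<rparr>" using H(1) by (rule subgroup_imp_group)
  obtain n where "(derived (G\<lparr>carrier := H\<rparr>) ^^ n) H = {\<one>}"
    using H.solvable_imp_trivial_derived_seq[of H] H(3) by (auto simp: solvable_def)
  then have n: "(derived G ^^ n) H = {\<one>}" using derived_series_restrict[OF H(1)] by simp
  obtain C where C: "finite_index_normal C" "C \<subseteq> H"
    using normal_core[OF H(1) finite_index_bounded_mod[OF H(1,2)]] by blast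
  have "(derived G ^^ n) C \<subseteq> {\<one>}" using mono_exp_of_derived[OF C(2), of n] n by simp
  then show ?thesis using that C(1) by blast
qed

lemma residually_finite_closure:
  assumes "residually_finite G" shows "profinite_closure {\<one>} = {\<one>}"
proof
  show "profinite_closure {\<one>} \<subseteq> {\<one>}"
  proof (rule ccontr)
    assume "\<not> ?thesis"
    then obtain g where g: "g \<in> profinite_closure {\<one>}" "g \<noteq> \<one>" by blast
    then have gc: "g \<in> carrier G" by (simp add: profinite_closure_def)
    obtain N where N: "N \<lhd> G" "finite_index G N" "g \<notin> N"
      using assms g(2) gc by (auto simp: residually_finite_def)
    have "finite_index_normal N"
      using N finite_index_bounded_mod[OF normal_imp_subgroup[OF N(1)]] by (simp add: finite_index_normal_def)
    then have "g \<in> {\<one>} <#> N" using g(1) by (simp add: profinite_closure_def)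
    then obtain k where k: "k \<in> N" "g = \<one> \<otimes> k" unfolding mem_set_mult by blast
    then have "g \<in> N" using subgroup.mem_carrier[OF normal_imp_subgroup[OF N(1)] k(1)] by simp
    then show False using N(3) by contradiction
  qed
  show "{\<one>} \<subseteq> profinite_closure {\<one>}" by (intro subset_profinite_closure) auto
qed

end

section \<open>Supports\<close>

text \<open>
  The expansivity constant \<open>\<Delta>\<close> is fixed once and for all; it also serves as the threshold below which a point
  counts as zero.
\<close>
locale shadowing_system = pointed_dynamical_system G X act zero
  for G :: "('g, 'm) monoid_scheme" (structure)
    and X :: "'x::metric_space set"
    and act :: "'g \<Rightarrow> 'x \<Rightarrow> 'x"
    and zero :: 'x +
  fixes S :: "'g set" and f :: "'x \<Rightarrow> 'x" and \<Delta> :: real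
  assumes finite_S: "finite S"
    and S_closed: "S \<subseteq> carrier G"
    and \<Delta>_pos: "0 < \<Delta>"
    and expansivity: "\<And>x y. x \<in> X \<Longrightarrow> y \<in> X \<Longrightarrow>
          (\<And>g. g \<in> carrier G \<Longrightarrow> dist (act g x) (act g y) \<le> \<Delta>) \<Longrightarrow> x = y"
    and shadowing: "shadowing_property G S X act"
    and endo: "system_endomorphism G X act zero f"
    and asymp: "asymptotically_nilpotent X zero f"

sublocale shadowing_system \<subseteq> group G
  using group_hom group_hom.axioms(1) by blast

context shadowing_system begin

lemma act_closed [simp]: "g \<in> carrier G \<Longrightarrow> x \<in> X \<Longrightarrow> act g x \<in> X"
  using element_image by blast

lemma act_mult: "g \<in> carrier G \<Longrightarrow> h \<in> carrier G \<Longrightarrow> x \<in> X \<Longrightarrow> act (g \<otimes> h) x = act g (act h x)"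
  using composition_rule by blast

lemma act_one [simp]: "x \<in> X \<Longrightarrow> act \<one> x = x"
  using id_eq_one by (metis restrict_apply')

lemma act_inv [simp]: "g \<in> carrier G \<Longrightarrow> x \<in> X \<Longrightarrow> act (inv g) (act g x) = x"
  using act_mult[of "inv g" g x] by simp

lemma act_inv' [simp]: "g \<in> carrier G \<Longrightarrow> x \<in> X \<Longrightarrow> act g (act (inv g) x) = x"
  using act_mult[of g "inv g" x] by simp

lemma zero_X [simp]: "zero \<in> X" by (rule zero_in)
lemma act_zero_simp [simp]: "g \<in> carrier G \<Longrightarrow> act g zero = zero" by (rule act_zero)

lemma fn_closed [simp]: "x \<in> X \<Longrightarrow> (f ^^ n) x \<in> X"
  using endo unfolding system_endomorphism_def by (induction n) auto

lemma fn_zero [simp]: "(f ^^ n) zero = zero"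
  using endo unfolding system_endomorphism_def by (induction n) auto

lemma fn_act: "g \<in> carrier G \<Longrightarrow> x \<in> X \<Longrightarrow> (f ^^ n) (act g x) = act g ((f ^^ n) x)"
  using endo unfolding system_endomorphism_def by (induction n) auto

lemma fn_continuous: "continuous_on X (f ^^ n)"
proof (induction n)
  case (Suc n)
  have "continuous_on ((f ^^ n) ` X) f"
    using endo unfolding system_endomorphism_def by (metis (no_types) continuous_on_subset fn_closed image_subsetI)
  then show ?case using continuous_on_compose[OF Suc] by simp
qed (simp add: continuous_on_id id_def)

text \<open>
  Values of \<open>t\<close> below \<open>\<Delta>\<close> are needed because gluing costs an \<open>\<epsilon>\<close>: only a support at a smaller threshold
  controls the support of a glued point.
\<close>
definition suppt :: "real \<Rightarrow> 'x \<Rightarrow> 'g set" where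
  "suppt t x = {g \<in> carrier G. t < dist (act g x) zero}"

abbreviation supp :: "'x \<Rightarrow> 'g set" where "supp \<equiv> suppt \<Delta>"

lemma suppt_closed [simp]: "suppt t x \<subseteq> carrier G"
  by (auto simp: suppt_def)

lemma suppt_closedD: "g \<in> suppt t x \<Longrightarrow> g \<in> carrier G"
  by (auto simp: suppt_def)

lemma suppt_antimono: "s \<le> t \<Longrightarrow> suppt t x \<subseteq> suppt s x"
  by (auto simp: suppt_def)

lemma mem_suppt_act:
  "h \<in> carrier G \<Longrightarrow> g \<in> carrier G \<Longrightarrow> x \<in> X \<Longrightarrow> h \<in> suppt t (act g x) \<longleftrightarrow> h \<otimes> g \<in> suppt t x"
  by (auto simp: suppt_def act_mult)

lemma suppt_act:
  assumes "g \<in> carrier G" "x \<in> X" shows "suppt t (act g x) = suppt t x #> inv g"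
proof
  show "suppt t (act g x) \<subseteq> suppt t x #> inv g"
  proof
    fix h assume h: "h \<in> suppt t (act g x)"
    then have hc: "h \<in> carrier G" by (rule suppt_closedD)
    have "h = (h \<otimes> g) \<otimes> inv g" using hc assms by (simp add: m_assoc)
    then show "h \<in> suppt t x #> inv g" using h hc mem_suppt_act assms by (fastforce simp: r_coset_def)
  qed
  show "suppt t x #> inv g \<subseteq> suppt t (act g x)"
  proof
    fix h assume "h \<in> suppt t x #> inv g"
    then obtain k where k: "k \<in> suppt t x" "h = k \<otimes> inv g" by (auto simp: r_coset_def)
    then have "k \<in> carrier G" by (simp add: suppt_closedD)
    then show "h \<in> suppt t (act g x)" using k assms by (simp add: mem_suppt_act m_assoc)
  qed
qed

lemma suppt_zero [simp]: "t \<ge> 0 \<Longrightarrow> suppt t zero = {}"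
  by (auto simp: suppt_def)

lemma supp_empty: "x \<in> X \<Longrightarrow> supp x = {} \<Longrightarrow> x = zero"
  by (rule expansivity) (auto simp: suppt_def)

lemma supp_iff: "g \<in> carrier G \<Longrightarrow> g \<notin> suppt t x \<longleftrightarrow> dist (act g x) zero \<le> t"
  by (auto simp: suppt_def)

lemma continuous_act_fn: "g \<in> carrier G \<Longrightarrow> continuous_on X (\<lambda>x. act g ((f ^^ n) x))"
  by (rule continuous_on_compose2[OF continuous_act fn_continuous]) auto

text \<open>
  The closed sets of pairs at distance at least \<open>\<eta>\<close> whose images under \<open>h\<close> are \<open>\<Delta>\<close>-close have no common
  point as \<open>h\<close> varies; by compactness finitely many of them suffice.
\<close>
lemma uniform_expansivity:
  assumes "\<eta> > 0"
  obtains E where "finite E" "E \<subseteq> carrier G"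
    "\<And>x y. x \<in> X \<Longrightarrow> y \<in> X \<Longrightarrow> (\<And>h. h \<in> E \<Longrightarrow> dist (act h x) (act h y) \<le> \<Delta>) \<Longrightarrow> dist x y < \<eta>"
proof -
  define C where "C h = {p \<in> X \<times> X. dist (act h (fst p)) (act h (snd p)) \<le> \<Delta> \<and> \<eta> \<le> dist (fst p) (snd p)}" for h
  have cX: "closed (X \<times> X)" using compact_space by (simp add: compact_imp_closed closed_Times)
  have clC: "closed (C h)" if "h \<in> carrier G" for h
  proof -
    have c1: "continuous_on (X \<times> X) (\<lambda>p. dist (act h (fst p)) (act h (snd p)))"
      by (intro continuous_on_dist continuous_on_compose2[OF continuous_act[OF that]] continuous_intros) auto
    have c2: "continuous_on (X \<times> X) (\<lambda>p::'x \<times> 'x. dist (fst p) (snd p))" by (intro continuous_intros)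
    have "C h = {p \<in> X \<times> X. dist (act h (fst p)) (act h (snd p)) \<in> {..\<Delta>}} \<inter> {p \<in> X \<times> X. dist (fst p) (snd p) \<in> {\<eta>..}}"
      by (auto simp: C_def)
    moreover have "closed {p \<in> X \<times> X. dist (act h (fst p)) (act h (snd p)) \<in> {..\<Delta>}}"
      using continuous_closed_preimage[OF c1 cX closed_atMost, of \<Delta>] by (simp add: vimage_def Int_def)
    moreover have "closed {p \<in> X \<times> X. dist (fst p) (snd p) \<in> {\<eta>..}}"
      using continuous_closed_preimage[OF c2 cX closed_atLeast, of \<eta>] by (simp add: vimage_def Int_def)
    ultimately show ?thesis by (simp add: closed_Int)
  qed
  have emp: "(X \<times> X) \<inter> \<Inter>(C ` carrier G) = {}"
  proof (rule ccontr)
    assume "(X \<times> X) \<inter> \<Inter>(C ` carrier G) \<noteq> {}"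
    then obtain p where p: "p \<in> X \<times> X" "\<And>h. h \<in> carrier G \<Longrightarrow> p \<in> C h" by blast
    have "fst p = snd p" by (rule expansivity) (use p in \<open>auto simp: C_def\<close>)
    moreover have "\<eta> \<le> dist (fst p) (snd p)" using p(2)[OF one_closed] by (simp add: C_def)
    ultimately show False using assms by simp
  qed
  have "\<exists>E. finite E \<and> E \<subseteq> carrier G \<and> (X \<times> X) \<inter> \<Inter>(C ` E) = {}"
  proof (rule ccontr)
    assume no: "\<not> ?thesis"
    have "(X \<times> X) \<inter> \<Inter>(C ` carrier G) \<noteq> {}"
    proof (rule compact_imp_fip_image)
      show "compact (X \<times> X)" using compact_space by (simp add: compact_Times)
      show "\<And>h. h \<in> carrier G \<Longrightarrow> closed (C h)" by (rule clC)
      show "\<And>E. finite E \<Longrightarrow> E \<subseteq> carrier G \<Longrightarrow> (X \<times> X) \<inter> \<Inter>(C ` E) \<noteq> {}"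
        using no by blast
    qed
    then show False using emp by contradiction
  qed
  then obtain E where E: "finite E" "E \<subseteq> carrier G" "(X \<times> X) \<inter> \<Inter>(C ` E) = {}" by blast
  show ?thesis
  proof
    show "finite E" "E \<subseteq> carrier G" using E by auto
    fix x y assume xy: "x \<in> X" "y \<in> X" "\<And>h. h \<in> E \<Longrightarrow> dist (act h x) (act h y) \<le> \<Delta>"
    then obtain h where "h \<in> E" "(x, y) \<notin> C h" using E(3) by blast
    then show "dist x y < \<eta>" using xy by (simp add: C_def not_le)
  qed
qed

text \<open>
  The analogue of the block map of a cellular automaton: the behaviour of the \<open>n\<close>-th iterate at \<open>g\<close> is determined, up to
  \<open>\<eta>\<close>, by agreement on the finite neighbourhood \<open>E g\<close>.
\<close>
lemma locality:
  assumes "\<eta> > 0"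
  obtains E where "finite E" "E \<subseteq> carrier G"
    "\<And>x y g. x \<in> X \<Longrightarrow> y \<in> X \<Longrightarrow> g \<in> carrier G \<Longrightarrow>
       (\<And>h. h \<in> E \<Longrightarrow> dist (act (h \<otimes> g) x) (act (h \<otimes> g) y) \<le> \<Delta>) \<Longrightarrow>
       dist (act g ((f ^^ n) x)) (act g ((f ^^ n) y)) < \<eta>"
proof -
  have "uniformly_continuous_on X (f ^^ n)"
    by (rule compact_uniformly_continuous[OF fn_continuous compact_space])
  then obtain d where d: "d > 0" "\<And>x y. x \<in> X \<Longrightarrow> y \<in> X \<Longrightarrow> dist x y < d \<Longrightarrow> dist ((f ^^ n) x) ((f ^^ n) y) < \<eta>"
    using assms unfolding uniformly_continuous_on_def by (metis dist_commute)
  obtain E where E: "finite E" "E \<subseteq> carrier G"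
    "\<And>x y. x \<in> X \<Longrightarrow> y \<in> X \<Longrightarrow> (\<And>h. h \<in> E \<Longrightarrow> dist (act h x) (act h y) \<le> \<Delta>) \<Longrightarrow> dist x y < d"
    using uniform_expansivity[OF d(1)] by blast
  show ?thesis
  proof
    show "finite E" "E \<subseteq> carrier G" using E by auto
    fix x y g assume *: "x \<in> X" "y \<in> X" "g \<in> carrier G"
       "\<And>h. h \<in> E \<Longrightarrow> dist (act (h \<otimes> g) x) (act (h \<otimes> g) y) \<le> \<Delta>"
    have "dist (act g x) (act g y) < d"
      by (rule E(3)) (use * E(2) in \<open>auto simp: act_mult[symmetric] subset_iff\<close>)
    then have "dist ((f ^^ n) (act g x)) ((f ^^ n) (act g y)) < \<eta>" using * d(2) by simp
    then show "dist (act g ((f ^^ n) x)) (act g ((f ^^ n) y)) < \<eta>" using * by (simp add: fn_act)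
  qed
qed

lemma suppt_fn:
  assumes "t > 0"
  obtains E where "finite E" "E \<subseteq> carrier G" "\<And>x. x \<in> X \<Longrightarrow> suppt t ((f ^^ n) x) \<subseteq> E <#> supp x"
proof -
  obtain E where E: "finite E" "E \<subseteq> carrier G"
    "\<And>x y g. x \<in> X \<Longrightarrow> y \<in> X \<Longrightarrow> g \<in> carrier G \<Longrightarrow>
       (\<And>h. h \<in> E \<Longrightarrow> dist (act (h \<otimes> g) x) (act (h \<otimes> g) y) \<le> \<Delta>) \<Longrightarrow>
       dist (act g ((f ^^ n) x)) (act g ((f ^^ n) y)) < t"
    using locality[OF assms] by blast
  show ?thesis
  proof
    show "finite (invs E)" "invs E \<subseteq> carrier G" using E by auto
    fix x assume x: "x \<in> X"
    show "suppt t ((f ^^ n) x) \<subseteq> invs E <#> supp x"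
    proof
      fix g assume g: "g \<in> suppt t ((f ^^ n) x)"
      then have gc: "g \<in> carrier G" by (rule suppt_closedD)
      have "\<exists>h\<in>E. h \<otimes> g \<in> supp x"
      proof (rule ccontr)
        assume no: "\<not> ?thesis"
        have "dist (act g ((f ^^ n) x)) (act g ((f ^^ n) zero)) < t"
        proof (rule E(3)[OF x zero_X gc])
          fix h assume h: "h \<in> E"
          then have hc: "h \<in> carrier G" using E by auto
          have "h \<otimes> g \<notin> supp x" using no h by blast
          then show "dist (act (h \<otimes> g) x) (act (h \<otimes> g) zero) \<le> \<Delta>" using hc gc by (simp add: supp_iff)
        qed
        then show False using g gc by (simp add: suppt_def)
      qed
      then obtain h where h: "h \<in> E" "h \<otimes> g \<in> supp x" by blast
      have "h \<in> carrier G" using h E by auto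
      then have "g = inv h \<otimes> (h \<otimes> g)" using gc by (simp add: inv_mult_cancel_left)
      then show "g \<in> invs E <#> supp x" using h by (auto simp: invs_def mem_set_mult)
    qed
  qed
qed

lemma suppt_supp:
  assumes "t > 0"
  obtains E where "finite E" "E \<subseteq> carrier G" "\<And>x. x \<in> X \<Longrightarrow> suppt t x \<subseteq> E <#> supp x"
  using suppt_fn[OF assms, of 0] by (auto simp: id_def)

text \<open>
  The inequality defining the support is strict, so agreement on a large enough finite set preserves it.
\<close>
lemma supp_fn_open:
  assumes "x \<in> X" "t \<in> supp ((f ^^ n) x)"
  obtains E where "finite E" "E \<subseteq> carrier G"
    "\<And>y. y \<in> X \<Longrightarrow> (\<And>h. h \<in> E \<Longrightarrow> dist (act h y) (act h x) \<le> \<Delta>) \<Longrightarrow> t \<in> supp ((f ^^ n) y)"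
proof -
  have tc: "t \<in> carrier G" using assms suppt_closedD by blast
  define \<eta> where "\<eta> = dist (act t ((f ^^ n) x)) zero - \<Delta>"
  have "\<eta> > 0" using assms by (auto simp: \<eta>_def suppt_def)
  then obtain E where E: "finite E" "E \<subseteq> carrier G"
    "\<And>x y g. x \<in> X \<Longrightarrow> y \<in> X \<Longrightarrow> g \<in> carrier G \<Longrightarrow>
       (\<And>h. h \<in> E \<Longrightarrow> dist (act (h \<otimes> g) x) (act (h \<otimes> g) y) \<le> \<Delta>) \<Longrightarrow>
       dist (act g ((f ^^ n) x)) (act g ((f ^^ n) y)) < \<eta>"
    using locality[where n = n and \<eta> = \<eta>] by blast
  show ?thesis
  proof
    show "finite (E #> t)" using E by (simp add: r_coset_def)
    show "E #> t \<subseteq> carrier G" using E tc by (simp add: r_coset_subset_G)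
    fix y assume y: "y \<in> X" "\<And>h. h \<in> E #> t \<Longrightarrow> dist (act h y) (act h x) \<le> \<Delta>"
    have "dist (act t ((f ^^ n) y)) (act t ((f ^^ n) x)) < \<eta>"
      by (rule E(3)[OF y(1) assms(1) tc]) (use y in \<open>auto simp: r_coset_def\<close>)
    moreover have "dist (act t ((f ^^ n) x)) zero \<le> dist (act t ((f ^^ n) y)) (act t ((f ^^ n) x)) + dist (act t ((f ^^ n) y)) zero"
      by (metis dist_triangle dist_commute)
    ultimately show "t \<in> supp ((f ^^ n) y)" using tc by (simp add: suppt_def \<eta>_def)
  qed
qed

lemma eventually_off:
  assumes "x \<in> X" "finite T" "T \<subseteq> carrier G"
  obtains N where "\<And>n. n \<ge> N \<Longrightarrow> T \<inter> supp ((f ^^ n) x) = {}"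
proof -
  have "\<forall>t\<in>T. eventually (\<lambda>n. t \<notin> supp ((f ^^ n) x)) sequentially"
  proof
    fix t assume t: "t \<in> T"
    then have tc: "t \<in> carrier G" using assms by auto
    have lim: "(\<lambda>n. (f ^^ n) (act t x)) \<longlonglongrightarrow> zero"
      using asymp assms tc unfolding asymptotically_nilpotent_def by simp
    have "eventually (\<lambda>n. dist ((f ^^ n) (act t x)) zero < \<Delta>) sequentially"
      using tendstoD[OF lim \<Delta>_pos] .
    then show "eventually (\<lambda>n. t \<notin> supp ((f ^^ n) x)) sequentially"
      by eventually_elim (use assms tc in \<open>auto simp: suppt_def fn_act\<close>)
  qed
  then have "eventually (\<lambda>n. \<forall>t\<in>T. t \<notin> supp ((f ^^ n) x)) sequentially"
    using assms(2) by (simp add: eventually_ball_finite)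
  then obtain N where "\<And>n. n \<ge> N \<Longrightarrow> \<forall>t\<in>T. t \<notin> supp ((f ^^ n) x)"
    unfolding eventually_sequentially by blast
  then show ?thesis using that by blast
qed

end

section \<open>Gluing points with separated supports\<close>

context shadowing_system begin

text \<open>
  A patch is a point together with a region containing its support. Regions instead of supports are kept apart from each
  other, because regions survive the replacement of the points by approximations.
\<close>
definition patches :: "('x \<times> 'g set) set \<Rightarrow> bool" where
  "patches P \<longleftrightarrow> (\<forall>p\<in>P. fst p \<in> X \<and> snd p \<subseteq> carrier G \<and> supp (fst p) \<subseteq> snd p)"

definition separated :: "'g set \<Rightarrow> ('x \<times> 'g set) set \<Rightarrow> bool" where
  "separated J P \<longleftrightarrow> (\<forall>p\<in>P. \<forall>q\<in>P. p \<noteq> q \<longrightarrow> (J <#> snd p) \<inter> (J <#> snd q) = {})"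

text \<open>
  The value at \<open>g\<close> is prescribed by a patch as soon as no other patch is near \<open>g\<close>, even outside the neighbourhood of
  its region; this makes comparisons with a single patch immediate.
\<close>
definition shadows :: "real \<Rightarrow> 'g set \<Rightarrow> ('x \<times> 'g set) set \<Rightarrow> 'x \<Rightarrow> bool" where
  "shadows \<epsilon> J P y \<longleftrightarrow>
     (\<forall>p\<in>P. \<forall>g\<in>carrier G. (\<forall>q\<in>P. q \<noteq> p \<longrightarrow> g \<notin> J <#> snd q) \<longrightarrow> dist (act g y) (act g (fst p)) < \<epsilon>) \<and>
     (\<forall>g\<in>carrier G. (\<forall>q\<in>P. g \<notin> J <#> snd q) \<longrightarrow> dist (act g y) zero < \<epsilon>)"

definition glueing :: "real \<Rightarrow> 'g set \<Rightarrow> bool" where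
  "glueing \<epsilon> J \<longleftrightarrow> finite J \<and> J \<subseteq> carrier G \<and> \<one> \<in> J \<and>
     (\<forall>P. patches P \<longrightarrow> separated J P \<longrightarrow> (\<exists>y\<in>X. shadows \<epsilon> J P y))"

lemma shadowsD1:
  "shadows \<epsilon> J P y \<Longrightarrow> p \<in> P \<Longrightarrow> g \<in> carrier G \<Longrightarrow> (\<And>q. q \<in> P \<Longrightarrow> q \<noteq> p \<Longrightarrow> g \<notin> J <#> snd q) \<Longrightarrow>
     dist (act g y) (act g (fst p)) < \<epsilon>"
  by (auto simp: shadows_def)

lemma shadowsD2:
  "shadows \<epsilon> J P y \<Longrightarrow> g \<in> carrier G \<Longrightarrow> (\<And>q. q \<in> P \<Longrightarrow> g \<notin> J <#> snd q) \<Longrightarrow> dist (act g y) zero < \<epsilon>"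
  by (auto simp: shadows_def)

lemma patches_subset: "patches P \<Longrightarrow> Q \<subseteq> P \<Longrightarrow> patches Q"
  unfolding patches_def by (meson subsetD)

lemma separated_subset: "separated A P \<Longrightarrow> Q \<subseteq> P \<Longrightarrow> separated A Q"
  unfolding separated_def by (meson subsetD)

lemma separated_unique:
  assumes "separated J P" "p \<in> P" "q \<in> P" "g \<in> J <#> snd p" "g \<in> J <#> snd q"
  shows "q = p"
proof (rule ccontr)
  assume "q \<noteq> p"
  then have "(J <#> snd q) \<inter> (J <#> snd p) = {}" using assms(1-3) by (simp add: separated_def)
  then show False using assms(4,5) by blast
qed

lemma separated_cases:
  assumes "separated J P"
  obtains (none) "\<And>q. q \<in> P \<Longrightarrow> g \<notin> J <#> snd q"
    | (one) p where "p \<in> P" "g \<in> J <#> snd p" "\<And>q. q \<in> P \<Longrightarrow> q \<noteq> p \<Longrightarrow> g \<notin> J <#> snd q"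
proof (cases "\<exists>p\<in>P. g \<in> J <#> snd p")
  case True
  then obtain p where p: "p \<in> P" "g \<in> J <#> snd p" by blast
  have "g \<notin> J <#> snd q" if "q \<in> P" "q \<noteq> p" for q
    using separated_unique[OF assms p(1) that(1) p(2)] that by blast
  then show ?thesis using p one by blast
qed (use none in blast)

text \<open>
  Following the orbit of a patch near its region and resting at \<open>zero\<close> elsewhere is a pseudo-orbit: the
  margin \<open>J\<close> is so wide that on its boundary every patch is already close to \<open>zero\<close>.
\<close>
lemma glueing_exists:
  assumes "\<epsilon> > 0"
  obtains J where "glueing \<epsilon> J"
proof -
  obtain d where d: "d > 0" "\<And>u. u \<in> carrier G \<rightarrow> X \<Longrightarrow>
      (\<And>g s. g \<in> carrier G \<Longrightarrow> s \<in> S \<Longrightarrow> dist (act s (u g)) (u (s \<otimes> g)) < d) \<Longrightarrow>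
      \<exists>y\<in>X. \<forall>g\<in>carrier G. dist (u g) (act g y) < \<epsilon> / 2"
    using shadowing assms unfolding shadowing_property_def by (metis half_gt_zero)
  define t where "t = min (d / 3) (\<epsilon> / 3)"
  have t: "t > 0" "2 * t < d" "2 * t < \<epsilon>" using d(1) assms by (auto simp: t_def)
  obtain E where E: "finite E" "E \<subseteq> carrier G" "\<And>x. x \<in> X \<Longrightarrow> suppt t x \<subseteq> E <#> supp x"
    using suppt_supp[OF t(1)] by blast
  define J where "J = insert \<one> (E \<union> (invs S <#> E))"
  have J: "finite J" "J \<subseteq> carrier G" "\<one> \<in> J"
    using E finite_S S_closed by (auto simp: J_def set_mult_closed)
  have small: "dist (act g x) zero \<le> t" if "x \<in> X" "supp x \<subseteq> V" "g \<in> carrier G" "g \<notin> E <#> V" for x V g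
  proof -
    have "E <#> supp x \<subseteq> E <#> V" using that by (intro mono_set_mult) auto
    then have "g \<notin> suppt t x" using E(3)[OF that(1)] that by blast
    then show ?thesis using that by (simp add: supp_iff)
  qed
  have EJ: "g \<in> J <#> V" if "g \<in> E <#> V" for g V
    using that mono_set_mult[of E J V V] by (auto simp: J_def)
  have SEJ: "g \<in> J <#> V" if "s \<otimes> g \<in> E <#> V" "s \<in> S" "g \<in> carrier G" "V \<subseteq> carrier G" for g V s
  proof -
    have sc: "s \<in> carrier G" using that S_closed by auto
    have "g = inv s \<otimes> (s \<otimes> g)" using that sc by (simp add: inv_mult_cancel_left)
    then have "g \<in> invs S <#> (E <#> V)" using that by (metis set_multI invsI)
    also have "\<dots> = (invs S <#> E) <#> V" using S_closed E that by (simp add: set_mult_assoc)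
    also have "\<dots> \<subseteq> J <#> V" by (intro mono_set_mult) (auto simp: J_def)
    finally show ?thesis .
  qed
  have "\<exists>y\<in>X. shadows \<epsilon> J P y" if P: "patches P" and sep: "separated J P" for P
  proof -
    define u where "u g = (if \<exists>p\<in>P. g \<in> J <#> snd p then act g (fst (SOME p. p \<in> P \<and> g \<in> J <#> snd p)) else zero)" for g
    have uniq: "q = p" if "p \<in> P" "q \<in> P" "g \<in> J <#> snd p" "g \<in> J <#> snd q" for p q g
      using separated_unique[OF sep that] .
    have u1: "u g = act g (fst p)" if "p \<in> P" "g \<in> J <#> snd p" for p g
    proof -
      have "(SOME p. p \<in> P \<and> g \<in> J <#> snd p) = p"
        using uniq that by (intro some_equality) auto
      then show ?thesis using that by (auto simp: u_def)
    qed
    have u0: "u g = zero" if "\<And>p. p \<in> P \<Longrightarrow> g \<notin> J <#> snd p" for g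
      using that by (auto simp: u_def)
    have PD: "fst p \<in> X" "snd p \<subseteq> carrier G" "supp (fst p) \<subseteq> snd p" if "p \<in> P" for p
      using P that by (auto simp: patches_def)
    have uX: "u \<in> carrier G \<rightarrow> X"
    proof
      fix g assume g: "g \<in> carrier G"
      show "u g \<in> X"
        by (rule separated_cases[OF sep, of g]) (use g u0 u1 PD in auto)
    qed
    have pseudo: "dist (act s (u g)) (u (s \<otimes> g)) < d" if g: "g \<in> carrier G" and s: "s \<in> S" for g s
    proof -
      have sc: "s \<in> carrier G" and sg: "s \<otimes> g \<in> carrier G" using s S_closed g by auto
      \<comment> \<open>crossing the boundary of a patch, the orbit of its point is already within \<open>t\<close> of \<open>zero\<close>\<close>
      have out: "dist (act (s \<otimes> g) (fst p)) zero \<le> t" if "p \<in> P" "s \<otimes> g \<notin> J <#> snd p" for p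
        using that EJ by (intro small[OF PD(1,3)[OF that(1)] sg]) auto
      have inn: "dist (act (s \<otimes> g) (fst p)) zero \<le> t" if "p \<in> P" "g \<notin> J <#> snd p" for p
        using that SEJ[OF _ s g PD(2)[OF that(1)]] by (intro small[OF PD(1,3)[OF that(1)] sg]) auto
      have a1: "act s (u g) = act (s \<otimes> g) (fst p)" if "p \<in> P" "g \<in> J <#> snd p" for p
        using u1[OF that] act_mult[OF sc g PD(1)[OF that(1)]] by simp
      have a0: "act s (u g) = zero" if "\<And>p. p \<in> P \<Longrightarrow> g \<notin> J <#> snd p"
        using u0[OF that] sc by simp
      show ?thesis
      proof (rule separated_cases[OF sep, of g]; rule separated_cases[OF sep, of "s \<otimes> g"])
        fix p q assume p: "p \<in> P" "g \<in> J <#> snd p" and po: "\<And>r. r \<in> P \<Longrightarrow> r \<noteq> p \<Longrightarrow> g \<notin> J <#> snd r"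
           and q: "q \<in> P" "s \<otimes> g \<in> J <#> snd q" and qo: "\<And>r. r \<in> P \<Longrightarrow> r \<noteq> q \<Longrightarrow> s \<otimes> g \<notin> J <#> snd r"
        show ?thesis
        proof (cases "p = q")
          case True then show ?thesis using a1[OF p] u1[OF q] d(1) by simp
        next
          case False
          have "dist (act (s \<otimes> g) (fst p)) (act (s \<otimes> g) (fst q)) \<le> t + t"
            using out[OF p(1) qo[OF p(1) False]] inn[OF q(1) po[OF q(1) False[symmetric]]]
            dist_triangle2[of "act (s \<otimes> g) (fst p)" "act (s \<otimes> g) (fst q)" zero] by simp
          then show ?thesis using a1[OF p] u1[OF q] t by simp
        qed
      next
        fix p assume p: "p \<in> P" "g \<in> J <#> snd p" and no: "\<And>r. r \<in> P \<Longrightarrow> s \<otimes> g \<notin> J <#> snd r"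
        show ?thesis using a1[OF p] u0[OF no] out[OF p(1) no[OF p(1)]] t by simp
      next
        fix q assume q: "q \<in> P" "s \<otimes> g \<in> J <#> snd q" and no: "\<And>r. r \<in> P \<Longrightarrow> g \<notin> J <#> snd r"
        show ?thesis using a0[OF no] u1[OF q] inn[OF q(1) no[OF q(1)]] t by (simp add: dist_commute)
      next
        assume no: "\<And>r. r \<in> P \<Longrightarrow> g \<notin> J <#> snd r" and no': "\<And>r. r \<in> P \<Longrightarrow> s \<otimes> g \<notin> J <#> snd r"
        show ?thesis using a0[OF no] u0[OF no'] d(1) by simp
      qed
    qed
    obtain y where y: "y \<in> X" "\<And>g. g \<in> carrier G \<Longrightarrow> dist (u g) (act g y) < \<epsilon> / 2"
      using d(2)[OF uX pseudo] by blast
    have "shadows \<epsilon> J P y"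
      unfolding shadows_def
    proof (intro conjI ballI impI)
      fix p g assume p: "p \<in> P" and g: "g \<in> carrier G" and no: "\<forall>q\<in>P. q \<noteq> p \<longrightarrow> g \<notin> J <#> snd q"
      show "dist (act g y) (act g (fst p)) < \<epsilon>"
      proof (cases "g \<in> J <#> snd p")
        case True then show ?thesis using y(2)[OF g] u1[OF p True] assms by (simp add: dist_commute)
      next
        case False
        then have "u g = zero" using no by (intro u0) auto
        moreover have "dist (act g (fst p)) zero \<le> t"
          using False EJ by (intro small[OF PD(1,3)[OF p] g]) auto
        ultimately have "dist (act g y) (act g (fst p)) < \<epsilon> / 2 + t"
          using y(2)[OF g] dist_triangle2[of "act g y" "act g (fst p)" zero] by (simp add: dist_commute)
        then show ?thesis using t by simp
      qed
    next
      fix g assume g: "g \<in> carrier G" and no: "\<forall>q\<in>P. g \<notin> J <#> snd q"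
      then show "dist (act g y) zero < \<epsilon>" using u0[of g] y(2)[OF g] assms by (simp add: dist_commute)
    qed
    then show ?thesis using y(1) by blast
  qed
  then have "glueing \<epsilon> J" using J by (auto simp: glueing_def)
  then show ?thesis using that by blast
qed

lemma shadows_unique:
  assumes "shadows \<epsilon> J P y" "shadows \<epsilon> J P z" "separated J P" "y \<in> X" "z \<in> X" "2 * \<epsilon> \<le> \<Delta>"
  shows "y = z"
proof (rule expansivity[OF assms(4,5)])
  fix g assume g: "g \<in> carrier G"
  show "dist (act g y) (act g z) \<le> \<Delta>"
  proof (rule separated_cases[OF assms(3), of g])
    assume no: "\<And>q. q \<in> P \<Longrightarrow> g \<notin> J <#> snd q"
    show ?thesis
      using shadowsD2[OF assms(1) g no] shadowsD2[OF assms(2) g no] dist_triangle2[of "act g y" "act g z" zero] assms(6) by simp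
  next
    fix p assume p: "p \<in> P" and no: "\<And>q. q \<in> P \<Longrightarrow> q \<noteq> p \<Longrightarrow> g \<notin> J <#> snd q"
    show ?thesis
      using shadowsD1[OF assms(1) p g no] shadowsD1[OF assms(2) p g no]
        dist_triangle2[of "act g y" "act g z" "act g (fst p)"] assms(6) by simp
  qed
qed

lemma mem_translate:
  assumes "V \<subseteq> carrier G" "J \<subseteq> carrier G" "h \<in> carrier G" "g \<in> carrier G"
  shows "g \<in> J <#> (V #> inv h) \<longleftrightarrow> g \<otimes> h \<in> J <#> V"
proof
  assume "g \<in> J <#> (V #> inv h)"
  then obtain j v where jv: "j \<in> J" "v \<in> V" "g = j \<otimes> (v \<otimes> inv h)" by (auto simp: mem_set_mult r_coset_def)
  then have "j \<in> carrier G" "v \<in> carrier G" using assms by auto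
  then have "g \<otimes> h = j \<otimes> v" using jv(3) assms by (simp add: m_assoc)
  then show "g \<otimes> h \<in> J <#> V" using jv by (simp add: set_multI)
next
  assume "g \<otimes> h \<in> J <#> V"
  then obtain j v where jv: "j \<in> J" "v \<in> V" "g \<otimes> h = j \<otimes> v" by (auto simp: mem_set_mult)
  then have c: "j \<in> carrier G" "v \<in> carrier G" using assms by auto
  have "g = g \<otimes> h \<otimes> inv h" using assms by (simp add: m_assoc)
  also have "\<dots> = j \<otimes> (v \<otimes> inv h)" using jv c assms by (simp add: m_assoc)
  finally show "g \<in> J <#> (V #> inv h)" using jv by (auto simp: r_coset_def intro!: set_multI)
qed

definition translate :: "'g \<Rightarrow> 'x \<times> 'g set \<Rightarrow> 'x \<times> 'g set" where
  "translate h p = (act h (fst p), snd p #> inv h)"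

lemma fst_translate [simp]: "fst (translate h p) = act h (fst p)"
  and snd_translate [simp]: "snd (translate h p) = snd p #> inv h"
  by (simp_all add: translate_def)

lemma shadows_translate:
  assumes "shadows \<epsilon> J P y" "patches P" "J \<subseteq> carrier G" "h \<in> carrier G" "y \<in> X"
  shows "shadows \<epsilon> J (translate h ` P) (act h y)"
proof -
  have mem: "g \<in> J <#> snd (translate h p) \<longleftrightarrow> g \<otimes> h \<in> J <#> snd p" if "p \<in> P" "g \<in> carrier G" for p g
    using mem_translate assms that by (simp add: patches_def)
  show ?thesis
    unfolding shadows_def
  proof (intro conjI ballI impI)
    fix r g assume r: "r \<in> translate h ` P" and g: "g \<in> carrier G"
      and no: "\<forall>q\<in>translate h ` P. q \<noteq> r \<longrightarrow> g \<notin> J <#> snd q"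
    obtain p where p: "p \<in> P" "r = translate h p" using r by blast
    have pX: "fst p \<in> X" using p assms by (auto simp: patches_def)
    have gh: "g \<otimes> h \<in> carrier G" using g assms by simp
    have inj: "q = p" if "q \<in> P" "translate h q = translate h p" for q
    proof -
      have q: "fst q \<in> X" "snd q \<subseteq> carrier G" "snd p \<subseteq> carrier G" using that p assms by (auto simp: patches_def)
      have "fst q = fst p" using that(2) q pX assms(4) by (metis act_inv fst_translate)
      moreover have "snd q = snd p"
        using that(2) q assms(4) by (metis coset_mult_assoc coset_mult_one inv_closed l_inv snd_translate)
      ultimately show ?thesis by (simp add: prod_eq_iff)
    qed
    have "dist (act (g \<otimes> h) y) (act (g \<otimes> h) (fst p)) < \<epsilon>"
      by (rule shadowsD1[OF assms(1) p(1) gh]) (use no mem g p inj in blast)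
    then show "dist (act g (act h y)) (act g (fst r)) < \<epsilon>"
      using p pX assms g by (simp add: act_mult)
  next
    fix g assume g: "g \<in> carrier G" and no: "\<forall>q\<in>translate h ` P. g \<notin> J <#> snd q"
    have "dist (act (g \<otimes> h) y) zero < \<epsilon>"
      by (rule shadowsD2[OF assms(1)]) (use no mem g assms(4) in auto)
    then show "dist (act g (act h y)) zero < \<epsilon>" using assms g by (simp add: act_mult)
  qed
qed

text \<open>
  Glued points are unique by expansivity, so they inherit the symmetries of the family of patches.
\<close>
lemma shadows_fixed:
  assumes "shadows \<epsilon> J P y" "patches P" "separated J P" "J \<subseteq> carrier G" "h \<in> carrier G" "y \<in> X" "2 * \<epsilon> \<le> \<Delta>"
    and "translate h ` P = P"
  shows "act h y = y"
  using shadows_translate[OF assms(1,2,4-6)] assms by (intro shadows_unique[OF _ assms(1,3) _ assms(6,7)]) auto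

lemma shadows_suppt:
  assumes "shadows \<epsilon> J P y" "separated J P" "y \<in> X" "0 \<le> t" "0 \<le> \<epsilon>"
    and "\<And>p. p \<in> P \<Longrightarrow> suppt t (fst p) \<subseteq> snd p"
  shows "suppt (t + \<epsilon>) y \<subseteq> (\<Union>p\<in>P. snd p)"
proof
  fix g assume gs: "g \<in> suppt (t + \<epsilon>) y"
  then have g: "g \<in> carrier G" by (rule suppt_closedD)
  show "g \<in> (\<Union>p\<in>P. snd p)"
  proof (rule separated_cases[OF assms(2), of g])
    assume no: "\<And>q. q \<in> P \<Longrightarrow> g \<notin> J <#> snd q"
    show ?thesis using shadowsD2[OF assms(1) g no] gs g assms(4) by (auto simp: suppt_def)
  next
    fix p assume p: "p \<in> P" and no: "\<And>q. q \<in> P \<Longrightarrow> q \<noteq> p \<Longrightarrow> g \<notin> J <#> snd q"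
    have "t + \<epsilon> < dist (act g y) (act g (fst p)) + dist (act g (fst p)) zero"
      using gs dist_triangle[of "act g y" zero "act g (fst p)"] by (auto simp: suppt_def)
    then have "g \<in> suppt t (fst p)"
      using shadowsD1[OF assms(1) p g no] g by (simp add: suppt_def)
    then show ?thesis using assms(6)[OF p] p by blast
  qed
qed

lemma shadows_supp_local:
  assumes "shadows \<epsilon> J P y" "separated J P" "2 * \<epsilon> \<le> \<Delta>" "g \<in> supp y"
  obtains p where "p \<in> P" "g \<in> J <#> snd p" "g \<in> suppt (\<Delta> / 2) (fst p)"
proof -
  have g: "g \<in> carrier G" using assms(4) by (rule suppt_closedD)
  have gs: "\<Delta> < dist (act g y) zero" using assms(4) by (simp add: suppt_def)
  show ?thesis
  proof (rule separated_cases[OF assms(2), of g])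
    assume no: "\<And>q. q \<in> P \<Longrightarrow> g \<notin> J <#> snd q"
    show ?thesis using shadowsD2[OF assms(1) g no] gs assms(3) \<Delta>_pos by simp
  next
    fix p assume p: "p \<in> P" "g \<in> J <#> snd p" and no: "\<And>q. q \<in> P \<Longrightarrow> q \<noteq> p \<Longrightarrow> g \<notin> J <#> snd q"
    have "\<Delta> < dist (act g y) (act g (fst p)) + dist (act g (fst p)) zero"
      using gs dist_triangle[of "act g y" zero "act g (fst p)"] by simp
    then have "g \<in> suppt (\<Delta> / 2) (fst p)"
      using shadowsD1[OF assms(1) p(1) g no] g assms(3) by (simp add: suppt_def)
    then show ?thesis using p that by blast
  qed
qed

text \<open>
  A finite window meets the neighbourhoods of finitely many patches only, as these are disjoint. Hence a glued point is a
  limit of points glued from finite subfamilies, and even from approximations \<open>\<xi>\<close> of their members.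
\<close>
lemma shadows_approx:
  assumes "shadows \<epsilon> J P y" "separated J P" "y \<in> X" "4 * \<epsilon> \<le> \<Delta>" "\<eta> > 0"
  obtains E Q where "finite E" "E \<subseteq> carrier G" "finite Q" "Q \<subseteq> P"
    "\<forall>\<xi>. \<forall>z\<in>X. (\<forall>p\<in>Q. \<forall>h\<in>E. dist (act h (\<xi> p)) (act h (fst p)) \<le> \<Delta> / 2) \<longrightarrow>
       shadows \<epsilon> J ((\<lambda>p. (\<xi> p, snd p)) ` Q) z \<longrightarrow> dist z y < \<eta>"
proof -
  obtain E where E: "finite E" "E \<subseteq> carrier G"
    "\<And>x y. x \<in> X \<Longrightarrow> y \<in> X \<Longrightarrow> (\<And>h. h \<in> E \<Longrightarrow> dist (act h x) (act h y) \<le> \<Delta>) \<Longrightarrow> dist x y < \<eta>"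
    using uniform_expansivity[OF assms(5)] by blast
  define Q where "Q = {p \<in> P. \<exists>h\<in>E. h \<in> J <#> snd p}"
  have fQ: "finite Q"
  proof (rule finite_subset)
    show "Q \<subseteq> (\<lambda>h. THE p. p \<in> P \<and> h \<in> J <#> snd p) ` E"
    proof
      fix p assume "p \<in> Q"
      then obtain h where h: "p \<in> P" "h \<in> E" "h \<in> J <#> snd p" by (auto simp: Q_def)
      then have "(THE p. p \<in> P \<and> h \<in> J <#> snd p) = p"
        using assms(2) unfolding separated_def by (intro the_equality) blast+
      then show "p \<in> (\<lambda>h. THE p. p \<in> P \<and> h \<in> J <#> snd p) ` E" by (intro image_eqI[OF _ h(2)]) (rule sym)
    qed
    show "finite ((\<lambda>h. THE p. p \<in> P \<and> h \<in> J <#> snd p) ` E)" using E by simp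
  qed
  show ?thesis
  proof
    show "finite E" "E \<subseteq> carrier G" "finite Q" "Q \<subseteq> P" using E fQ by (auto simp: Q_def)
    have main: "dist z y < \<eta>"
      if z: "z \<in> X" and close: "\<And>p h. p \<in> Q \<Longrightarrow> h \<in> E \<Longrightarrow> dist (act h (\<xi> p)) (act h (fst p)) \<le> \<Delta> / 2"
      and sz: "shadows \<epsilon> J ((\<lambda>p. (\<xi> p, snd p)) ` Q) z" for \<xi> z
    proof (rule E(3)[OF z assms(3)])
      fix h assume h: "h \<in> E"
      then have hc: "h \<in> carrier G" using E by auto
      show "dist (act h z) (act h y) \<le> \<Delta>"
      proof (rule separated_cases[OF assms(2), of h])
        assume no: "\<And>q. q \<in> P \<Longrightarrow> h \<notin> J <#> snd q"
        have "dist (act h z) zero < \<epsilon>"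
          by (rule shadowsD2[OF sz hc]) (use no in \<open>auto simp: Q_def\<close>)
        then show ?thesis
          using shadowsD2[OF assms(1) hc no] dist_triangle2[of "act h z" "act h y" zero] assms(4) \<Delta>_pos by simp
      next
        fix p assume p: "p \<in> P" "h \<in> J <#> snd p" and no: "\<And>q. q \<in> P \<Longrightarrow> q \<noteq> p \<Longrightarrow> h \<notin> J <#> snd q"
        have pQ: "p \<in> Q" using p h by (auto simp: Q_def)
        have "dist (act h z) (act h (fst (\<xi> p, snd p))) < \<epsilon>"
        proof (rule shadowsD1[OF sz _ hc])
          show "(\<xi> p, snd p) \<in> (\<lambda>p. (\<xi> p, snd p)) ` Q" using pQ by blast
          fix r assume "r \<in> (\<lambda>p. (\<xi> p, snd p)) ` Q" "r \<noteq> (\<xi> p, snd p)"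
          then obtain q where "q \<in> Q" "q \<noteq> p" "r = (\<xi> q, snd q)" by blast
          then show "h \<notin> J <#> snd r" using no by (simp add: Q_def)
        qed
        then have "dist (act h z) (act h (\<xi> p)) < \<epsilon>" by simp
        moreover have "dist (act h (\<xi> p)) (act h (fst p)) \<le> \<Delta> / 2" using close pQ h by blast
        moreover have "dist (act h y) (act h (fst p)) < \<epsilon>" using shadowsD1[OF assms(1) p(1) hc no] .
        ultimately show ?thesis
          using dist_triangle2[of "act h z" "act h y" "act h (fst p)"]
            dist_triangle[of "act h z" "act h (fst p)" "act h (\<xi> p)"] assms(4) by simp
      qed
    qed
    show "\<forall>\<xi>. \<forall>z\<in>X. (\<forall>p\<in>Q. \<forall>h\<in>E. dist (act h (\<xi> p)) (act h (fst p)) \<le> \<Delta> / 2) \<longrightarrow>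
       shadows \<epsilon> J ((\<lambda>p. (\<xi> p, snd p)) ` Q) z \<longrightarrow> dist z y < \<eta>"
    proof (intro allI ballI impI)
      fix \<xi> z
      assume *: "z \<in> X" "\<forall>p\<in>Q. \<forall>h\<in>E. dist (act h (\<xi> p)) (act h (fst p)) \<le> \<Delta> / 2"
        "shadows \<epsilon> J ((\<lambda>p. (\<xi> p, snd p)) ` Q) z"
      show "dist z y < \<eta>"
        by (rule main[OF *(1) _ *(3)]) (rule *(2)[rule_format])
    qed
  qed
qed

end

section \<open>Stability of zero among nilpotent points\<close>

context shadowing_system begin

definition nilp :: "'x \<Rightarrow> bool" where "nilp x \<longleftrightarrow> (\<exists>n. (f ^^ n) x = zero)"

definition fixed_by :: "'g set \<Rightarrow> 'x \<Rightarrow> bool" where "fixed_by H x \<longleftrightarrow> (\<forall>h\<in>H. act h x = x)"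

lemma fn_add: "(f ^^ (m + n)) x = (f ^^ m) ((f ^^ n) x)"
  by (simp add: funpow_add)

lemma fn_stays_zero: "(f ^^ n) x = zero \<Longrightarrow> n \<le> m \<Longrightarrow> (f ^^ m) x = zero"
  using fn_add[of "m - n" n x] by simp

lemma fixed_by_fn: "x \<in> X \<Longrightarrow> H \<subseteq> carrier G \<Longrightarrow> fixed_by H x \<Longrightarrow> fixed_by H ((f ^^ n) x)"
  unfolding fixed_by_def by (metis fn_act subsetD)

lemma supp_fixed:
  assumes "x \<in> X" "h \<in> carrier G" "act h x = x" "g \<in> carrier G"
  shows "g \<otimes> h \<in> suppt t x \<longleftrightarrow> g \<in> suppt t x"
  using mem_suppt_act[OF assms(4,2,1), of t] assms(3) by simp

text \<open>
  Periodicity reduces the support to finitely many positions, which are all zero from some time on.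
\<close>
lemma confined_imp_nilp:
  assumes x: "x \<in> X" and L: "L \<subseteq> carrier G" and fixed: "fixed_by L x" and Z: "bounded_mod L Z"
    and conf: "\<And>n. supp ((f ^^ n) x) \<subseteq> Z"
  shows "nilp x"
proof -
  obtain F where F: "finite F" "F \<subseteq> carrier G" "Z \<subseteq> F <#> L" using Z unfolding bounded_mod_def by blast
  obtain N where N: "\<And>n. n \<ge> N \<Longrightarrow> F \<inter> supp ((f ^^ n) x) = {}" using eventually_off[OF x F(1,2)] by blast
  have "supp ((f ^^ N) x) = {}"
  proof (rule ccontr)
    assume "supp ((f ^^ N) x) \<noteq> {}"
    then obtain g where g: "g \<in> supp ((f ^^ N) x)" by blast
    then have "g \<in> F <#> L" using conf F by blast
    then obtain a l where al: "a \<in> F" "l \<in> L" "g = a \<otimes> l" unfolding mem_set_mult by blast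
    have "act l ((f ^^ N) x) = (f ^^ N) x"
      using fixed_by_fn[OF x L fixed] al by (simp add: fixed_by_def)
    then have "a \<in> supp ((f ^^ N) x)"
      using supp_fixed[OF fn_closed[OF x] subsetD[OF L al(2)] _ subsetD[OF F(2) al(1)]] g al(3) by simp
    then show False using N[of N] al by blast
  qed
  then have "(f ^^ N) x = zero" by (rule supp_empty[OF fn_closed[OF x]])
  then show ?thesis unfolding nilp_def by (rule exI)
qed

text \<open>
  Every orbit is eventually off \<open>T\<close>, so the closed sets of points that are off \<open>T\<close> from time \<open>n\<close> on cover the
  compact space \<open>closure Q\<close>, and one of them has interior.
\<close>
lemma baire_off:
  assumes Q: "Q \<subseteq> X" "Q \<noteq> {}" and T: "finite T" "T \<subseteq> carrier G"
  obtains w \<eta> N where "w \<in> Q" "\<eta> > 0"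
    "\<And>y n. y \<in> closure Q \<Longrightarrow> dist y w < \<eta> \<Longrightarrow> n \<ge> N \<Longrightarrow> T \<inter> supp ((f ^^ n) y) = {}"
proof -
  define Y where "Y = closure Q"
  have clX: "closed X" using compact_space by (rule compact_imp_closed)
  have YX: "Y \<subseteq> X" using Q clX closure_minimal by (auto simp: Y_def)
  have cY: "compact Y" using compact_space YX clX by (simp add: Y_def compact_closure bounded_subset compact_imp_bounded) 
      (metis YX Y_def closed_closure compact_Int_closed inf.absorb_iff2)
  have QY: "Q \<subseteq> Y" by (simp add: Y_def closure_subset)
  define C where "C n = {y \<in> Y. \<forall>m\<ge>n. \<forall>t\<in>T. t \<notin> supp ((f ^^ m) y)}" for n :: nat
  have clC: "closed (C n)" for n
  proof -
    have "closed {y \<in> Y. t \<notin> supp ((f ^^ m) y)}" if "t \<in> T" for t m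
    proof -
      have tc: "t \<in> carrier G" using that T by auto
      have "continuous_on Y (\<lambda>y. dist (act t ((f ^^ m) y)) zero)"
        by (intro continuous_on_dist continuous_on_const continuous_on_subset[OF continuous_act_fn[OF tc] YX])
      then have "closed (Y \<inter> (\<lambda>y. dist (act t ((f ^^ m) y)) zero) -` {..\<Delta>})"
        by (intro continuous_closed_preimage) (auto simp: Y_def)
      moreover have "Y \<inter> (\<lambda>y. dist (act t ((f ^^ m) y)) zero) -` {..\<Delta>} = {y \<in> Y. t \<notin> supp ((f ^^ m) y)}"
        using tc by (auto simp: suppt_def)
      ultimately show ?thesis by simp
    qed
    then have "closed (Y \<inter> (\<Inter>m\<in>{n..}. \<Inter>t\<in>T. {y \<in> Y. t \<notin> supp ((f ^^ m) y)}))"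
      by (intro closed_Int closed_INT ballI) (auto simp: Y_def)
    moreover have "Y \<inter> (\<Inter>m\<in>{n..}. \<Inter>t\<in>T. {y \<in> Y. t \<notin> supp ((f ^^ m) y)}) = C n"
      by (auto simp: C_def)
    ultimately show ?thesis by simp
  qed
  have cover: "(\<Union>n. C n) = Y"
  proof
    show "Y \<subseteq> (\<Union>n. C n)"
    proof
      fix y assume y: "y \<in> Y"
      then obtain N where "\<And>n. n \<ge> N \<Longrightarrow> T \<inter> supp ((f ^^ n) y) = {}"
        using eventually_off[OF _ T] YX by blast
      then have "y \<in> C N" using y by (auto simp: C_def)
      then show "y \<in> (\<Union>n. C n)" by blast
    qed
  qed (auto simp: C_def)
  have "\<exists>n. top_of_set Y interior_of C n \<noteq> {}"
  proof (rule ccontr)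
    assume no: "\<not> ?thesis"
    have "top_of_set Y interior_of \<Union>(range C) = {}"
    proof (rule Baire_category_alt)
      have "compact_space (top_of_set Y)" using cY by (simp add: compact_space_subtopology)
      moreover have "metrizable_space (top_of_set Y)"
        by (simp add: metrizable_space_euclidean metrizable_space_subtopology)
      ultimately show "completely_metrizable_space (top_of_set Y) \<or> locally_compact_space (top_of_set Y) \<and> regular_space (top_of_set Y)"
        by (simp add: compact_imp_locally_compact_space metrizable_imp_regular_space)
      show "countable (range C)" by simp
      show "closedin (top_of_set Y) A \<and> top_of_set Y interior_of A = {}" if "A \<in> range C" for A
        using that no clC by (auto simp: C_def intro!: closed_subset)
    qed
    then have "Y = {}" using cover by (metis interior_of_topspace topspace_euclidean_subtopology)
    then show False using QY Q by blast
  qed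
  then obtain N U where U: "openin (top_of_set Y) U" "U \<noteq> {}" "U \<subseteq> C N"
    by (metis interior_of_subset openin_interior_of)
  then obtain W where W: "open W" "U = Y \<inter> W" by (auto simp: openin_open)
  then obtain w where w: "w \<in> Q" "w \<in> W"
    using U by (metis Y_def disjoint_iff open_Int_closure_eq_empty)
  then obtain \<eta> where \<eta>: "\<eta> > 0" "ball w \<eta> \<subseteq> W" using W openE by blast
  show ?thesis
  proof
    show "w \<in> Q" "\<eta> > 0" using w \<eta> by auto
    fix y n assume y: "y \<in> closure Q" "dist y w < \<eta>" "N \<le> n"
    then have "y \<in> U" using W \<eta> by (auto simp: Y_def dist_commute subset_iff)
    then show "T \<inter> supp ((f ^^ n) y) = {}" using U y by (auto simp: C_def)
  qed
qed

lemma supp_fn_upto: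
  obtains E where "finite E" "E \<subseteq> carrier G" "\<And>x n. x \<in> X \<Longrightarrow> n \<le> M \<Longrightarrow> supp ((f ^^ n) x) \<subseteq> E <#> supp x"
proof -
  have "\<exists>E. finite E \<and> E \<subseteq> carrier G \<and> (\<forall>x\<in>X. supp ((f ^^ n) x) \<subseteq> E <#> supp x)" for n
    using suppt_fn[OF \<Delta>_pos, of n] by metis
  then obtain E where E: "\<And>n. finite (E n)" "\<And>n. E n \<subseteq> carrier G" "\<And>n x. x \<in> X \<Longrightarrow> supp ((f ^^ n) x) \<subseteq> E n <#> supp x"
    by metis
  show ?thesis
  proof
    show "finite (\<Union>n\<le>M. E n)" "(\<Union>n\<le>M. E n) \<subseteq> carrier G" using E by auto
    fix x n assume "x \<in> X" "n \<le> M"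
    then have "supp ((f ^^ n) x) \<subseteq> E n <#> supp x" "E n \<subseteq> (\<Union>n\<le>M. E n)"
      using E(3) by auto
    moreover from this(2) have "E n <#> supp x \<subseteq> (\<Union>n\<le>M. E n) <#> supp x" by (rule mono_set_mult) simp
    ultimately show "supp ((f ^^ n) x) \<subseteq> (\<Union>n\<le>M. E n) <#> supp x" by blast
  qed
qed

text \<open>
  The point \<open>x\<close> must not disturb the point \<open>u\<close> found by Baire's theorem until \<open>u\<close> has died and the silence around
  \<open>u\<close> has begun. At that time \<open>M\<close> the glued point has become equal to \<open>x\<close>, so it would break the silence if \<open>x\<close>
  ever became visible at \<open>T\<close>. All this only requires \<open>supp x\<close> to avoid a set depending on \<open>u\<close>.
\<close>
lemma stability_of_nilpotent_points:
  assumes H: "subgroup H G" and T: "finite T" "T \<subseteq> carrier G"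
  obtains Z where "bounded_mod H Z"
    "\<And>x n. x \<in> X \<Longrightarrow> bounded_mod H (supp x) \<Longrightarrow> nilp x \<Longrightarrow> supp x \<inter> Z = {} \<Longrightarrow> T \<inter> supp ((f ^^ n) x) = {}"
proof -
  have Hc: "H \<subseteq> carrier G" using H by (rule subgroup.subset)
  define A where "A = {u \<in> X. bounded_mod H (supp u) \<and> nilp u}"
  have "zero \<in> A" using \<Delta>_pos by (auto simp: A_def nilp_def intro!: exI[of _ 0])
  then obtain u \<eta> N where u: "u \<in> A" and \<eta>: "\<eta> > 0"
    and N: "\<And>y n. y \<in> closure A \<Longrightarrow> dist y u < \<eta> \<Longrightarrow> n \<ge> N \<Longrightarrow> T \<inter> supp ((f ^^ n) y) = {}"
    using baire_off[of A T] T by (metis (no_types, lifting) A_def empty_iff mem_Collect_eq subsetI)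
  obtain N1 where N1: "(f ^^ N1) u = zero" using u by (auto simp: A_def nilp_def)
  have uX: "u \<in> X" and ub: "bounded_mod H (supp u)" using u by (auto simp: A_def)
  define M where "M = max N N1"
  have uM: "(f ^^ M) u = zero" by (rule fn_stays_zero[OF N1]) (simp add: M_def)
  define \<epsilon> where "\<epsilon> = \<Delta> / 4"
  have \<epsilon>: "\<epsilon> > 0" "2 * \<epsilon> \<le> \<Delta>" using \<Delta>_pos by (auto simp: \<epsilon>_def)
  obtain J where J: "glueing \<epsilon> J" using glueing_exists[OF \<epsilon>(1)] by blast
  have Jf: "finite J" "J \<subseteq> carrier G" "\<one> \<in> J" using J by (auto simp: glueing_def)
  obtain E0 where E0: "finite E0" "E0 \<subseteq> carrier G"
    "\<And>x y g. x \<in> X \<Longrightarrow> y \<in> X \<Longrightarrow> g \<in> carrier G \<Longrightarrow>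
       (\<And>h. h \<in> E0 \<Longrightarrow> dist (act (h \<otimes> g) x) (act (h \<otimes> g) y) \<le> \<Delta>) \<Longrightarrow>
       dist (act g ((f ^^ M) x)) (act g ((f ^^ M) y)) < \<Delta> / 2"
    using locality[of "\<Delta> / 2" M] \<Delta>_pos by (metis half_gt_zero)
  obtain E1 where E1: "finite E1" "E1 \<subseteq> carrier G" "\<And>x n. x \<in> X \<Longrightarrow> n \<le> M \<Longrightarrow> supp ((f ^^ n) x) \<subseteq> E1 <#> supp x"
    using supp_fn_upto by blast
  obtain E2 where E2: "finite E2" "E2 \<subseteq> carrier G"
    "\<And>x y. x \<in> X \<Longrightarrow> y \<in> X \<Longrightarrow> (\<And>h. h \<in> E2 \<Longrightarrow> dist (act h x) (act h y) \<le> \<Delta>) \<Longrightarrow> dist x y < \<eta>"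
    using uniform_expansivity[OF \<eta>] by blast
  define Z' where "Z' = ((E0 <#> invs E0) <#> (J <#> supp u)) \<union> (J <#> supp u) \<union> T \<union> E2"
  have "bounded_mod H (J <#> supp u)" by (rule bounded_mod_mult[OF Jf(1,2) ub Hc])
  moreover from this have "bounded_mod H ((E0 <#> invs E0) <#> (J <#> supp u))"
    using bounded_mod_mult[of "E0 <#> invs E0" H "J <#> supp u"] E0 Hc by (simp add: set_mult_closed)
  ultimately have "bounded_mod H Z'"
    unfolding Z'_def using T E2 H by (intro bounded_mod_Un) (simp_all add: bounded_mod_finite)
  then obtain Z where Z: "bounded_mod H Z"
    "\<And>B. B \<subseteq> carrier G \<Longrightarrow> B \<inter> Z = {} \<Longrightarrow> ((J \<union> E1) <#> B) \<inter> Z' = {}"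
    using bounded_mod_avoid[of "J \<union> E1" H Z'] Jf E1 H by blast
  show ?thesis
  proof (rule that[OF Z(1)], rule ccontr)
    fix x n
    assume x: "x \<in> X" "bounded_mod H (supp x)" "nilp x" "supp x \<inter> Z = {}" and "T \<inter> supp ((f ^^ n) x) \<noteq> {}"
    then obtain t where t: "t \<in> T" "t \<in> supp ((f ^^ n) x)" by blast
    have far: "((J \<union> E1) <#> supp x) \<inter> Z' = {}" using Z(2) x by simp
    have sub: "J <#> supp x \<subseteq> (J \<union> E1) <#> supp x" "E1 <#> supp x \<subseteq> (J \<union> E1) <#> supp x"
      by (rule mono_set_mult; simp)+
    have nM: "n \<ge> M"
    proof (rule ccontr)
      assume "\<not> n \<ge> M"
      then have "t \<in> (J \<union> E1) <#> supp x" using E1(3)[OF x(1), of n] t sub by auto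
      then show False using far t by (auto simp: Z'_def)
    qed
    define P where "P = {(u, supp u), (x, supp x)}"
    have disj: "(J <#> supp u) \<inter> (J <#> supp x) = {}" using far sub by (auto simp: Z'_def)
    have pP: "patches P" using uX x by (auto simp: P_def patches_def)
    have sP: "separated J P" using disj by (auto simp: P_def separated_def)
    obtain y where y: "y \<in> X" "shadows \<epsilon> J P y" using J pP sP by (auto simp: glueing_def)
    have near_u: "dist (act g y) (act g u) \<le> \<Delta>" if "g \<in> carrier G" "g \<notin> J <#> supp x" for g
      using shadowsD1[OF y(2), of "(u, supp u)" g] that \<epsilon> by (auto simp: P_def)
    have near_x: "dist (act g y) (act g x) \<le> \<Delta>" if "g \<in> carrier G" "g \<notin> J <#> supp u" for g
      using shadowsD1[OF y(2), of "(x, supp x)" g] that \<epsilon> by (auto simp: P_def)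
    have fM: "(f ^^ M) y = (f ^^ M) x"
    proof (rule expansivity)
      fix g assume g: "g \<in> carrier G"
      show "dist (act g ((f ^^ M) y)) (act g ((f ^^ M) x)) \<le> \<Delta>"
      proof (cases "\<forall>h\<in>E0. h \<otimes> g \<notin> J <#> supp u")
        case True
        then have "dist (act g ((f ^^ M) y)) (act g ((f ^^ M) x)) < \<Delta> / 2"
          using E0(2) g by (intro E0(3)[OF y(1) x(1) g] near_x) auto
        then show ?thesis using \<Delta>_pos by simp
      next
        case False
        then obtain e where e: "e \<in> E0" "e \<otimes> g \<in> J <#> supp u" by blast
        have no: "h \<otimes> g \<notin> J <#> supp x" if h: "h \<in> E0" for h
        proof
          assume hx: "h \<otimes> g \<in> J <#> supp x"
          have c: "h \<in> carrier G" "e \<in> carrier G" using h e E0 by auto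
          have "h \<otimes> g = (h \<otimes> inv e) \<otimes> (e \<otimes> g)" using c g by (simp add: m_assoc inv_mult_cancel_left)
          moreover have "(h \<otimes> inv e) \<otimes> (e \<otimes> g) \<in> (E0 <#> invs E0) <#> (J <#> supp u)"
            by (rule set_multI[OF set_multI[OF h invsI[OF e(1)]] e(2)])
          ultimately show False using hx far sub by (auto simp: Z'_def)
        qed
        have "dist (act g ((f ^^ M) y)) (act g ((f ^^ M) u)) < \<Delta> / 2"
          using E0(2) g no by (intro E0(3)[OF y(1) uX g] near_u) auto
        moreover have "dist (act g ((f ^^ M) x)) (act g ((f ^^ M) zero)) < \<Delta> / 2"
        proof (rule E0(3)[OF x(1) zero_X g])
          fix h assume h: "h \<in> E0"
          then have hc: "h \<in> carrier G" using E0 by auto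
          have "h \<otimes> g \<notin> supp x" using no[OF h] subset_set_mult_one[OF Jf(3) suppt_closed] by blast
          then show "dist (act (h \<otimes> g) x) (act (h \<otimes> g) zero) \<le> \<Delta>" using hc g by (simp add: supp_iff)
        qed
        ultimately show ?thesis
          using uM g dist_triangle2[of "act g ((f ^^ M) y)" "act g ((f ^^ M) x)" zero] by simp
      qed
    qed (use x y in auto)
    have later: "(f ^^ k) y = (f ^^ k) x" if "k \<ge> M" for k
      using fn_add[of "k - M" M y] fn_add[of "k - M" M x] fM that by simp
    have "supp y \<subseteq> (J <#> supp u) \<union> (J <#> supp x)"
    proof
      fix g assume "g \<in> supp y"
      then show "g \<in> (J <#> supp u) \<union> (J <#> supp x)"
        by (rule shadows_supp_local[OF y(2) sP \<epsilon>(2)]) (auto simp: P_def)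
    qed
    then have yb: "bounded_mod H (supp y)"
      using bounded_mod_Un[OF bounded_mod_mult[OF Jf(1,2) ub Hc] bounded_mod_mult[OF Jf(1,2) x(2) Hc]] bounded_mod_subset by blast
    obtain m where "(f ^^ m) x = zero" using x(3) by (auto simp: nilp_def)
    then have "(f ^^ (max m M)) y = zero" using later[of "max m M"] fn_stays_zero[of m x "max m M"] by simp
    then have "nilp y" unfolding nilp_def by blast
    then have yA: "y \<in> A" using y yb by (simp add: A_def)
    have "dist y u < \<eta>"
    proof (rule E2(3)[OF y(1) uX near_u])
      fix h assume h: "h \<in> E2"
      then show "h \<in> carrier G" using E2 by auto
      show "h \<notin> J <#> supp x" using h far sub by (auto simp: Z'_def)
    qed
    then have "T \<inter> supp ((f ^^ n) y) = {}"
      using yA closure_subset nM by (intro N) (auto simp: M_def)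
    then show False using t later[OF nM] by auto
  qed
qed

text \<open>
  Stability at the translates of \<open>T\<close> by \<open>M\<close>: a point of the support at time \<open>n\<close> must have a point of \<open>supp x\<close> in the
  corresponding translate of \<open>Z\<close>.
\<close>
lemma confinement:
  assumes "subgroup H G" "subgroup M G" "H \<subseteq> M" and norm: "\<And>m h. m \<in> M \<Longrightarrow> h \<in> H \<Longrightarrow> inv m \<otimes> h \<otimes> m \<in> H"
    and "finite T" "T \<subseteq> carrier G" "bounded_mod H Z" "bounded_mod H A"
  obtains B where "bounded_mod H B"
    "\<And>x n. x \<in> X \<Longrightarrow> supp x \<subseteq> A \<Longrightarrow>
       (\<And>m. m \<in> M \<Longrightarrow> supp (act m x) \<inter> Z = {} \<Longrightarrow> T \<inter> supp ((f ^^ n) (act m x)) = {}) \<Longrightarrow>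
       supp ((f ^^ n) x) \<inter> (T <#> M) \<subseteq> B"
proof -
  obtain B where B: "bounded_mod H B"
    "\<And>t m z. t \<in> T \<Longrightarrow> m \<in> M \<Longrightarrow> z \<in> Z \<Longrightarrow> z \<otimes> m \<in> A \<Longrightarrow> t \<otimes> m \<in> B"
    using confinement_algebra[OF assms] by blast
  show ?thesis
  proof (rule that[OF B(1)])
    fix x n
    assume x: "x \<in> X" "supp x \<subseteq> A"
      and st: "\<And>m. m \<in> M \<Longrightarrow> supp (act m x) \<inter> Z = {} \<Longrightarrow> T \<inter> supp ((f ^^ n) (act m x)) = {}"
    show "supp ((f ^^ n) x) \<inter> (T <#> M) \<subseteq> B"
    proof
      fix g assume g: "g \<in> supp ((f ^^ n) x) \<inter> (T <#> M)"
      then obtain t m where tm: "t \<in> T" "m \<in> M" "g = t \<otimes> m" unfolding mem_set_mult Int_iff by blast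
      have c: "t \<in> carrier G" "m \<in> carrier G" using tm assms(2,6) subgroup.subset by blast+
      have "t \<in> supp ((f ^^ n) (act m x))"
        using g tm c x by (simp add: fn_act mem_suppt_act)
      then obtain z where z: "z \<in> Z" "z \<in> supp (act m x)" using st[OF tm(2)] tm(1) by blast
      have "z \<otimes> m \<in> supp x" using z c x mem_suppt_act[OF suppt_closedD[OF z(2)]] by blast
      then show "g \<in> B" using B(2)[OF tm(1,2) z(1)] x tm by blast
    qed
  qed
qed

end

section \<open>Periodization\<close>

context shadowing_system begin

lemma translate_mult:
  assumes "fst p \<in> X" "snd p \<subseteq> carrier G" "g \<in> carrier G" "h \<in> carrier G"
  shows "translate g (translate h p) = translate (g \<otimes> h) p"
  using assms by (simp add: translate_def act_mult coset_mult_assoc inv_mult_group)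

text \<open>
  The patches that make up the \<open>L\<close>-periodization of \<open>x\<close>. Different elements of \<open>L\<close> may give the same patch, when
  they differ by a period of \<open>x\<close>.
\<close>
definition orbit_patches :: "real \<Rightarrow> 'g set \<Rightarrow> 'x \<Rightarrow> ('x \<times> 'g set) set" where
  "orbit_patches t L x = (\<lambda>l. translate l (x, suppt t x)) ` L"

lemma snd_orbit_patches:
  "x \<in> X \<Longrightarrow> L \<subseteq> carrier G \<Longrightarrow> p \<in> orbit_patches t L x \<Longrightarrow> snd p = suppt t (fst p)"
  by (auto simp: orbit_patches_def suppt_act subset_iff)

lemma orbit_patches_translate:
  assumes "x \<in> X" "subgroup L G" "h \<in> L"
  shows "translate h ` orbit_patches t L x = orbit_patches t L x"
proof -
  have L: "L \<subseteq> carrier G" using assms(2) by (rule subgroup.subset)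
  have "translate h ` orbit_patches t L x = (\<lambda>l. translate (h \<otimes> l) (x, suppt t x)) ` L"
    unfolding orbit_patches_def image_image
    using L assms by (intro image_cong refl translate_mult) auto
  also have "\<dots> = (\<lambda>l. translate l (x, suppt t x)) ` ((\<lambda>l. h \<otimes> l) ` L)"
    by (simp add: image_image)
  also have "(\<lambda>l. h \<otimes> l) ` L = L"
  proof
    show "(\<lambda>l. h \<otimes> l) ` L \<subseteq> L" using assms by (auto intro: subgroup.m_closed)
    show "L \<subseteq> (\<lambda>l. h \<otimes> l) ` L"
    proof
      fix l assume l: "l \<in> L"
      have "l = h \<otimes> (inv h \<otimes> l)" using l L assms by (simp add: mult_inv_cancel_left subset_iff)
      moreover have "inv h \<otimes> l \<in> L" using assms l by (simp add: subgroup.m_closed subgroup.m_inv_closed)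
      ultimately show "l \<in> (\<lambda>l. h \<otimes> l) ` L" by (rule image_eqI)
    qed
  qed
  finally show ?thesis by (simp add: orbit_patches_def)
qed

text \<open>
  If \<open>x\<close> vanishes on a set of the form \<open>B H\<close>, then its periodization \<open>y\<close> along \<open>L = H \<inter> K N\<close> vanishes on a slightly smaller set
  of this form, since \<open>L \<subseteq> H\<close>.
  If \<open>N\<close> is small, then \<open>y\<close> agrees with \<open>x\<close> on a window large enough to see the same event at \<open>T\<close>. As \<open>y\<close> is nilpotent,
  \<open>stability_of_nilpotent_points\<close> forbids this event. The set \<open>Z\<close> works for all \<open>x\<close>, whereas \<open>N\<close> depends on \<open>x\<close>.
\<close>
lemma periodic_stability:
  assumes K: "K \<lhd> G" and closed: "profinitely_closed K" and H: "subgroup H G" and KH: "K \<subseteq> H"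
    and t: "0 < t" "t \<le> \<Delta>" and \<epsilon>: "0 < \<epsilon>" "2 * \<epsilon> \<le> \<Delta>" and J: "glueing \<epsilon> J"
    and T: "finite T" "T \<subseteq> carrier G"
    and nil: "\<And>x N y. x \<in> X \<Longrightarrow> fixed_by K x \<Longrightarrow> bounded_mod K (supp x) \<Longrightarrow> suppt t x \<subseteq> U \<Longrightarrow>
        finite_index_normal N \<Longrightarrow> y \<in> X \<Longrightarrow> fixed_by (H \<inter> (K <#> N)) y \<Longrightarrow>
        patches (orbit_patches t (H \<inter> (K <#> N)) x) \<Longrightarrow> separated J (orbit_patches t (H \<inter> (K <#> N)) x) \<Longrightarrow>
        shadows \<epsilon> J (orbit_patches t (H \<inter> (K <#> N)) x) y \<Longrightarrow> nilp y"
  obtains Z where "bounded_mod H Z"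
    "\<And>x n. x \<in> X \<Longrightarrow> fixed_by K x \<Longrightarrow> bounded_mod K (supp x) \<Longrightarrow> suppt t x \<subseteq> U \<Longrightarrow>
        supp x \<inter> Z = {} \<Longrightarrow> T \<inter> supp ((f ^^ n) x) = {}"
proof -
  have Ks: "subgroup K G" using K by (rule normal_imp_subgroup)
  have Kc: "K \<subseteq> carrier G" and Hc: "H \<subseteq> carrier G" using Ks H by (simp_all add: subgroup.subset)
  have Jf: "finite J" "J \<subseteq> carrier G" "\<one> \<in> J" using J by (auto simp: glueing_def)
  obtain Z0 where Z0: "bounded_mod H Z0"
    "\<And>x n. x \<in> X \<Longrightarrow> bounded_mod H (supp x) \<Longrightarrow> nilp x \<Longrightarrow> supp x \<inter> Z0 = {} \<Longrightarrow> T \<inter> supp ((f ^^ n) x) = {}"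
    using stability_of_nilpotent_points[OF H T] by blast
  obtain B where B: "finite B" "B \<subseteq> carrier G" "Z0 \<subseteq> B <#> H" using Z0(1) unfolding bounded_mod_def by blast
  obtain E where E: "finite E" "E \<subseteq> carrier G" "\<And>x. x \<in> X \<Longrightarrow> suppt (\<Delta> / 2) x \<subseteq> E <#> supp x"
    using suppt_supp[of "\<Delta> / 2"] \<Delta>_pos by (metis half_gt_zero)
  obtain D where D: "finite D" "D \<subseteq> carrier G" "\<And>x. x \<in> X \<Longrightarrow> suppt t x \<subseteq> D <#> supp x"
    using suppt_supp[OF t(1)] by blast
  have "bounded_mod H (B <#> H)" by (rule bounded_modI[OF B(1,2) order.refl])
  then obtain Z where Z: "bounded_mod H Z"
    "\<And>A. A \<subseteq> carrier G \<Longrightarrow> A \<inter> Z = {} \<Longrightarrow> (E <#> A) \<inter> (B <#> H) = {}"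
    using bounded_mod_avoid[OF E(1,2) _ H] by blast
  show ?thesis
  proof (rule that[OF Z(1)], rule ccontr)
    fix x n
    assume x: "x \<in> X" "fixed_by K x" "bounded_mod K (supp x)" "suppt t x \<subseteq> U" "supp x \<inter> Z = {}"
      and "T \<inter> supp ((f ^^ n) x) \<noteq> {}"
    then obtain s where s: "s \<in> T" "s \<in> supp ((f ^^ n) x)" by blast
    obtain E3 where E3: "finite E3" "E3 \<subseteq> carrier G"
      "\<And>y. y \<in> X \<Longrightarrow> (\<And>h. h \<in> E3 \<Longrightarrow> dist (act h y) (act h x) \<le> \<Delta>) \<Longrightarrow> s \<in> supp ((f ^^ n) y)"
      using supp_fn_open[OF x(1) s(2)] by blast
    have "bounded_mod K (suppt t x)"
      by (rule bounded_mod_subset[OF bounded_mod_mult[OF D(1,2) x(3) Kc] D(3)[OF x(1)]])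
    then obtain F where F: "finite F" "F \<subseteq> carrier G" "suppt t x \<subseteq> F <#> K" unfolding bounded_mod_def by blast
    define C where "C = J <#> F"
    have C: "finite C" "C \<subseteq> carrier G" using Jf F by (auto simp: C_def set_mult_closed)
    have JC: "J <#> suppt t x \<subseteq> C <#> K"
    proof -
      have "J <#> suppt t x \<subseteq> J <#> (F <#> K)" using F(3) by (intro mono_set_mult) auto
      then show ?thesis using Jf F Kc by (simp add: C_def set_mult_assoc)
    qed
    obtain N where N: "finite_index_normal N"
      "\<And>q. q \<in> (invs C <#> C) \<union> (invs E3 <#> C) \<Longrightarrow> q \<in> K <#> N \<Longrightarrow> q \<in> K"
    proof (rule profinitely_closed_separates[OF closed Kc])
      show "finite ((invs C <#> C) \<union> (invs E3 <#> C))" using C E3 by simp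
      show "(invs C <#> C) \<union> (invs E3 <#> C) \<subseteq> carrier G" using C E3 by (simp add: set_mult_closed)
    qed blast
    have Ns: "subgroup N G" using N(1) by (simp add: finite_index_normal_def normal_imp_subgroup)
    have KN: "subgroup (K <#> N) G" 
      by (rule normal_imp_subgroup[OF normal_subgroup_set_mult_closed[OF K]]) (use N(1) in \<open>simp add: finite_index_normal_def\<close>)
    have KKN: "K \<subseteq> K <#> N"
      using subgroup.one_closed[OF Ns] Kc by (force simp: mem_set_mult)
    define L where "L = H \<inter> (K <#> N)"
    have L: "subgroup L G" unfolding L_def by (rule subgroups_Inter_pair[OF H KN])
    have Lc: "L \<subseteq> carrier G" using L by (rule subgroup.subset)
    have LKN: "L \<subseteq> K <#> N" and LH: "L \<subseteq> H" and KL: "K \<subseteq> L" using KH KKN by (auto simp: L_def)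
    define P where "P = orbit_patches t L x"
    have mem: "g \<otimes> l \<in> J <#> suppt t x" if "g \<in> J <#> snd (translate l (x, suppt t x))" "l \<in> L" "g \<in> carrier G" for g l
      using that mem_translate[of "suppt t x" J l g] Jf Lc by auto
    have same: "translate l (x, suppt t x) = translate l' (x, suppt t x)" if "l \<in> L" "l' \<in> L" "inv l \<otimes> l' \<in> K" for l l'
    proof -
      have c: "l \<in> carrier G" "l' \<in> carrier G" using that Lc by auto
      have "l' = l \<otimes> (inv l \<otimes> l')" using c by (simp add: mult_inv_cancel_left)
      then have "act l' x = act l (act (inv l \<otimes> l') x)" using c x act_mult by (metis inv_closed m_closed)
      then have "act l' x = act l x" using x(2) that(3) by (simp add: fixed_by_def)
      then show ?thesis using c x by (simp add: translate_def suppt_act[symmetric])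
    qed
    have sepP: "separated J P"
      unfolding separated_def
    proof (intro ballI impI equals0I)
      fix p q g
      assume pq: "p \<in> P" "q \<in> P" "p \<noteq> q" and g: "g \<in> (J <#> snd p) \<inter> (J <#> snd q)"
      obtain l where l: "l \<in> L" "p = translate l (x, suppt t x)" using pq by (auto simp: P_def orbit_patches_def)
      obtain l' where l': "l' \<in> L" "q = translate l' (x, suppt t x)" using pq by (auto simp: P_def orbit_patches_def)
      have "snd p \<subseteq> carrier G"
        using r_coset_subset_G[OF suppt_closed inv_closed[OF subsetD[OF Lc l(1)]], of t x] l(2) by simp
      then have gc: "g \<in> carrier G" using g Jf set_mult_closed by blast
      have "g \<otimes> l \<in> C <#> K" "g \<otimes> l' \<in> C <#> K" using mem g gc l l' JC by blast+
      then obtain c k c' k' where ck: "c \<in> C" "k \<in> K" "g \<otimes> l = c \<otimes> k" "c' \<in> C" "k' \<in> K" "g \<otimes> l' = c' \<otimes> k'"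
        unfolding mem_set_mult by blast
      have cc: "c \<in> carrier G" "c' \<in> carrier G" using ck C by auto
      have lc: "l \<in> carrier G" "l' \<in> carrier G" "k \<in> carrier G" "k' \<in> carrier G" using l l' Lc ck Kc by auto
      have "inv c \<otimes> c' \<in> K <#> N"
        by (rule quotient_in_subgroup[OF KN cc gc _ _ _ _ ck(3,6)]) (use l l' LKN ck KKN in auto)
      then have inK: "inv c \<otimes> c' \<in> K" using N(2) ck by (meson UnI1 invsI set_multI)
      have "inv l \<otimes> l' = inv (g \<otimes> l) \<otimes> (g \<otimes> l')" using lc gc by (simp add: inv_mult_group m_assoc inv_mult_cancel_left)
      also have "\<dots> = inv k \<otimes> (inv c \<otimes> c') \<otimes> k'" using ck(3,6) lc cc by (simp add: inv_mult_group m_assoc)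
      also have "\<dots> \<in> K" using inK ck Ks by (simp add: subgroup.m_closed subgroup.m_inv_closed)
      finally show False using same l l' pq by blast
    qed
    have patP: "patches P"
      unfolding patches_def
    proof (intro ballI conjI)
      fix p assume p: "p \<in> P"
      then show "fst p \<in> X" using x Lc by (auto simp: P_def orbit_patches_def)
      have "snd p = suppt t (fst p)" using p snd_orbit_patches[OF x(1) Lc] by (simp add: P_def)
      then show "snd p \<subseteq> carrier G" "supp (fst p) \<subseteq> snd p" using t suppt_antimono by simp_all
    qed
    obtain y where y: "y \<in> X" "shadows \<epsilon> J P y" using J patP sepP by (auto simp: glueing_def)
    have fixy: "fixed_by L y"
      unfolding fixed_by_def
    proof
      fix h assume h: "h \<in> L"
      show "act h y = y"
        by (rule shadows_fixed[OF y(2) patP sepP Jf(2) _ y(1) \<epsilon>(2)])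
          (use h Lc orbit_patches_translate[OF x(1) L h] in \<open>auto simp: P_def\<close>)
    qed
    have nily: "nilp y"
      by (rule nil[OF x(1-4) N(1) y(1)]) (use fixy patP sepP y in \<open>simp_all add: P_def L_def\<close>)
    have near: "\<exists>l\<in>L. g \<otimes> l \<in> E <#> supp x" if gy: "g \<in> supp y" for g
    proof -
      have gc: "g \<in> carrier G" using gy by (rule suppt_closedD)
      obtain p where p: "p \<in> P" "g \<in> suppt (\<Delta> / 2) (fst p)"
        using shadows_supp_local[OF y(2) sepP \<epsilon>(2) gy] by blast
      obtain l where l: "l \<in> L" "fst p = act l x" using p by (auto simp: P_def orbit_patches_def)
      have "g \<otimes> l \<in> suppt (\<Delta> / 2) x"
        using mem_suppt_act[OF gc subsetD[OF Lc l(1)] x(1)] p(2) l(2) by simp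
      then show ?thesis using l(1) subsetD[OF E(3)[OF x(1)]] by (intro bexI[of _ l])
    qed
    have "supp y \<inter> Z0 = {}"
    proof (intro equals0I)
      fix g assume g: "g \<in> supp y \<inter> Z0"
      obtain l where l: "l \<in> L" "g \<otimes> l \<in> E <#> supp x" using near[OF IntD1[OF g]] by (rule bexE)
      obtain b h where bh: "b \<in> B" "h \<in> H" "g = b \<otimes> h" 
        using subsetD[OF B(3) IntD2[OF g]] unfolding mem_set_mult by (elim bexE)
      have "g \<otimes> l = b \<otimes> (h \<otimes> l)" using bh B(2) Hc Lc l by (simp add: m_assoc subset_iff)
      moreover have "h \<otimes> l \<in> H" using bh l LH H by (simp add: subgroup.m_closed subset_iff)
      ultimately have "g \<otimes> l \<in> B <#> H" using bh(1) by (simp add: set_multI)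
      then show False using Z(2)[OF suppt_closed x(5)] l by blast
    qed
    moreover have "bounded_mod H (supp y)"
    proof -
      have "bounded_mod H (E <#> supp x)"
        by (rule bounded_mod_mult[OF E(1,2) bounded_mod_mono[OF x(3) KH] Hc])
      then obtain R where R: "finite R" "R \<subseteq> carrier G" "E <#> supp x \<subseteq> R <#> H" unfolding bounded_mod_def by blast
      show ?thesis
      proof (rule bounded_modI[OF R(1,2)], rule subsetI)
        fix g assume g: "g \<in> supp y"
        obtain l where l: "l \<in> L" "g \<otimes> l \<in> E <#> supp x" using near[OF g] by (rule bexE)
        show "g \<in> R <#> H"
          by (rule mult_coset_absorb[OF H R(2) suppt_closedD[OF g] subsetD[OF LH l(1)] subsetD[OF R(3) l(2)]])
      qed
    qed
    ultimately have off: "T \<inter> supp ((f ^^ n) y) = {}" using Z0(2) y nily by blast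
    have p0: "(x, suppt t x) \<in> P"
    proof -
      have "(x, suppt t x) = translate \<one> (x, suppt t x)" using x by (simp add: translate_def coset_mult_one)
      then show ?thesis using subgroup.one_closed[OF L] unfolding P_def orbit_patches_def by (rule image_eqI)
    qed
    have "s \<in> supp ((f ^^ n) y)"
    proof (rule E3(3)[OF y(1)])
      fix h assume h: "h \<in> E3"
      then have hc: "h \<in> carrier G" using E3 by auto
      have "dist (act h y) (act h (fst (x, suppt t x))) < \<epsilon>"
      proof (rule shadowsD1[OF y(2) p0 hc])
        fix q assume q: "q \<in> P" "q \<noteq> (x, suppt t x)"
        obtain l where l: "l \<in> L" "q = translate l (x, suppt t x)" using q by (auto simp: P_def orbit_patches_def)
        show "h \<notin> J <#> snd q"
        proof
          assume "h \<in> J <#> snd q"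
          then have "h \<otimes> l \<in> C <#> K" using mem l hc JC by blast
          then obtain c k where ck: "c \<in> C" "k \<in> K" "h \<otimes> l = c \<otimes> k" unfolding mem_set_mult by blast
          have c: "c \<in> carrier G" "k \<in> carrier G" "l \<in> carrier G" using ck C Kc l Lc by auto
          have hl: "inv h \<otimes> c = l \<otimes> inv k"
          proof -
            have "inv h \<otimes> c = inv h \<otimes> (h \<otimes> l \<otimes> inv k)" using ck(3) c by (simp add: m_assoc)
            then show ?thesis using c hc by (simp add: m_assoc inv_mult_cancel_left)
          qed
          then have "inv h \<otimes> c \<in> K <#> N"
            using l LKN ck KKN KN by (simp add: subgroup.m_closed subgroup.m_inv_closed subset_iff)
          then have "inv h \<otimes> c \<in> K" using N(2) h ck by (meson UnI2 invsI set_multI)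
          then have "inv h \<otimes> c \<otimes> k \<in> K" using ck Ks by (simp add: subgroup.m_closed)
          then have "l \<in> K" using hl c by (simp add: m_assoc)
          then have "inv \<one> \<otimes> l \<in> K" using c by simp
          then have "translate \<one> (x, suppt t x) = translate l (x, suppt t x)"
            using same[of \<one> l] subgroup.one_closed[OF L] l by blast
          then show False using l q x by (simp add: translate_def coset_mult_one)
        qed
      qed
      then show "dist (act h y) (act h x) \<le> \<Delta>" using \<epsilon> by simp
    qed
    then show False using off s by blast
  qed
qed

end

section \<open>Limits of periodic points with finite patterns\<close>

context shadowing_system begin

lemma closed_X: "closed X"
  using compact_space by (rule compact_imp_closed)

lemma closure_in_X: "A \<subseteq> X \<Longrightarrow> closure A \<subseteq> X"
  using closed_X closure_minimal by blast

lemma closure_off: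
  assumes A: "A \<subseteq> X" and g: "g \<in> carrier G" and off: "\<And>a. a \<in> A \<Longrightarrow> g \<notin> suppt s ((f ^^ n) a)" and x: "x \<in> closure A"
  shows "g \<notin> suppt s ((f ^^ n) x)"
proof -
  have "continuous_on (closure A) (\<lambda>y. dist (act g ((f ^^ n) y)) zero)"
    by (intro continuous_on_dist continuous_on_const continuous_on_subset[OF continuous_act_fn[OF g] closure_in_X[OF A]])
  then have "closed (closure A \<inter> (\<lambda>y. dist (act g ((f ^^ n) y)) zero) -` {..s})"
    by (intro continuous_closed_preimage) auto
  moreover have "A \<subseteq> closure A \<inter> (\<lambda>y. dist (act g ((f ^^ n) y)) zero) -` {..s}"
    using off g closure_subset by (fastforce simp: suppt_def)
  ultimately have "x \<in> closure A \<inter> (\<lambda>y. dist (act g ((f ^^ n) y)) zero) -` {..s}"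
    using x closure_minimal by blast
  then show ?thesis by (simp add: suppt_def)
qed

lemma closure_supp_fn:
  assumes "A \<subseteq> X" "\<And>a. a \<in> A \<Longrightarrow> suppt s ((f ^^ n) a) \<subseteq> B" "x \<in> closure A"
  shows "suppt s ((f ^^ n) x) \<subseteq> B"
proof
  fix g assume g: "g \<in> suppt s ((f ^^ n) x)"
  show "g \<in> B"
  proof (rule ccontr)
    assume "g \<notin> B"
    then have "g \<notin> suppt s ((f ^^ n) x)"
      using assms(2) by (intro closure_off[OF assms(1) suppt_closedD[OF g] _ assms(3)]) blast
    then show False using g by contradiction
  qed
qed

lemma closure_act:
  assumes "A \<subseteq> X" "h \<in> carrier G" "\<And>a. a \<in> A \<Longrightarrow> act h a \<in> B" "x \<in> closure A"
  shows "act h x \<in> closure B"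
proof -
  have "act h ` closure A \<subseteq> closure B"
  proof (rule image_closure_subset)
    show "continuous_on (closure A) (act h)"
      using continuous_on_subset[OF continuous_act[OF assms(2)] closure_in_X[OF assms(1)]] .
    show "act h ` A \<subseteq> closure B" using assms(3) closure_subset by blast
  qed simp
  then show ?thesis using assms(4) by blast
qed

lemma closure_near:
  assumes A: "A \<subseteq> X" and E: "finite E" "E \<subseteq> carrier G" and d: "d > 0" and x: "x \<in> closure A"
  obtains a where "a \<in> A" "\<And>h. h \<in> E \<Longrightarrow> dist (act h a) (act h x) \<le> d"
proof -
  have xX: "x \<in> X" using closure_in_X[OF A] x by blast
  have "\<forall>h\<in>E. \<exists>e>0. \<forall>y\<in>X. dist y x < e \<longrightarrow> dist (act h y) (act h x) < d"
    using continuous_act xX d E(2) unfolding continuous_on_iff by blast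
  then obtain e where e: "\<And>h. h \<in> E \<Longrightarrow> e h > 0"
    "\<And>h y. h \<in> E \<Longrightarrow> y \<in> X \<Longrightarrow> dist y x < e h \<Longrightarrow> dist (act h y) (act h x) < d" by metis
  define r where "r = Min (insert 1 (e ` E))"
  have r: "r > 0" "\<And>h. h \<in> E \<Longrightarrow> r \<le> e h" using E e by (auto simp: r_def)
  then obtain a where a: "a \<in> A" "dist a x < r" using x unfolding closure_approachable by blast
  show ?thesis
  proof (rule that[OF a(1)])
    fix h assume h: "h \<in> E"
    have "dist (act h a) (act h x) < d"
      by (rule e(2)[OF h]) (use a A r(2)[OF h] in auto)
    then show "dist (act h a) (act h x) \<le> d" by simp
  qed
qed

text \<open>
  The points that are periodic under \<open>K\<close> and finite modulo these periods, located in \<open>V\<close> at threshold \<open>t\<close>. Points with larger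
  period groups are treated as limits of such points; this way confinement, a closed condition known for patterns, extends to them.
\<close>
definition patterns :: "'g set \<Rightarrow> real \<Rightarrow> 'g set \<Rightarrow> 'x set" where
  "patterns K t V = {x \<in> X. fixed_by K x \<and> bounded_mod K (supp x) \<and> suppt t x \<subseteq> V}"

lemma patterns_X: "patterns K t V \<subseteq> X"
  by (auto simp: patterns_def)

lemma patterns_mono: "t \<le> t' \<Longrightarrow> V \<subseteq> V' \<Longrightarrow> patterns K t V \<subseteq> patterns K t' V'"
  using suppt_antimono by (fastforce simp: patterns_def)

lemma patterns_closure_X: "closure (patterns K t V) \<subseteq> X"
  by (rule closure_in_X[OF patterns_X])

lemma patterns_closure_mono: "t \<le> t' \<Longrightarrow> V \<subseteq> V' \<Longrightarrow> closure (patterns K t V) \<subseteq> closure (patterns K t' V')"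
  by (intro closure_mono patterns_mono)

lemma patterns_closure_suppt:
  assumes "x \<in> closure (patterns K t V)" shows "suppt t x \<subseteq> V"
  using closure_supp_fn[OF patterns_X, of K t V t 0 V x] assms by (auto simp: patterns_def)

lemma patterns_act:
  assumes K: "K \<lhd> G" and h: "h \<in> carrier G" and x: "x \<in> patterns K t V"
  shows "act h x \<in> patterns K t (V #> inv h)"
proof -
  have Kc: "K \<subseteq> carrier G" using K by (simp add: normal_imp_subgroup subgroup.subset)
  have xX: "x \<in> X" "fixed_by K x" "bounded_mod K (supp x)" "suppt t x \<subseteq> V" using x by (auto simp: patterns_def)
  have "fixed_by K (act h x)"
    unfolding fixed_by_def
  proof
    fix k assume k: "k \<in> K"
    have kc: "k \<in> carrier G" using k Kc by auto
    have k': "inv h \<otimes> k \<otimes> h \<in> K" using normal.inv_op_closed1[OF K h k] .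
    have "act k (act h x) = act (k \<otimes> h) x" using kc h xX by (simp add: act_mult)
    also have "k \<otimes> h = h \<otimes> (inv h \<otimes> k \<otimes> h)" using kc h by (simp add: m_assoc mult_inv_cancel_left)
    also have "act (h \<otimes> (inv h \<otimes> k \<otimes> h)) x = act h (act (inv h \<otimes> k \<otimes> h) x)"
      using kc h xX(1) by (intro act_mult) auto
    also have "act (inv h \<otimes> k \<otimes> h) x = x" using xX(2) k' by (simp add: fixed_by_def)
    finally show "act k (act h x) = act h x" .
  qed
  moreover have "bounded_mod K (supp (act h x))"
    unfolding suppt_act[OF h xX(1)]
  proof (rule bounded_mod_rcoset[OF xX(3) inv_closed[OF h] Kc])
    fix k assume "k \<in> K"
    then show "inv (inv h) \<otimes> k \<otimes> inv h \<in> K" using normal.inv_op_closed2[OF K h] h by simp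
  qed
  moreover have "suppt t (act h x) \<subseteq> V #> inv h"
    unfolding suppt_act[OF h xX(1)] using xX(4) by (auto simp: r_coset_def)
  ultimately show ?thesis using xX(1) h by (simp add: patterns_def)
qed

lemma patterns_closure_act:
  assumes "K \<lhd> G" "h \<in> carrier G" "x \<in> closure (patterns K t V)"
  shows "act h x \<in> closure (patterns K t (V #> inv h))"
  using closure_act[OF patterns_X assms(2) _ assms(3)] patterns_act[OF assms(1,2)] by blast

text \<open>
  The glued point is approximated by points glued from finitely many patterns, which are patterns again. The
  threshold grows by \<open>\<epsilon>\<close>.
\<close>
lemma glue_in_patterns_closure:
  assumes K: "K \<lhd> G" and J: "glueing \<epsilon> J" and \<epsilon>: "0 < \<epsilon>" "4 * \<epsilon> \<le> \<Delta>" and t: "0 \<le> t" "t + \<epsilon> \<le> \<Delta>"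
    and sep: "separated J P" and y: "y \<in> X" "shadows \<epsilon> J P y"
    and P: "\<And>p. p \<in> P \<Longrightarrow> fst p \<in> closure (patterns K t (snd p))"
    and PV: "\<And>p. p \<in> P \<Longrightarrow> snd p \<subseteq> carrier G"
    and PK: "\<And>p k. p \<in> P \<Longrightarrow> k \<in> K \<Longrightarrow> snd p #> k = snd p"
  shows "y \<in> closure (patterns K (t + \<epsilon>) (\<Union>p\<in>P. snd p))"
  unfolding closure_approachable
proof (intro allI impI)
  fix \<eta> :: real assume \<eta>: "0 < \<eta>"
  have Ks: "subgroup K G" using K by (rule normal_imp_subgroup)
  have Kc: "K \<subseteq> carrier G" using Ks by (rule subgroup.subset)
  have Jf: "finite J" "J \<subseteq> carrier G" using J by (auto simp: glueing_def)
  obtain E Q where E: "finite E" "E \<subseteq> carrier G" and Q: "finite Q" "Q \<subseteq> P"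
    and close: "\<forall>\<xi>. \<forall>z\<in>X. (\<forall>p\<in>Q. \<forall>h\<in>E. dist (act h (\<xi> p)) (act h (fst p)) \<le> \<Delta> / 2) \<longrightarrow>
       shadows \<epsilon> J ((\<lambda>p. (\<xi> p, snd p)) ` Q) z \<longrightarrow> dist z y < \<eta>"
    by (rule shadows_approx[OF y(2) sep y(1) \<epsilon>(2) \<eta>]) (rule that)
  have "\<exists>x. x \<in> patterns K t (snd p) \<and> (\<forall>h\<in>E. dist (act h x) (act h (fst p)) \<le> \<Delta> / 2)" if p: "p \<in> Q" for p
  proof -
    have "\<Delta> / 2 > 0" using \<Delta>_pos by simp
    then show ?thesis
      by (rule closure_near[OF patterns_X E _ P[OF subsetD[OF Q(2) p]]]) (rule exI, rule conjI, assumption, rule ballI)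
  qed
  then have "\<exists>\<xi>. \<forall>p\<in>Q. \<xi> p \<in> patterns K t (snd p) \<and> (\<forall>h\<in>E. dist (act h (\<xi> p)) (act h (fst p)) \<le> \<Delta> / 2)"
    by (intro bchoice ballI)
  then obtain \<xi> where \<xi>0: "\<forall>p\<in>Q. \<xi> p \<in> patterns K t (snd p) \<and> (\<forall>h\<in>E. dist (act h (\<xi> p)) (act h (fst p)) \<le> \<Delta> / 2)" ..
  then have \<xi>: "\<And>p. p \<in> Q \<Longrightarrow> \<xi> p \<in> patterns K t (snd p)" by simp
  have \<xi>D: "\<xi> p \<in> X" "fixed_by K (\<xi> p)" "bounded_mod K (supp (\<xi> p))" "suppt t (\<xi> p) \<subseteq> snd p" if "p \<in> Q" for p
    using \<xi>[OF that] by (auto simp: patterns_def)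
  define R where "R = (\<lambda>p. (\<xi> p, snd p)) ` Q"
  have patR: "patches R"
    unfolding patches_def
  proof (intro ballI conjI)
    fix r assume "r \<in> R"
    then obtain p where p: "p \<in> Q" "r = (\<xi> p, snd p)" by (auto simp: R_def)
    show "fst r \<in> X" "snd r \<subseteq> carrier G" using p(2) \<xi>D(1)[OF p(1)] PV[OF subsetD[OF Q(2) p(1)]] by simp_all
    show "supp (fst r) \<subseteq> snd r" using \<xi>D(4)[OF p(1)] p suppt_antimono[of t \<Delta> "\<xi> p"] t \<epsilon> by auto
  qed
  have sepR: "separated J R"
    unfolding separated_def
  proof (intro ballI impI)
    fix r r' assume "r \<in> R" "r' \<in> R" "r \<noteq> r'"
    then obtain p p' where p: "p \<in> Q" "r = (\<xi> p, snd p)" "p' \<in> Q" "r' = (\<xi> p', snd p')" by (auto simp: R_def)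
    then have "p \<noteq> p'" using \<open>r \<noteq> r'\<close> by auto
    then show "(J <#> snd r) \<inter> (J <#> snd r') = {}"
      using sep p Q unfolding separated_def by (metis snd_conv subsetD)
  qed
  obtain z where z: "z \<in> X" "shadows \<epsilon> J R z" using J patR sepR by (auto simp: glueing_def)
  have "fixed_by K z"
    unfolding fixed_by_def
  proof
    fix k assume k: "k \<in> K"
    have kc: "k \<in> carrier G" using k Kc by auto
    have "translate k r = r" if "r \<in> R" for r
    proof -
      obtain p where p: "p \<in> Q" "r = (\<xi> p, snd p)" using \<open>r \<in> R\<close> by (auto simp: R_def)
      have "inv k \<in> K" using Ks k by (simp add: subgroup.m_inv_closed)
      then show ?thesis
        using p(2) \<xi>D(2)[OF p(1)] k PK[OF subsetD[OF Q(2) p(1)]] by (simp add: translate_def fixed_by_def)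
    qed
    then have "translate k ` R = R" by (simp add: image_def)
    then show "act k z = z" using \<epsilon> by (intro shadows_fixed[OF z(2) patR sepR Jf(2) kc z(1)]) auto
  qed
  moreover have "bounded_mod K (supp z)"
  proof -
    obtain D where D: "finite D" "D \<subseteq> carrier G" "\<And>x. x \<in> X \<Longrightarrow> suppt (\<Delta> / 2) x \<subseteq> D <#> supp x"
      using suppt_supp[of "\<Delta> / 2"] \<Delta>_pos by (metis half_gt_zero)
    have "supp z \<subseteq> (\<Union>p\<in>Q. D <#> supp (\<xi> p))"
    proof
      fix g assume g: "g \<in> supp z"
      obtain r where r: "r \<in> R" "g \<in> suppt (\<Delta> / 2) (fst r)"
      proof (rule shadows_supp_local[OF z(2) sepR _ g])
        show "2 * \<epsilon> \<le> \<Delta>" using \<epsilon> by simp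
      qed
      then obtain p where p: "p \<in> Q" "r = (\<xi> p, snd p)" by (auto simp: R_def)
      then show "g \<in> (\<Union>p\<in>Q. D <#> supp (\<xi> p))" using r D(3)[OF \<xi>D(1)[OF p(1)]] by auto
    qed
    moreover have "bounded_mod K (\<Union>p\<in>Q. D <#> supp (\<xi> p))"
      using bounded_mod_mult[OF D(1,2) \<xi>D(3) Kc] by (intro bounded_mod_UN[OF Q(1)]) blast
    ultimately show ?thesis using bounded_mod_subset by blast
  qed
  moreover have "suppt (t + \<epsilon>) z \<subseteq> (\<Union>p\<in>P. snd p)"
  proof -
    have "suppt (t + \<epsilon>) z \<subseteq> (\<Union>r\<in>R. snd r)"
    proof (rule shadows_suppt[OF z(2) sepR z(1) t(1)])
      show "0 \<le> \<epsilon>" using \<epsilon> by simp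
      fix r assume "r \<in> R"
      then obtain p where p: "p \<in> Q" "r = (\<xi> p, snd p)" by (auto simp: R_def)
      then show "suppt t (fst r) \<subseteq> snd r" using \<xi>D(4)[OF p(1)] by simp
    qed
    also have "\<dots> \<subseteq> (\<Union>p\<in>P. snd p)" using Q by (auto simp: R_def)
    finally show ?thesis .
  qed
  ultimately have "z \<in> patterns K (t + \<epsilon>) (\<Union>p\<in>P. snd p)" using z(1) by (simp add: patterns_def)
  moreover have "dist z y < \<eta>" using close[rule_format, of z \<xi>] z \<xi>0 unfolding R_def by simp
  ultimately show "\<exists>z\<in>patterns K (t + \<epsilon>) (\<Union>p\<in>P. snd p). dist z y < \<eta>" by blast
qed

end

section \<open>Walls along a cyclic direction\<close>

text \<open>
  The one-dimensional situation: supports of patterns in \<open>U\<close> stay in the slabs \<open>T L a\<^sup>i\<close>, and \<open>a\<close> has infinite order modulo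
  the group of periods \<open>L\<close>. The gap between the thresholds \<open>t0\<close> and \<open>t1\<close> is room for gluing.
\<close>
locale cyclic_confinement = shadowing_system G X act zero S f \<Delta>
  for G :: "('g, 'm) monoid_scheme" (structure)
    and X :: "'x::metric_space set"
    and act :: "'g \<Rightarrow> 'x \<Rightarrow> 'x"
    and zero :: 'x and S :: "'g set" and f :: "'x \<Rightarrow> 'x" and \<Delta> :: real +
  fixes K L H :: "'g set" and a :: 'g and t0 t1 :: real and U T :: "'g set"
  assumes K: "K \<lhd> G" and L: "subgroup L G" and H: "subgroup H G" and KL: "K \<subseteq> L" and LH: "L \<subseteq> H"
    and normL: "\<And>h l. h \<in> H \<Longrightarrow> l \<in> L \<Longrightarrow> inv h \<otimes> l \<otimes> h \<in> L"
    and a: "a \<in> H" and a_inf: "\<And>i::int. i \<noteq> 0 \<Longrightarrow> a [^] i \<notin> L"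
    and t: "0 < t0" "t0 < t1" "t1 \<le> \<Delta>"
    and U: "U \<subseteq> carrier G" "\<And>h. h \<in> H \<Longrightarrow> U #> h \<subseteq> U"
    and T: "finite T" "T \<subseteq> carrier G"
    and slabs: "\<And>x n. x \<in> closure (patterns K t1 U) \<Longrightarrow> supp ((f ^^ n) x) \<subseteq> (\<Union>i::int. (T <#> L) #> a [^] i)"
begin

lemma Lc: "L \<subseteq> carrier G" and Hc: "H \<subseteq> carrier G" and Kc: "K \<subseteq> carrier G"
  using L H K by (simp_all add: subgroup.subset normal_imp_subgroup)

lemma ac [simp]: "a \<in> carrier G" using a Hc by blast

lemma powH: "a [^] (i::int) \<in> H" using a H by (simp add: subgroup_int_pow_closed)

lemma powc [simp]: "a [^] (i::int) \<in> carrier G" by simp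

lemma pow_add: "a [^] (i + j :: int) = a [^] i \<otimes> a [^] j" by (simp add: int_pow_mult)

lemma pow_inv: "inv (a [^] (i::int)) = a [^] (- i)" by (simp add: int_pow_neg)

abbreviation slab :: "int \<Rightarrow> 'g set" where "slab i \<equiv> (T <#> L) #> a [^] i"

lemma TLc: "T <#> L \<subseteq> carrier G" using T Lc by (simp add: set_mult_closed)

lemma TLb: "bounded_mod L (T <#> L)" by (rule bounded_modI[OF T order.refl])

lemma rcos_pow:
  "A \<subseteq> carrier G \<Longrightarrow> A #> a [^] (i::int) #> a [^] (j::int) = A #> a [^] (i + j)"
  by (simp add: coset_mult_assoc pow_add)

lemma bounded_rcos_pow: "bounded_mod L A \<Longrightarrow> bounded_mod L (A #> a [^] (i::int))"
  using bounded_mod_rcoset[of L A "a [^] i"] Lc normL[OF powH] by simp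

lemma separation:
  assumes "bounded_mod L A" "bounded_mod L B"
  obtains r :: int where "r \<ge> 0" "\<And>i. (A #> a [^] i) \<inter> B \<noteq> {} \<Longrightarrow> \<bar>i\<bar> \<le> r"
  using slab_separation[OF L ac a_inf normL[OF powH] assms] by blast

lemma mem_slab:
  assumes "g \<in> slab i"
  obtains s l where "s \<in> T" "l \<in> L" "g = s \<otimes> a [^] i \<otimes> l"
proof -
  obtain s l where sl: "s \<in> T" "l \<in> L" "g = s \<otimes> l \<otimes> a [^] i"
    using assms unfolding r_coset_def by (auto simp: mem_set_mult)
  have c: "s \<in> carrier G" "l \<in> carrier G" using sl T Lc by auto
  have "g = s \<otimes> a [^] i \<otimes> (inv (a [^] i) \<otimes> l \<otimes> a [^] i)"
    using sl(3) c by (simp add: m_assoc mult_inv_cancel_left)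
  then show ?thesis using that[OF sl(1) normL[OF powH sl(2)]] by blast
qed

text \<open>
  Modulo the periods \<open>L\<close> a slab is finite.
\<close>
lemma slab_off:
  assumes "x \<in> X" "fixed_by L x" "(T #> a [^] (i::int)) \<inter> supp ((f ^^ n) x) = {}"
  shows "slab i \<inter> supp ((f ^^ n) x) = {}"
proof (rule ccontr)
  assume "slab i \<inter> supp ((f ^^ n) x) \<noteq> {}"
  then obtain g where g: "g \<in> slab i" "g \<in> supp ((f ^^ n) x)" by blast
  obtain s l where sl: "s \<in> T" "l \<in> L" "g = s \<otimes> a [^] i \<otimes> l" using mem_slab[OF g(1)] by blast
  have sc: "s \<otimes> a [^] i \<in> carrier G" using sl T by auto
  have "act l ((f ^^ n) x) = (f ^^ n) x"
    using fixed_by_fn[OF assms(1) Lc assms(2)] sl(2) by (simp add: fixed_by_def)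
  then have "s \<otimes> a [^] i \<in> supp ((f ^^ n) x)"
    using supp_fixed[OF fn_closed[OF assms(1)] subsetD[OF Lc sl(2)] _ sc] g(2) sl(3) by simp
  moreover have "s \<otimes> a [^] i \<in> T #> a [^] i" using sl(1) by (auto simp: r_coset_def)
  ultimately show False using assms(3) by blast
qed

lemma slab_shift:
  assumes "x \<in> X" "slab i \<inter> supp ((f ^^ n) (act (a [^] j) x)) = {}"
  shows "slab (i + j) \<inter> supp ((f ^^ n) x) = {}"
proof (rule ccontr)
  assume "slab (i + j) \<inter> supp ((f ^^ n) x) \<noteq> {}"
  then obtain g where g: "g \<in> slab (i + j)" "g \<in> supp ((f ^^ n) x)" by blast
  then have "g \<in> slab i #> a [^] j" using rcos_pow[OF TLc] by simp
  then obtain h where h: "h \<in> slab i" "g = h \<otimes> a [^] j" by (auto simp: r_coset_def)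
  have hc: "h \<in> carrier G" using h(1) r_coset_subset_G[OF TLc powc] by blast
  have "h \<in> supp ((f ^^ n) (act (a [^] j) x))"
    using mem_suppt_act[OF hc powc fn_closed[OF assms(1)]] g(2) h(2) assms(1) by (simp add: fn_act)
  then show False using assms(2) h(1) by blast
qed

definition region :: "'g set \<Rightarrow> bool" where
  "region V \<longleftrightarrow> V \<subseteq> U \<and> bounded_mod L V \<and> (\<forall>l\<in>L. V #> l = V)"

definition finite_patterns :: "real \<Rightarrow> 'x set" where
  "finite_patterns s = {x \<in> X. fixed_by L x \<and> (\<exists>V. region V \<and> x \<in> closure (patterns K s V))}"

text \<open>
  The half-open interval of thresholds makes this set of points closed under gluing with a sufficiently small \<open>\<epsilon>\<close>.
\<close>
definition base :: "'x set" where "base = (\<Union>s\<in>{t0..<t1}. finite_patterns s)"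

lemma region_carrier: "region V \<Longrightarrow> V \<subseteq> carrier G"
  using U by (auto simp: region_def)

lemma region_UN:
  assumes "finite I" "\<And>i. i \<in> I \<Longrightarrow> region (V i)" shows "region (\<Union>i\<in>I. V i)"
  using assms unfolding region_def
  by (auto intro: bounded_mod_UN simp: r_coset_def)

lemma region_rcos:
  assumes V: "region V" and h: "h \<in> H" shows "region (V #> h)"
  unfolding region_def
proof (intro conjI ballI)
  have hc: "h \<in> carrier G" using h Hc by blast
  have Vc: "V \<subseteq> carrier G" using V by (rule region_carrier)
  show "V #> h \<subseteq> U" using U(2)[OF h] V unfolding region_def r_coset_def by blast
  show "bounded_mod L (V #> h)"
    using bounded_mod_rcoset[OF _ hc Lc normL[OF h]] V by (simp add: region_def)
  fix l assume l: "l \<in> L"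
  have lc: "l \<in> carrier G" using l Lc by blast
  have hlh: "h \<otimes> l \<otimes> inv h \<in> L"
    using normL[OF subgroup.m_inv_closed[OF H h] l] hc by simp
  have "V #> h #> l = V #> (h \<otimes> l \<otimes> inv h) #> h"
    using Vc hc lc by (simp add: coset_mult_assoc m_assoc)
  also have "V #> (h \<otimes> l \<otimes> inv h) = V" using V hlh by (simp add: region_def)
  finally show "V #> h #> l = V #> h" .
qed

lemma finite_patterns_X: "finite_patterns s \<subseteq> X" by (auto simp: finite_patterns_def)
lemma base_X: "base \<subseteq> X" using finite_patterns_X by (auto simp: base_def)

lemma fixed_by_act:
  assumes "x \<in> X" "fixed_by L x" "h \<in> H" shows "fixed_by L (act h x)"
  unfolding fixed_by_def
proof
  fix l assume l: "l \<in> L"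
  have c: "l \<in> carrier G" "h \<in> carrier G" using l assms Lc Hc by auto
  have "act l (act h x) = act (l \<otimes> h) x" using c assms by (simp add: act_mult)
  also have "l \<otimes> h = h \<otimes> (inv h \<otimes> l \<otimes> h)" using c by (simp add: m_assoc mult_inv_cancel_left)
  also have "act (h \<otimes> (inv h \<otimes> l \<otimes> h)) x = act h (act (inv h \<otimes> l \<otimes> h) x)"
    using c assms(1) by (intro act_mult) auto
  also have "act (inv h \<otimes> l \<otimes> h) x = x" using assms normL l by (simp add: fixed_by_def)
  finally show "act l (act h x) = act h x" .
qed

lemma finite_patterns_act:
  assumes x: "x \<in> finite_patterns s" and h: "h \<in> H" shows "act h x \<in> finite_patterns s"
proof -
  have hc: "h \<in> carrier G" using h Hc by blast
  obtain V where V: "region V" "x \<in> closure (patterns K s V)" using x by (auto simp: finite_patterns_def)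
  have "region (V #> inv h)" by (rule region_rcos[OF V(1) subgroup.m_inv_closed[OF H h]])
  moreover have "act h x \<in> closure (patterns K s (V #> inv h))" by (rule patterns_closure_act[OF K hc V(2)])
  ultimately show ?thesis using x hc h fixed_by_act by (auto simp: finite_patterns_def)
qed

lemma base_closure_act: "x \<in> closure base \<Longrightarrow> h \<in> H \<Longrightarrow> act h x \<in> closure base"
  using closure_act[OF base_X, of h base x] finite_patterns_act Hc by (auto simp: base_def)

lemma base_closure_patterns: "closure base \<subseteq> closure (patterns K t1 U)"
proof (rule closure_minimal)
  show "base \<subseteq> closure (patterns K t1 U)"
  proof
    fix x assume "x \<in> base"
    then obtain s V where "s < t1" "region V" "x \<in> closure (patterns K s V)"
      by (auto simp: base_def finite_patterns_def)
    then show "x \<in> closure (patterns K t1 U)"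
      using patterns_closure_mono[of s t1 V U] by (auto simp: region_def)
  qed
qed simp

lemma glue_closure_base:
  assumes J: "glueing \<epsilon> J" and \<epsilon>: "0 < \<epsilon>" "4 * \<epsilon> \<le> \<Delta>" and s: "t0 \<le> s" "s + \<epsilon> < t1"
    and sep: "separated J P" and y: "y \<in> X" "shadows \<epsilon> J P y"
    and P: "\<And>p. p \<in> P \<Longrightarrow> fst p \<in> closure (patterns K s (snd p)) \<and> fixed_by L (fst p) \<and> region (snd p)"
  shows "fixed_by L y" "y \<in> closure base"
proof -
  have Jf: "finite J" "J \<subseteq> carrier G" using J by (auto simp: glueing_def)
  have s0: "0 \<le> s" "s + \<epsilon> \<le> \<Delta>" "s \<le> \<Delta>" using s t \<epsilon> by auto
  have PD: "fst p \<in> X" "snd p \<subseteq> carrier G" "supp (fst p) \<subseteq> snd p" if "p \<in> P" for p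
    using P[OF that] patterns_closure_X region_carrier patterns_closure_suppt suppt_antimono[OF s0(3), of "fst p"]
    by blast+
  have patP: "patches P" using PD by (simp add: patches_def)
  have tr: "translate l p = p" if "p \<in> P" "l \<in> L" for p l
    using P[OF that(1)] that(2) subgroup.m_inv_closed[OF L that(2)]
    by (simp add: translate_def fixed_by_def region_def)
  have Lfix: "fixed_by L z" if "Q \<subseteq> P" "z \<in> X" "shadows \<epsilon> J Q z" for Q z
    unfolding fixed_by_def
  proof
    fix l assume l: "l \<in> L"
    have "patches Q" "separated J Q" using that(1) patP sep patches_subset separated_subset by blast+
    moreover have "translate l ` Q = Q" using tr[OF subsetD[OF that(1)] l] by (simp add: image_def)
    ultimately show "act l z = z" using \<epsilon> l Lc by (intro shadows_fixed[OF that(3) _ _ Jf(2) _ that(2)]) auto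
  qed
  show "fixed_by L y" by (rule Lfix[OF order.refl y])
  show "y \<in> closure base"
    unfolding closure_approachable
  proof (intro allI impI)
    fix \<eta> :: real assume \<eta>: "0 < \<eta>"
    obtain E Q where E: "finite E" "E \<subseteq> carrier G" and Q: "finite Q" "Q \<subseteq> P"
      and close: "\<forall>\<xi>. \<forall>z\<in>X. (\<forall>p\<in>Q. \<forall>h\<in>E. dist (act h (\<xi> p)) (act h (fst p)) \<le> \<Delta> / 2) \<longrightarrow>
         shadows \<epsilon> J ((\<lambda>p. (\<xi> p, snd p)) ` Q) z \<longrightarrow> dist z y < \<eta>"
      by (rule shadows_approx[OF y(2) sep y(1) \<epsilon>(2) \<eta>]) (rule that)
    have patQ: "patches Q" and sepQ: "separated J Q" 
      using Q(2) patP sep patches_subset separated_subset by blast+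
    obtain z where z: "z \<in> X" "shadows \<epsilon> J Q z" using J patQ sepQ by (auto simp: glueing_def)
    have "dist z y < \<eta>" using close[rule_format, of z fst] z \<Delta>_pos by simp
    moreover have "z \<in> base"
    proof -
      have "z \<in> closure (patterns K (s + \<epsilon>) (\<Union>p\<in>Q. snd p))"
      proof (rule glue_in_patterns_closure[OF K J \<epsilon> s0(1,2) sepQ z])
        fix p assume "p \<in> Q"
        then have p: "p \<in> P" using Q by blast
        show "fst p \<in> closure (patterns K s (snd p))" "snd p \<subseteq> carrier G" using P[OF p] PD[OF p] by auto
        show "\<And>k. k \<in> K \<Longrightarrow> snd p #> k = snd p" using P[OF p] KL by (auto simp: region_def)
      qed
      moreover have "region (\<Union>p\<in>Q. snd p)" using P Q by (intro region_UN) auto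
      ultimately have "z \<in> finite_patterns (s + \<epsilon>)"
        using z Lfix[OF Q(2) z] by (auto simp: finite_patterns_def)
      then show ?thesis using s \<epsilon> by (auto simp: base_def)
    qed
    ultimately show "\<exists>z\<in>base. dist z y < \<eta>" by blast
  qed
qed

lemma slab_step_bound:
  assumes "finite E" "E \<subseteq> carrier G"
  obtains r :: int where "r \<ge> 0"
    "\<And>i j g e. e \<in> E \<Longrightarrow> g \<in> slab i \<Longrightarrow> e \<otimes> g \<in> slab j \<Longrightarrow> \<bar>i - j\<bar> \<le> r"
proof -
  have "bounded_mod L (E <#> (T <#> L))" by (rule bounded_mod_mult[OF assms TLb Lc])
  then obtain r :: int where r: "r \<ge> 0" "\<And>i. ((E <#> (T <#> L)) #> a [^] i) \<inter> (T <#> L) \<noteq> {} \<Longrightarrow> \<bar>i\<bar> \<le> r"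
    using separation[OF _ TLb] by blast
  show ?thesis
  proof (rule that[OF r(1)])
    fix i j g e assume *: "e \<in> E" "g \<in> slab i" "e \<otimes> g \<in> slab j"
    obtain x where x: "x \<in> T <#> L" "g = x \<otimes> a [^] i" using *(2) by (auto simp: r_coset_def)
    obtain y where y: "y \<in> T <#> L" "e \<otimes> g = y \<otimes> a [^] j" using *(3) by (auto simp: r_coset_def)
    have c: "x \<in> carrier G" "y \<in> carrier G" "e \<in> carrier G" using x y * assms TLc by auto
    have "e \<otimes> x \<otimes> a [^] (i - j) = (e \<otimes> g) \<otimes> a [^] (- j)"
      using x c pow_add[of i "- j"] by (simp add: m_assoc)
    also have "\<dots> = y \<otimes> (a [^] j \<otimes> a [^] (- j))" using y c by (simp add: m_assoc)
    also have "\<dots> = y" using c pow_add[of j "- j"] by simp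
    finally have "y \<in> (E <#> (T <#> L)) #> a [^] (i - j)"
      using set_multI[OF *(1) x(1)] by (auto simp: r_coset_def)
    then show "\<bar>i - j\<bar> \<le> r" using r(2)[of "i - j"] y(1) by blast
  qed
qed

text \<open>
  Once confined to the slabs between two walls, which remain empty, a support can never jump over them: in one
  step it moves by at most \<open>r\<close> slabs.
\<close>
lemma walls_confine:
  assumes y: "y \<in> X" "y \<in> closure (patterns K t1 U)"
    and E: "E \<subseteq> carrier G" "\<And>x. x \<in> X \<Longrightarrow> supp (f x) \<subseteq> E <#> supp x"
    and r: "\<And>i j g e. e \<in> E \<Longrightarrow> g \<in> slab i \<Longrightarrow> e \<otimes> g \<in> slab j \<Longrightarrow> \<bar>i - j\<bar> \<le> r"
    and start: "supp ((f ^^ m) y) \<subseteq> (\<Union>i\<in>{-c..c}. slab i)"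
    and wall: "\<And>n i. n \<ge> m \<Longrightarrow> \<bar>i - c\<bar> \<le> r \<or> \<bar>i + c\<bar> \<le> r \<Longrightarrow> slab i \<inter> supp ((f ^^ n) y) = {}"
    and n: "n \<ge> m"
  shows "supp ((f ^^ n) y) \<subseteq> (\<Union>i\<in>{-c..c}. slab i)"
  using n
proof (induction n rule: dec_induct)
  case base show ?case by (rule start)
next
  case (step n)
  show ?case
  proof
    fix g assume g: "g \<in> supp ((f ^^ Suc n) y)"
    then have "g \<in> supp (f ((f ^^ n) y))" by simp
    then have "g \<in> E <#> supp ((f ^^ n) y)" by (rule subsetD[OF E(2)[OF fn_closed[OF y(1)]]])
    then obtain e h where eh: "e \<in> E" "h \<in> supp ((f ^^ n) y)" "g = e \<otimes> h"
      unfolding mem_set_mult by (elim bexE)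
    obtain i where i: "-c \<le> i" "i \<le> c" "h \<in> slab i" 
      using subsetD[OF step.IH eh(2)] by auto
    obtain j where j: "g \<in> slab j" using slabs[OF y(2)] g by blast
    have ij: "\<bar>i - j\<bar> \<le> r" using r[OF eh(1) i(3)] j eh(3) by simp
    have "-c \<le> j \<and> j \<le> c"
    proof (rule ccontr)
      assume "\<not> (-c \<le> j \<and> j \<le> c)"
      then have "\<bar>j - c\<bar> \<le> r \<or> \<bar>j + c\<bar> \<le> r" using ij i by linarith
      then have "slab j \<inter> supp ((f ^^ Suc n) y) = {}" using step.hyps by (intro wall) auto
      then show False using j g by blast
    qed
    then show "g \<in> (\<Union>i\<in>{-c..c}. slab i)" using j by auto
  qed
qed

lemma mem_rcos_pow:
  assumes "A \<subseteq> carrier G" "g \<in> carrier G"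
  shows "g \<in> A #> a [^] (i + j :: int) \<longleftrightarrow> g \<otimes> a [^] (- j) \<in> A #> a [^] i"
proof
  assume "g \<in> A #> a [^] (i + j)"
  then obtain x where x: "x \<in> A" "g = x \<otimes> a [^] (i + j)" by (auto simp: r_coset_def)
  then have "x \<in> carrier G" using assms by blast
  then have "g \<otimes> a [^] (- j) = x \<otimes> a [^] i" using x pow_add[of "i + j" "- j"] by (simp add: m_assoc)
  then show "g \<otimes> a [^] (- j) \<in> A #> a [^] i" using x by (auto simp: r_coset_def)
next
  assume "g \<otimes> a [^] (- j) \<in> A #> a [^] i"
  then obtain x where x: "x \<in> A" "g \<otimes> a [^] (- j) = x \<otimes> a [^] i" by (auto simp: r_coset_def)
  then have xc: "x \<in> carrier G" using assms by blast
  have "g = g \<otimes> (a [^] (- j) \<otimes> a [^] j)" using pow_add[of "- j" j] assms by simp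
  also have "\<dots> = (g \<otimes> a [^] (- j)) \<otimes> a [^] j" using assms by (simp add: m_assoc)
  also have "\<dots> = x \<otimes> a [^] (i + j)" using x xc pow_add[of i j] by (simp add: m_assoc)
  finally show "g \<in> A #> a [^] (i + j)" using x by (auto simp: r_coset_def)
qed

end

text \<open>
  The data of the wall construction: a point \<open>w\<close> such that every point near \<open>w\<close> is zero on the slabs around \<open>0\<close> from time \<open>N\<close> on, and
  a spacing \<open>p\<close> at which translates of \<open>w\<close> can be glued without affecting each other's nearness to \<open>w\<close> on the window \<open>D\<close>.
\<close>
locale walls = cyclic_confinement G X act zero S f \<Delta> K L H a t0 t1 U T
  for G :: "('g, 'm) monoid_scheme" (structure)
    and X :: "'x::metric_space set"
    and act :: "'g \<Rightarrow> 'x \<Rightarrow> 'x"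
    and zero :: 'x and S :: "'g set" and f :: "'x \<Rightarrow> 'x" and \<Delta> :: real
    and K L H :: "'g set" and a :: 'g and t0 t1 :: real and U T :: "'g set" +
  fixes E :: "'g set" and r :: int and w :: 'x and V :: "'g set" and s \<eta> \<epsilon> :: real and N :: nat
    and J D :: "'g set" and p :: int
  assumes E: "E \<subseteq> carrier G" "\<And>x. x \<in> X \<Longrightarrow> supp (f x) \<subseteq> E <#> supp x"
    and r: "\<And>i j g e. e \<in> E \<Longrightarrow> g \<in> slab i \<Longrightarrow> e \<otimes> g \<in> slab j \<Longrightarrow> \<bar>i - j\<bar> \<le> r"
    and w: "w \<in> closure (patterns K s V)" "fixed_by L w" "region V"
    and s: "t0 \<le> s" "s + \<epsilon> < t1"
    and silent: "\<And>y n i. y \<in> closure base \<Longrightarrow> fixed_by L y \<Longrightarrow> dist y w < \<eta> \<Longrightarrow> n \<ge> N \<Longrightarrow> \<bar>i\<bar> \<le> r \<Longrightarrow>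
        slab i \<inter> supp ((f ^^ n) y) = {}"
    and J: "glueing \<epsilon> J" and \<epsilon>: "0 < \<epsilon>" "4 * \<epsilon> \<le> \<Delta>"
    and D: "finite D" "D \<subseteq> carrier G"
      "\<And>x y. x \<in> X \<Longrightarrow> y \<in> X \<Longrightarrow> (\<And>h. h \<in> D \<Longrightarrow> dist (act h x) (act h y) \<le> \<Delta>) \<Longrightarrow> dist x y < \<eta>"
    and p: "p > 0" "\<And>i. ((J <#> V) #> a [^] i) \<inter> ((J <#> V) \<union> D) \<noteq> {} \<Longrightarrow> \<bar>i\<bar> < p"
begin

lemma Jf: "finite J" "J \<subseteq> carrier G" "\<one> \<in> J" using J by (auto simp: glueing_def)
lemma Vc: "V \<subseteq> carrier G" using w(3) by (rule region_carrier)
lemma Vb: "bounded_mod L V" using w(3) by (simp add: region_def)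
lemma wX: "w \<in> X" using w(1) patterns_closure_X by blast
lemma JVc: "J <#> V \<subseteq> carrier G" using Jf Vc by (simp add: set_mult_closed)
lemma JVb: "bounded_mod L (J <#> V)" by (rule bounded_mod_mult[OF Jf(1,2) Vb Lc])

definition brick :: "int \<Rightarrow> 'x \<times> 'g set" where
  "brick k = (act (a [^] (- (k * p))) w, V #> a [^] (k * p))"

lemma fst_brick: "fst (brick k) = act (a [^] (- (k * p))) w"
  and snd_brick: "snd (brick k) = V #> a [^] (k * p)"
  by (simp_all add: brick_def)

lemma J_brick: "J <#> snd (brick k) = (J <#> V) #> a [^] (k * p)"
  using Jf Vc by (simp add: snd_brick setmult_rcos_assoc)

lemma brick_disjoint:
  assumes "k \<noteq> k'" shows "(J <#> snd (brick k)) \<inter> (J <#> snd (brick k')) = {}"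
proof (rule ccontr)
  assume "(J <#> snd (brick k)) \<inter> (J <#> snd (brick k')) \<noteq> {}"
  then obtain g where g: "g \<in> (J <#> V) #> a [^] (k * p)" "g \<in> (J <#> V) #> a [^] (k' * p)"
    unfolding J_brick by blast
  have gc: "g \<in> carrier G" using g(1) r_coset_subset_G[OF JVc powc] by blast
  have "g \<in> (J <#> V) #> a [^] ((k * p - k' * p) + k' * p)" using g(1) by simp
  then have 1: "g \<otimes> a [^] (- (k' * p)) \<in> (J <#> V) #> a [^] (k * p - k' * p)"
    using mem_rcos_pow[OF JVc gc] by blast
  have "g \<in> (J <#> V) #> a [^] (0 + k' * p)" using g(2) by simp
  then have "g \<otimes> a [^] (- (k' * p)) \<in> (J <#> V) #> a [^] (0::int)" using mem_rcos_pow[OF JVc gc] by blast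
  then have "g \<otimes> a [^] (- (k' * p)) \<in> J <#> V" using coset_mult_one[OF JVc] by simp
  then have "\<bar>k * p - k' * p\<bar> < p" using 1 p(2) by blast
  then have "\<bar>k - k'\<bar> * p < 1 * p" using p(1) by (simp add: abs_mult left_diff_distrib[symmetric])
  then show False using assms p(1) by simp
qed

lemma brick_props:
  "fst (brick k) \<in> closure (patterns K s (snd (brick k))) \<and> fixed_by L (fst (brick k)) \<and> region (snd (brick k))"
proof (intro conjI)
  show "fst (brick k) \<in> closure (patterns K s (snd (brick k)))"
    using patterns_closure_act[OF K powc[of "- (k * p)"] w(1)] by (simp add: fst_brick snd_brick pow_inv)
  show "fixed_by L (fst (brick k))" unfolding fst_brick by (rule fixed_by_act[OF wX w(2) powH])
  show "region (snd (brick k))" unfolding snd_brick by (rule region_rcos[OF w(3) powH])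
qed

lemma translate_brick: "translate (a [^] (j * p)) (brick k) = brick (k - j)"
proof -
  have "act (a [^] (j * p)) (act (a [^] (- (k * p))) w) = act (a [^] (- ((k - j) * p))) w"
    using act_mult[OF powc powc wX, of "j * p" "- (k * p)"] pow_add[of "j * p" "- (k * p)"]
    by (simp add: left_diff_distrib)
  moreover have "V #> a [^] (k * p) #> inv (a [^] (j * p)) = V #> a [^] ((k - j) * p)"
    using rcos_pow[OF Vc, of "k * p" "- (j * p)"] by (simp add: pow_inv left_diff_distrib)
  ultimately show ?thesis by (simp add: translate_def brick_def)
qed

lemma bricks_separated: "separated J (range brick)"
  unfolding separated_def
proof (intro ballI impI)
  fix b c assume "b \<in> range brick" "c \<in> range brick" "b \<noteq> c"
  then obtain k k' where "b = brick k" "c = brick k'" "k \<noteq> k'" by blast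
  then show "(J <#> snd b) \<inter> (J <#> snd c) = {}" using brick_disjoint by simp
qed

text \<open>
  The point glued from all bricks has the additional period \<open>a\<^sup>p\<close>, so finitely many slabs represent all of them.
\<close>
lemma periodic_point_dies:
  obtains q m where "q \<in> X" "shadows \<epsilon> J (range brick) q" "m \<ge> N" "(f ^^ m) q = zero"
proof -
  have sX: "s \<le> \<Delta>" using s \<epsilon> t by simp
  have pat: "patches (range brick)"
    unfolding patches_def
  proof (intro ballI conjI)
    fix b assume "b \<in> range brick"
    then obtain k where k: "b = brick k" by blast
    show "fst b \<in> X" "snd b \<subseteq> carrier G"
      using brick_props[of k] k patterns_closure_X region_carrier by blast+
    show "supp (fst b) \<subseteq> snd b"
      using patterns_closure_suppt[of "fst b" K s "snd b"] brick_props[of k] k suppt_antimono[OF sX, of "fst b"] by auto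
  qed
  obtain q where q: "q \<in> X" "shadows \<epsilon> J (range brick) q"
    using J pat bricks_separated by (auto simp: glueing_def)
  have base: "fixed_by L q" "q \<in> closure base"
    using glue_closure_base[OF J \<epsilon> s bricks_separated q] brick_props by blast+
  have per: "act (a [^] (j * p)) q = q" for j
  proof (rule shadows_fixed[OF q(2) pat bricks_separated Jf(2) powc q(1)])
    show "2 * \<epsilon> \<le> \<Delta>" using \<epsilon> by simp
    have "brick k \<in> translate (a [^] (j * p)) ` range brick" for k
    proof -
      have "brick k = translate (a [^] (j * p)) (brick (k + j))" by (simp add: translate_brick)
      then show ?thesis by blast
    qed
    then show "translate (a [^] (j * p)) ` range brick = range brick"
      by (auto simp: translate_brick)
  qed
  define W where "W = (\<Union>i\<in>{0..<p}. T #> a [^] i)"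
  have W: "finite W" "W \<subseteq> carrier G"
    using T by (auto simp: W_def r_coset_def)
  obtain N' where N': "\<And>n. n \<ge> N' \<Longrightarrow> W \<inter> supp ((f ^^ n) q) = {}"
    using eventually_off[OF q(1) W] by blast
  define m where "m = max N N'"
  have "supp ((f ^^ m) q) = {}"
  proof (rule ccontr)
    assume "supp ((f ^^ m) q) \<noteq> {}"
    then obtain g where g: "g \<in> supp ((f ^^ m) q)" by blast
    obtain i where i: "g \<in> slab i" using slabs base_closure_patterns base(2) g by blast
    have "i mod p \<in> {0..<p}" using p(1) by simp
    then have "T #> a [^] (i mod p) \<subseteq> W" unfolding W_def by blast
    then have "(T #> a [^] (i mod p)) \<inter> supp ((f ^^ m) q) = {}"
      using N'[of m] by (auto simp: m_def)
    then have "slab (i mod p) \<inter> supp ((f ^^ m) (act (a [^] (i div p * p)) q)) = {}"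
      using slab_off[OF q(1) base(1)] per by simp
    then have "slab (i mod p + i div p * p) \<inter> supp ((f ^^ m) q) = {}" by (rule slab_shift[OF q(1)])
    then show False using i g by auto
  qed
  then have "(f ^^ m) q = zero" by (rule supp_empty[OF fn_closed[OF q(1)]])
  then show ?thesis by (intro that[OF q, of m]) (simp_all add: m_def)
qed

lemma bounded_brick: "bounded_mod L (J <#> snd (brick k))"
  unfolding J_brick by (rule bounded_rcos_pow[OF JVb])

text \<open>
  The point \<open>y\<close> consists of \<open>v\<close> in the middle and of the bricks from position \<open>k0\<close> on. Away from the middle it agrees with the
  point \<open>q\<close> of all bricks, so that \<open>f\<^sup>m y\<close>, like \<open>f\<^sup>m q\<close>, vanishes there. What remains lies between two bricks at
  positions \<open>k1\<close> and \<open>-k1\<close>, which act as walls.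
\<close>
lemma interrupted_bricks:
  assumes q: "q \<in> X" "shadows \<epsilon> J (range brick) q" "m \<ge> N" "(f ^^ m) q = zero"
    and v: "v \<in> closure (patterns K t0 V')" "fixed_by L v" "region V'"
    and k0: "k0 \<ge> 0" "\<And>k. k0 \<le> \<bar>k\<bar> \<Longrightarrow> (J <#> V') \<inter> (J <#> snd (brick k)) = {}"
  obtains y where "y \<in> X"
    "\<And>g. g \<in> carrier G \<Longrightarrow> (\<And>k. k0 \<le> \<bar>k\<bar> \<Longrightarrow> g \<notin> J <#> snd (brick k)) \<Longrightarrow> dist (act g y) (act g v) < \<epsilon>"
    "supp y \<subseteq> suppt (\<Delta> / 2) v \<union> (\<Union>k\<in>{k. k0 \<le> \<bar>k\<bar>}. J <#> snd (brick k))"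
    "nilp ((f ^^ m) y)" "bounded_mod L (supp ((f ^^ m) y))"
proof -
  define P where "P = insert (v, V') (brick ` {k. k0 \<le> \<bar>k\<bar>})"
  have V'c: "V' \<subseteq> carrier G" using v(3) by (rule region_carrier)
  have V'b: "bounded_mod L V'" using v(3) by (simp add: region_def)
  have vX: "v \<in> X" using v(1) patterns_closure_X by blast
  have JV'c: "J <#> V' \<subseteq> carrier G" using Jf V'c by (simp add: set_mult_closed)
  have JV'b: "bounded_mod L (J <#> V')" by (rule bounded_mod_mult[OF Jf(1,2) V'b Lc])
  have Pcases: "b = (v, V') \<or> (\<exists>k. k0 \<le> \<bar>k\<bar> \<and> b = brick k)" if "b \<in> P" for b
    using that by (auto simp: P_def)
  have sepP: "separated J P"
    unfolding separated_def
  proof (intro ballI impI)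
    fix b c assume bc: "b \<in> P" "c \<in> P" "b \<noteq> c"
    show "(J <#> snd b) \<inter> (J <#> snd c) = {}"
    proof (cases "b = (v, V')")
      case True
      then obtain k where "k0 \<le> \<bar>k\<bar>" "c = brick k" using Pcases[OF bc(2)] bc(3) by blast
      then show ?thesis using True k0(2)[of k] by simp
    next
      case False
      then obtain k where k: "k0 \<le> \<bar>k\<bar>" "b = brick k" using Pcases[OF bc(1)] by blast
      show ?thesis
      proof (cases "c = (v, V')")
        case True
        then show ?thesis using k k0(2)[of k] by (simp add: Int_commute)
      next
        case False
        then obtain k' where k': "c = brick k'" using Pcases[OF bc(2)] by blast
        then have "k \<noteq> k'" using k bc(3) by blast
        then show ?thesis using brick_disjoint k k' by simp
      qed
    qed
  qed
  have Pprops: "fst b \<in> closure (patterns K s (snd b)) \<and> fixed_by L (fst b) \<and> region (snd b)" if b: "b \<in> P" for b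
  proof (cases "b = (v, V')")
    case True
    then show ?thesis using v patterns_closure_mono[OF s(1) order.refl[of V'], of K] by auto
  next
    case False
    then show ?thesis using Pcases[OF b] brick_props by blast
  qed
  have sX: "s \<le> \<Delta>" using s \<epsilon> t by simp
  have patP: "patches P"
    unfolding patches_def
  proof (intro ballI conjI)
    fix b assume b: "b \<in> P"
    show "fst b \<in> X" using Pprops[OF b] patterns_closure_X by blast
    show "snd b \<subseteq> carrier G" using Pprops[OF b] region_carrier by blast
    show "supp (fst b) \<subseteq> snd b"
      using patterns_closure_suppt[of "fst b" K s "snd b"] Pprops[OF b] suppt_antimono[OF sX, of "fst b"] by blast
  qed
  obtain y where y: "y \<in> X" "shadows \<epsilon> J P y" using J patP sepP by (auto simp: glueing_def)
  have ybase: "fixed_by L y" "y \<in> closure base"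
    using glue_closure_base[OF J \<epsilon> s sepP y Pprops] by blast+
  have ypat: "y \<in> closure (patterns K t1 U)" using ybase(2) base_closure_patterns by blast
  have nearv: "dist (act g y) (act g v) < \<epsilon>"
    if g: "g \<in> carrier G" and no: "\<And>k. k0 \<le> \<bar>k\<bar> \<Longrightarrow> g \<notin> J <#> snd (brick k)" for g
  proof -
    have "dist (act g y) (act g (fst (v, V'))) < \<epsilon>"
    proof (rule shadowsD1[OF y(2) _ g])
      show "(v, V') \<in> P" by (simp add: P_def)
      fix b assume "b \<in> P" "b \<noteq> (v, V')"
      then obtain k where "k0 \<le> \<bar>k\<bar>" "b = brick k" using Pcases by blast
      then show "g \<notin> J <#> snd b" using no by simp
    qed
    then show ?thesis by simp
  qed
  have suppy: "supp y \<subseteq> suppt (\<Delta> / 2) v \<union> (\<Union>k\<in>{k. k0 \<le> \<bar>k\<bar>}. J <#> snd (brick k))"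
  proof
    fix g assume g: "g \<in> supp y"
    obtain b where b: "b \<in> P" "g \<in> J <#> snd b" "g \<in> suppt (\<Delta> / 2) (fst b)"
    proof (rule shadows_supp_local[OF y(2) sepP _ g])
      show "2 * \<epsilon> \<le> \<Delta>" using \<epsilon> by simp
    qed
    show "g \<in> suppt (\<Delta> / 2) v \<union> (\<Union>k\<in>{k. k0 \<le> \<bar>k\<bar>}. J <#> snd (brick k))"
      using Pcases[OF b(1)] b by auto
  qed
  define bad where "bad = (J <#> V') \<union> (\<Union>k\<in>{-k0..k0}. J <#> snd (brick k))"
  have badb: "bounded_mod L bad"
    unfolding bad_def by (intro bounded_mod_Un JV'b bounded_mod_UN bounded_brick) simp
  have nearq: "dist (act h y) (act h q) \<le> \<Delta>" if h: "h \<in> carrier G" and nb: "h \<notin> bad" for h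
  proof -
    have small: "h \<notin> J <#> snd (brick k)" if "\<not> k0 \<le> \<bar>k\<bar>" for k
    proof -
      have "k \<in> {-k0..k0}" using that by auto
      then show ?thesis using nb unfolding bad_def by blast
    qed
    show ?thesis
    proof (rule separated_cases[OF sepP, of h])
      assume none: "\<And>b. b \<in> P \<Longrightarrow> h \<notin> J <#> snd b"
      have "h \<notin> J <#> snd (brick k)" for k
        using none[of "brick k"] small[of k] by (auto simp: P_def)
      then have "dist (act h q) zero < \<epsilon>" by (intro shadowsD2[OF q(2) h]) auto
      moreover have "dist (act h y) zero < \<epsilon>" by (rule shadowsD2[OF y(2) h none])
      ultimately show ?thesis using dist_triangle2[of "act h y" "act h q" zero] \<epsilon> by simp
    next
      fix b assume b: "b \<in> P" "h \<in> J <#> snd b" and only: "\<And>c. c \<in> P \<Longrightarrow> c \<noteq> b \<Longrightarrow> h \<notin> J <#> snd c"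
      obtain k where k: "b = brick k" using Pcases[OF b(1)] b(2) nb by (auto simp: bad_def)
      have "dist (act h y) (act h (fst b)) < \<epsilon>" by (rule shadowsD1[OF y(2) b(1) h only])
      moreover have "dist (act h q) (act h (fst b)) < \<epsilon>"
      proof (rule shadowsD1[OF q(2) _ h])
        show "b \<in> range brick" using k by blast
        fix c assume "c \<in> range brick" "c \<noteq> b"
        then show "h \<notin> J <#> snd c" using separated_unique[OF bricks_separated, of b c h] b(2) k by blast
      qed
      ultimately show ?thesis using dist_triangle2[of "act h y" "act h q" "act h (fst b)"] \<epsilon> by simp
    qed
  qed
  obtain Em where Em: "finite Em" "Em \<subseteq> carrier G"
    "\<And>x y g. x \<in> X \<Longrightarrow> y \<in> X \<Longrightarrow> g \<in> carrier G \<Longrightarrow>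
       (\<And>h. h \<in> Em \<Longrightarrow> dist (act (h \<otimes> g) x) (act (h \<otimes> g) y) \<le> \<Delta>) \<Longrightarrow>
       dist (act g ((f ^^ m) x)) (act g ((f ^^ m) y)) < \<Delta>"
    using locality[OF \<Delta>_pos, of m] by blast
  define C where "C = invs Em <#> bad"
  have Cb: "bounded_mod L C" unfolding C_def using Em by (intro bounded_mod_mult badb Lc) auto
  have fmC: "supp ((f ^^ m) y) \<subseteq> C"
  proof
    fix g assume g: "g \<in> supp ((f ^^ m) y)"
    then have gc: "g \<in> carrier G" by (rule suppt_closedD)
    have "\<exists>h\<in>Em. h \<otimes> g \<in> bad"
    proof (rule ccontr)
      assume no: "\<not> ?thesis"
      have "dist (act g ((f ^^ m) y)) (act g ((f ^^ m) q)) < \<Delta>"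
      proof (rule Em(3)[OF y(1) q(1) gc])
        fix h assume "h \<in> Em"
        then show "dist (act (h \<otimes> g) y) (act (h \<otimes> g) q) \<le> \<Delta>" using no gc Em(2) by (intro nearq) auto
      qed
      then show False using g gc q(4) by (simp add: suppt_def)
    qed
    then obtain h where h: "h \<in> Em" "h \<otimes> g \<in> bad" by blast
    have "g = inv h \<otimes> (h \<otimes> g)" using inv_mult_cancel_left[OF subsetD[OF Em(2) h(1)] gc] by simp
    then show "g \<in> C" unfolding C_def using set_multI[OF invsI[OF h(1)] h(2)] by simp
  qed
  obtain r1 :: int where r1: "r1 \<ge> 0" "\<And>i. slab i \<inter> C \<noteq> {} \<Longrightarrow> \<bar>i\<bar> \<le> r1"
    using separation[OF TLb Cb] by blast
  obtain r2 :: int where r2: "r2 \<ge> 0" "\<And>i. ((J <#> V') #> a [^] i) \<inter> D \<noteq> {} \<Longrightarrow> \<bar>i\<bar> \<le> r2"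
    using separation[OF JV'b bounded_mod_finite[OF D(1,2) L]] by blast
  define k1 where "k1 = k0 + r1 + r2 + 1"
  have k1: "k1 > 0" "k0 \<le> k1" "r1 \<le> k1" "r2 < k1" using k0(1) r1(1) r2(1) by (auto simp: k1_def)
  define c where "c = k1 * p"
  have c: "k1 \<le> c" using k1(1) p(1) by (simp add: c_def)
  \<comment> \<open>the walls at the two positions \<open>\<plusminus> k1\<close>\<close>
  have near_wall: "dist (act (a [^] (k * p)) y) w < \<eta>" if k: "\<bar>k\<bar> = k1" for k
  proof (rule D(3))
    show "act (a [^] (k * p)) y \<in> X" "w \<in> X" using y(1) wX by simp_all
    fix h assume h: "h \<in> D"
    then have hc: "h \<in> carrier G" using D by blast
    define g where "g = h \<otimes> a [^] (k * p)"
    have gc: "g \<in> carrier G" using hc by (simp add: g_def)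
    have "g \<otimes> a [^] (- (k * p)) = h \<otimes> (a [^] (k * p) \<otimes> a [^] (- (k * p)))" using hc by (simp add: g_def m_assoc)
    then have gh: "g \<otimes> a [^] (- (k * p)) = h" using hc pow_add[of "k * p" "- (k * p)"] by simp
    have mem: "h \<in> A #> a [^] (i - k * p)" if "g \<in> A #> a [^] i" "A \<subseteq> carrier G" for A i
      using mem_rcos_pow[OF that(2) gc, of "i - k * p" "k * p"] that(1) gh by simp
    have bP: "brick k \<in> P" using k k1(2) by (simp add: P_def)
    have "dist (act g y) (act g (fst (brick k))) < \<epsilon>"
    proof (rule shadowsD1[OF y(2) bP gc])
      fix b assume b: "b \<in> P" "b \<noteq> brick k"
      show "g \<notin> J <#> snd b"
      proof
        assume gb: "g \<in> J <#> snd b"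
        consider "b = (v, V')" | k' where "b = brick k'" using Pcases[OF b(1)] by blast
        then show False
        proof cases
          case 1
          then have "g \<in> (J <#> V') #> a [^] (0::int)" using gb JV'c by (simp add: coset_mult_one)
          then have "h \<in> (J <#> V') #> a [^] (- (k * p))" using mem[OF _ JV'c] by fastforce
          then have "\<bar>- (k * p)\<bar> \<le> r2" using r2(2) h by blast
          then have "c \<le> r2" using k p(1) by (simp add: abs_mult c_def)
          then show False using c k1 by simp
        next
          case 2
          then have "g \<in> (J <#> V) #> a [^] (k' * p)" using gb J_brick by simp
          then have "h \<in> (J <#> V) #> a [^] (k' * p - k * p)" by (rule mem[OF _ JVc])
          then have "\<bar>k' * p - k * p\<bar> < p" using p(2) h by blast
          then have "\<bar>k' - k\<bar> * p < 1 * p" using p(1) by (simp add: abs_mult left_diff_distrib[symmetric])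
          then have "k' = k" using p(1) by simp
          then show False using b(2) 2 by simp
        qed
      qed
    qed
    moreover have "act g (fst (brick k)) = act h w"
    proof -
      have "act g (fst (brick k)) = act (g \<otimes> a [^] (- (k * p))) w"
        unfolding fst_brick using act_mult[OF gc powc wX] by simp
      then show ?thesis using gh by simp
    qed
    moreover have "act g y = act h (act (a [^] (k * p)) y)"
      unfolding g_def using hc y(1) by (intro act_mult) auto
    ultimately show "dist (act h (act (a [^] (k * p)) y)) (act h w) \<le> \<Delta>" using \<epsilon> by simp
  qed
  have wall_at: "slab i \<inter> supp ((f ^^ n) y) = {}" if n: "n \<ge> m" and k: "\<bar>k\<bar> = k1" and i: "\<bar>i - k * p\<bar> \<le> r" for n i k
  proof -
    have "slab (i - k * p) \<inter> supp ((f ^^ n) (act (a [^] (k * p)) y)) = {}"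
      using near_wall[OF k] base_closure_act[OF ybase(2) powH] fixed_by_act[OF y(1) ybase(1) powH] n q(3) i
      by (intro silent) auto
    from slab_shift[OF y(1) this] show ?thesis by simp
  qed
  have conf: "supp ((f ^^ n) y) \<subseteq> (\<Union>i\<in>{-c..c}. slab i)" if "n \<ge> m" for n
  proof (rule walls_confine[OF y(1) ypat E r _ _ that])
    show "supp ((f ^^ m) y) \<subseteq> (\<Union>i\<in>{-c..c}. slab i)"
    proof
      fix g assume g: "g \<in> supp ((f ^^ m) y)"
      then obtain i where i: "g \<in> slab i" using slabs[OF ypat] by blast
      then have "\<bar>i\<bar> \<le> r1" using r1(2) fmC g by blast
      then have "i \<in> {-c..c}" using c k1 by (auto simp: abs_le_iff)
      then show "g \<in> (\<Union>i\<in>{-c..c}. slab i)" using i by blast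
    qed
    show "slab i \<inter> supp ((f ^^ n') y) = {}" if "n' \<ge> m" "\<bar>i - c\<bar> \<le> r \<or> \<bar>i + c\<bar> \<le> r" for n' i
      using wall_at[OF that(1), of k1 i] wall_at[OF that(1), of "- k1" i] that(2) k1(1) by (auto simp: c_def)
  qed
  have slabsb: "bounded_mod L (\<Union>i\<in>{-c..c}. slab i)"
    by (intro bounded_mod_UN bounded_rcos_pow TLb) simp
  have "nilp ((f ^^ m) y)"
  proof (rule confined_imp_nilp[OF fn_closed[OF y(1)] Lc fixed_by_fn[OF y(1) Lc ybase(1)] slabsb])
    show "supp ((f ^^ n) ((f ^^ m) y)) \<subseteq> (\<Union>i\<in>{-c..c}. slab i)" for n
      using conf[of "n + m"] by (simp add: fn_add)
  qed
  moreover have "bounded_mod L (supp ((f ^^ m) y))" by (rule bounded_mod_subset[OF Cb fmC])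
  ultimately show ?thesis using that[OF y(1) nearv suppy] by blast
qed

text \<open>
  For given \<open>v\<close>, bricks that start far enough out influence neither the event at \<open>T\<close> that \<open>v\<close> causes at time \<open>n\<close> nor the
  vanishing of \<open>f\<^sup>m y\<close> on the set provided by \<open>stability_of_nilpotent_points\<close>. It is essential that \<open>m\<close> does not
  depend on \<open>v\<close>.
\<close>
lemma stable_between_walls:
  obtains Z where "bounded_mod L Z"
    "\<And>v n. v \<in> finite_patterns t0 \<Longrightarrow> supp v \<inter> Z = {} \<Longrightarrow> T \<inter> supp ((f ^^ n) v) = {}"
proof -
  obtain q m where q: "q \<in> X" "shadows \<epsilon> J (range brick) q" "m \<ge> N" "(f ^^ m) q = zero"
    using periodic_point_dies by blast
  obtain Z0 where Z0: "bounded_mod L Z0"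
    "\<And>x n. x \<in> X \<Longrightarrow> bounded_mod L (supp x) \<Longrightarrow> nilp x \<Longrightarrow> supp x \<inter> Z0 = {} \<Longrightarrow> T \<inter> supp ((f ^^ n) x) = {}"
    using stability_of_nilpotent_points[OF L T] by blast
  obtain Eu where Eu: "finite Eu" "Eu \<subseteq> carrier G" "\<And>x n. x \<in> X \<Longrightarrow> n \<le> m \<Longrightarrow> supp ((f ^^ n) x) \<subseteq> Eu <#> supp x"
    using supp_fn_upto by blast
  obtain Eh where Eh: "finite Eh" "Eh \<subseteq> carrier G" "\<And>x. x \<in> X \<Longrightarrow> suppt (\<Delta> / 2) x \<subseteq> Eh <#> supp x"
    using suppt_supp[of "\<Delta> / 2"] \<Delta>_pos by (metis half_gt_zero)
  define C where "C = Eu \<union> (Eu <#> Eh)"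
  have C: "finite C" "C \<subseteq> carrier G" using Eu Eh by (auto simp: C_def set_mult_closed)
  have "bounded_mod L (T \<union> Z0)" by (intro bounded_mod_Un Z0(1) bounded_mod_finite T L)
  then obtain Z where Z: "bounded_mod L Z"
    "\<And>A. A \<subseteq> carrier G \<Longrightarrow> A \<inter> Z = {} \<Longrightarrow> (C <#> A) \<inter> (T \<union> Z0) = {}"
    using bounded_mod_avoid[OF C _ L] by blast
  show ?thesis
  proof (rule that[OF Z(1)], rule ccontr)
    fix v n assume v: "v \<in> finite_patterns t0" "supp v \<inter> Z = {}" and "T \<inter> supp ((f ^^ n) v) \<noteq> {}"
    then obtain g where g: "g \<in> T" "g \<in> supp ((f ^^ n) v)" by blast
    obtain V' where V': "region V'" "v \<in> closure (patterns K t0 V')" and vf: "v \<in> X" "fixed_by L v"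
      using v(1) by (auto simp: finite_patterns_def)
    have V'c: "V' \<subseteq> carrier G" using V'(1) by (rule region_carrier)
    have V'b: "bounded_mod L V'" using V'(1) by (simp add: region_def)
    have JV'b: "bounded_mod L (J <#> V')" by (rule bounded_mod_mult[OF Jf(1,2) V'b Lc])
    have far: "(C <#> supp v) \<inter> (T \<union> Z0) = {}" using Z(2)[OF suppt_closed v(2)] .
    have EuC: "Eu <#> supp v \<subseteq> C <#> supp v" by (rule mono_set_mult) (auto simp: C_def)
    have EhC: "Eu <#> (Eh <#> supp v) \<subseteq> C <#> supp v"
    proof -
      have "Eu <#> (Eh <#> supp v) = (Eu <#> Eh) <#> supp v" using Eu Eh by (simp add: set_mult_assoc)
      also have "\<dots> \<subseteq> C <#> supp v" by (rule mono_set_mult) (auto simp: C_def)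
      finally show ?thesis .
    qed
    have nm: "n \<ge> m"
    proof (rule ccontr)
      assume "\<not> n \<ge> m"
      then have "g \<in> C <#> supp v" using Eu(3)[OF vf(1), of n] g(2) EuC by auto
      then show False using far g(1) by blast
    qed
    obtain E3 where E3: "finite E3" "E3 \<subseteq> carrier G"
      "\<And>y. y \<in> X \<Longrightarrow> (\<And>h. h \<in> E3 \<Longrightarrow> dist (act h y) (act h v) \<le> \<Delta>) \<Longrightarrow> g \<in> supp ((f ^^ n) y)"
      using supp_fn_open[OF vf(1) g(2)] by blast
    define A where "A = (J <#> V) \<union> (Eu <#> (J <#> V))"
    have Ab: "bounded_mod L A"
      unfolding A_def using bounded_mod_mult[OF Eu(1,2) JVb Lc] JVb by (intro bounded_mod_Un)
    have "bounded_mod L (Z0 \<union> E3 \<union> (J <#> V'))"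
      by (intro bounded_mod_Un Z0(1) JV'b bounded_mod_finite E3 L)
    then obtain r3 :: int where r3: "r3 \<ge> 0" "\<And>i. (A #> a [^] i) \<inter> (Z0 \<union> E3 \<union> (J <#> V')) \<noteq> {} \<Longrightarrow> \<bar>i\<bar> \<le> r3"
      using separation[OF Ab] by blast
    define k0 where "k0 = r3 + 1"
    have away: "(A #> a [^] (k * p)) \<inter> (Z0 \<union> E3 \<union> (J <#> V')) = {}" if k: "k0 \<le> \<bar>k\<bar>" for k
    proof (rule ccontr)
      assume "(A #> a [^] (k * p)) \<inter> (Z0 \<union> E3 \<union> (J <#> V')) \<noteq> {}"
      then have "\<bar>k * p\<bar> \<le> r3" by (rule r3(2))
      moreover have "\<bar>k\<bar> * 1 \<le> \<bar>k\<bar> * p" using p(1) by (intro mult_left_mono) auto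
      ultimately show False using k p(1) by (simp add: abs_mult k0_def)
    qed
    have brickA: "J <#> snd (brick k) \<subseteq> A #> a [^] (k * p)" for k
      unfolding J_brick by (auto simp: A_def r_coset_def)
    have EbrickA: "Eu <#> (J <#> snd (brick k)) \<subseteq> A #> a [^] (k * p)" for k
    proof -
      have "Eu <#> (J <#> snd (brick k)) = (Eu <#> (J <#> V)) #> a [^] (k * p)"
        unfolding J_brick using Eu(2) JVc by (simp add: setmult_rcos_assoc)
      then show ?thesis by (auto simp: A_def r_coset_def)
    qed
    have k0: "k0 \<ge> 0" using r3(1) by (simp add: k0_def)
    have disj: "(J <#> V') \<inter> (J <#> snd (brick k)) = {}" if "k0 \<le> \<bar>k\<bar>" for k
      using away[OF that] brickA[of k] by blast
    obtain y where y: "y \<in> X"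
      "\<And>g. g \<in> carrier G \<Longrightarrow> (\<And>k. k0 \<le> \<bar>k\<bar> \<Longrightarrow> g \<notin> J <#> snd (brick k)) \<Longrightarrow> dist (act g y) (act g v) < \<epsilon>"
      "supp y \<subseteq> suppt (\<Delta> / 2) v \<union> (\<Union>k\<in>{k. k0 \<le> \<bar>k\<bar>}. J <#> snd (brick k))"
      "nilp ((f ^^ m) y)" "bounded_mod L (supp ((f ^^ m) y))"
      using interrupted_bricks[OF q V'(2) vf(2) V'(1) k0 disj] by blast
    have "supp ((f ^^ m) y) \<inter> Z0 = {}"
    proof (rule ccontr)
      assume "supp ((f ^^ m) y) \<inter> Z0 \<noteq> {}"
      then obtain x where x: "x \<in> supp ((f ^^ m) y)" "x \<in> Z0" by blast
      then have "x \<in> Eu <#> supp y" using Eu(3)[OF y(1), of m] by blast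
      then obtain e h where eh: "e \<in> Eu" "h \<in> supp y" "x = e \<otimes> h" unfolding mem_set_mult by (elim bexE)
      consider "h \<in> suppt (\<Delta> / 2) v" | k where "k0 \<le> \<bar>k\<bar>" "h \<in> J <#> snd (brick k)" using subsetD[OF y(3) eh(2)] by auto
      then show False
      proof cases
        case 1
        then have "x \<in> C <#> supp v"
          using set_multI[OF eh(1) subsetD[OF Eh(3)[OF vf(1)]]] eh(3) EhC by blast
        then show False using far x(2) by blast
      next
        case 2
        then have "x \<in> A #> a [^] (k * p)" using set_multI[OF eh(1) 2(2)] eh(3) EbrickA by blast
        then show False using away[OF 2(1)] x(2) by blast
      qed
    qed
    then have "T \<inter> supp ((f ^^ (n - m)) ((f ^^ m) y)) = {}" by (rule Z0(2)[OF fn_closed[OF y(1)] y(5,4)])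
    then have off: "T \<inter> supp ((f ^^ n) y) = {}" using fn_add[of "n - m" m y] nm by simp
    have "g \<in> supp ((f ^^ n) y)"
    proof (rule E3(3)[OF y(1)])
      fix h assume h: "h \<in> E3"
      have "dist (act h y) (act h v) < \<epsilon>"
        using h E3(2) away brickA by (intro y(2)) blast+
      then show "dist (act h y) (act h v) \<le> \<Delta>" using \<epsilon> by simp
    qed
    then show False using off g(1) by blast
  qed
qed

end

context cyclic_confinement begin

lemma finite_patterns_stable:
  obtains Z where "bounded_mod L Z"
    "\<And>v n. v \<in> finite_patterns t0 \<Longrightarrow> supp v \<inter> Z = {} \<Longrightarrow> T \<inter> supp ((f ^^ n) v) = {}"
proof -
  obtain E where E: "finite E" "E \<subseteq> carrier G" "\<And>x. x \<in> X \<Longrightarrow> supp (f x) \<subseteq> E <#> supp x"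
    using suppt_fn[OF \<Delta>_pos, of 1] by auto
  obtain r :: int where r: "\<And>i j g e. e \<in> E \<Longrightarrow> g \<in> slab i \<Longrightarrow> e \<otimes> g \<in> slab j \<Longrightarrow> \<bar>i - j\<bar> \<le> r"
  proof (rule slab_step_bound[OF E(1,2)])
    fix r :: int
    assume *: "\<And>i j g e. e \<in> E \<Longrightarrow> g \<in> slab i \<Longrightarrow> e \<otimes> g \<in> slab j \<Longrightarrow> \<bar>i - j\<bar> \<le> r"
    show thesis by (rule that) (rule *)
  qed
  define W where "W = (\<Union>i\<in>{-r..r}. T #> a [^] i)"
  have W: "finite W" "W \<subseteq> carrier G" using T by (auto simp: W_def r_coset_def)
  have "zero \<in> finite_patterns t0"
  proof -
    have "zero \<in> patterns K t0 {}"
      using t Kc \<Delta>_pos by (auto simp: patterns_def fixed_by_def)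
    then have "zero \<in> closure (patterns K t0 {})" using closure_subset by blast
    moreover have "region {}" by (simp add: region_def r_coset_def)
    moreover have "fixed_by L zero" using Lc by (auto simp: fixed_by_def)
    ultimately show ?thesis by (auto simp: finite_patterns_def)
  qed
  then have "zero \<in> base" using t by (auto simp: base_def)
  then obtain w \<eta> N where w: "w \<in> base" "\<eta> > 0"
    and silent: "\<And>y n. y \<in> closure base \<Longrightarrow> dist y w < \<eta> \<Longrightarrow> n \<ge> N \<Longrightarrow> W \<inter> supp ((f ^^ n) y) = {}"
    using baire_off[OF base_X _ W] by blast
  obtain s where s: "t0 \<le> s" "s < t1" "w \<in> finite_patterns s" using w(1) by (auto simp: base_def)
  obtain V where V: "region V" "w \<in> closure (patterns K s V)" "fixed_by L w"
    using s(3) by (auto simp: finite_patterns_def)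
  define \<epsilon> where "\<epsilon> = min ((t1 - s) / 2) (\<Delta> / 4)"
  have \<epsilon>: "0 < \<epsilon>" "4 * \<epsilon> \<le> \<Delta>" "s + \<epsilon> < t1" using s \<Delta>_pos by (auto simp: \<epsilon>_def min_def field_simps)
  obtain J where J: "glueing \<epsilon> J" using glueing_exists[OF \<epsilon>(1)] by blast
  have Jf: "finite J" "J \<subseteq> carrier G" using J by (auto simp: glueing_def)
  obtain D where D: "finite D" "D \<subseteq> carrier G"
    "\<And>x y. x \<in> X \<Longrightarrow> y \<in> X \<Longrightarrow> (\<And>h. h \<in> D \<Longrightarrow> dist (act h x) (act h y) \<le> \<Delta>) \<Longrightarrow> dist x y < \<eta>"
    using uniform_expansivity[OF w(2)] by blast
  have JVb: "bounded_mod L (J <#> V)"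
    using V(1) by (intro bounded_mod_mult Jf Lc) (simp add: region_def)
  then obtain p :: int where p: "p \<ge> 0" "\<And>i. ((J <#> V) #> a [^] i) \<inter> ((J <#> V) \<union> D) \<noteq> {} \<Longrightarrow> \<bar>i\<bar> \<le> p"
    using separation[OF JVb bounded_mod_Un[OF JVb bounded_mod_finite[OF D(1,2) L]]] by blast
  interpret walls G X act zero S f \<Delta> K L H a t0 t1 U T E r w V s \<eta> \<epsilon> N J D "p + 1"
  proof unfold_locales
    fix y n i
    assume y: "y \<in> closure base" "fixed_by L y" "dist y w < \<eta>" "n \<ge> N" "\<bar>i\<bar> \<le> r"
    have "T #> a [^] i \<subseteq> W" using y(5) unfolding W_def by (intro UN_upper) auto
    then have "(T #> a [^] i) \<inter> supp ((f ^^ n) y) = {}" using silent[OF y(1,3,4)] by blast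
    moreover have "y \<in> X" using y(1) closure_in_X[OF base_X] by blast
    ultimately show "slab i \<inter> supp ((f ^^ n) y) = {}" using slab_off y(2) by blast
  next
    show "0 < p + 1" using p(1) by simp
    show "\<bar>i\<bar> < p + 1" if "((J <#> V) #> a [^] i) \<inter> ((J <#> V) \<union> D) \<noteq> {}" for i
      using p(2)[OF that] by simp
  qed (use E r V s \<epsilon> J D in \<open>(assumption | blast)+\<close>)
  show ?thesis using stable_between_walls that by blast
qed

text \<open>
  Stability, applied to all translates by \<open>H\<close>, confines the support to finitely many cosets of the periods \<open>L\<close>.
\<close>
lemma finite_patterns_nilp:
  assumes y: "y \<in> finite_patterns t0" shows "nilp y"
proof -
  obtain V where V: "region V" "y \<in> closure (patterns K t0 V)" and yX: "y \<in> X" "fixed_by L y"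
    using y by (auto simp: finite_patterns_def)
  obtain Z where Z: "bounded_mod L Z"
    "\<And>v n. v \<in> finite_patterns t0 \<Longrightarrow> supp v \<inter> Z = {} \<Longrightarrow> T \<inter> supp ((f ^^ n) v) = {}"
    using finite_patterns_stable by blast
  have Vb: "bounded_mod L V" using V(1) by (simp add: region_def)
  obtain B where B: "bounded_mod L B"
    "\<And>x n. x \<in> X \<Longrightarrow> supp x \<subseteq> V \<Longrightarrow>
       (\<And>m. m \<in> H \<Longrightarrow> supp (act m x) \<inter> Z = {} \<Longrightarrow> T \<inter> supp ((f ^^ n) (act m x)) = {}) \<Longrightarrow>
       supp ((f ^^ n) x) \<inter> (T <#> H) \<subseteq> B"
    using confinement[OF L H LH normL T Z(1) Vb] by blast
  have sV: "supp y \<subseteq> V"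
    using patterns_closure_suppt[OF V(2)] suppt_antimono[of t0 \<Delta> y] t by auto
  have yU: "y \<in> closure (patterns K t1 U)"
    using V patterns_closure_mono[of t0 t1 V U] t by (auto simp: region_def)
  have "supp ((f ^^ n) y) \<subseteq> B" for n
  proof -
    have "supp ((f ^^ n) y) \<subseteq> T <#> H"
    proof
      fix g assume "g \<in> supp ((f ^^ n) y)"
      then obtain i where "g \<in> slab i" using slabs[OF yU] by blast
      then obtain u l where ul: "u \<in> T" "l \<in> L" "g = u \<otimes> a [^] i \<otimes> l" by (rule mem_slab)
      then have "u \<in> carrier G" "l \<in> carrier G" using T(2) Lc by auto
      then have "g = u \<otimes> (a [^] i \<otimes> l)" using ul(3) by (simp add: m_assoc)
      moreover have "a [^] i \<otimes> l \<in> H" using powH ul(2) LH H by (auto intro: subgroup.m_closed)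
      ultimately show "g \<in> T <#> H" using ul(1) by (simp add: set_multI)
    qed
    moreover have "supp ((f ^^ n) y) \<inter> (T <#> H) \<subseteq> B"
      using Z(2) finite_patterns_act[OF y] by (intro B(2)[OF yX(1) sV]) blast
    ultimately show ?thesis by blast
  qed
  then show ?thesis by (rule confined_imp_nilp[OF yX(1) Lc yX(2) B(1)])
qed

end

section \<open>Removing a finitely generated abelian quotient\<close>

text \<open>
  The group \<open>M\<close> is abelian modulo the group of periods \<open>K\<close>, and supports of patterns stay close to \<open>M\<close>.
\<close>
locale abelian_confinement = shadowing_system G X act zero S f \<Delta>
  for G :: "('g, 'm) monoid_scheme" (structure)
    and X :: "'x::metric_space set"
    and act :: "'g \<Rightarrow> 'x \<Rightarrow> 'x"
    and zero :: 'x and S :: "'g set" and f :: "'x \<Rightarrow> 'x" and \<Delta> :: real +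
  fixes K M U T :: "'g set"
  assumes K: "K \<lhd> G" and M: "M \<lhd> G" and KM: "K \<subseteq> M"
    and comm: "\<And>x y. x \<in> M \<Longrightarrow> y \<in> M \<Longrightarrow> x \<otimes> y \<otimes> inv x \<otimes> inv y \<in> K"
    and closed: "profinitely_closed K"
    and U: "U \<subseteq> carrier G" "\<And>m. m \<in> M \<Longrightarrow> U #> m \<subseteq> U"
    and T: "finite T" "T \<subseteq> carrier G"
    and conf: "\<And>x n. x \<in> patterns K \<Delta> U \<Longrightarrow> supp ((f ^^ n) x) \<subseteq> T <#> M"
begin

lemma Ks: "subgroup K G" and Ms: "subgroup M G" and Kc: "K \<subseteq> carrier G" and Mc: "M \<subseteq> carrier G"
  using K M by (simp_all add: subgroup.subset normal_imp_subgroup)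

lemma normal_between:
  assumes H: "subgroup H G" "K \<subseteq> H" "H \<subseteq> M" and m: "m \<in> M" and h: "h \<in> H"
  shows "inv m \<otimes> h \<otimes> m \<in> H"
proof -
  have c: "m \<in> carrier G" "h \<in> carrier G" using m h H Mc by auto
  have "inv m \<otimes> h \<otimes> inv (inv m) \<otimes> inv h \<in> K"
    using H(3) h by (intro comm subgroup.m_inv_closed[OF Ms m]) auto
  then have "(inv m \<otimes> h \<otimes> m \<otimes> inv h) \<otimes> h \<in> H" using H h c by (auto intro: subgroup.m_closed)
  then show ?thesis using c by (simp add: m_assoc)
qed

lemma patterns_act_U:
  assumes "x \<in> patterns K s U" "m \<in> M" shows "act m x \<in> patterns K s U"
proof -
  have "act m x \<in> patterns K s (U #> inv m)" using assms Mc by (intro patterns_act[OF K]) auto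
  moreover have "U #> inv m \<subseteq> U" by (rule U(2)[OF subgroup.m_inv_closed[OF Ms assms(2)]])
  ultimately show ?thesis using patterns_mono[of s s "U #> inv m" U K] by blast
qed

text \<open>
  All thresholds below \<open>\<Delta>\<close> are included, since each use of stability for a larger subgroup loses a part of the threshold.
\<close>
definition stable_along :: "'g set \<Rightarrow> bool" where
  "stable_along H \<longleftrightarrow> (\<forall>s. 0 < s \<longrightarrow> s < \<Delta> \<longrightarrow>
     (\<exists>Z. bounded_mod H Z \<and> (\<forall>x n. x \<in> patterns K s U \<longrightarrow> supp x \<inter> Z = {} \<longrightarrow> T \<inter> supp ((f ^^ n) x) = {})))"

lemma stable_along_confines:
  assumes H: "subgroup H G" "K \<subseteq> H" "H \<subseteq> M" and st: "stable_along H" and s: "0 < s" "s < \<Delta>"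
    and A: "bounded_mod H A"
  obtains B where "bounded_mod H B"
    "\<And>x n. x \<in> patterns K s U \<Longrightarrow> supp x \<subseteq> A \<Longrightarrow> supp ((f ^^ n) x) \<subseteq> B"
proof -
  obtain Z where Z: "bounded_mod H Z"
    "\<And>x n. x \<in> patterns K s U \<Longrightarrow> supp x \<inter> Z = {} \<Longrightarrow> T \<inter> supp ((f ^^ n) x) = {}"
    using st s unfolding stable_along_def by blast
  obtain B where B: "bounded_mod H B"
    "\<And>x n. x \<in> X \<Longrightarrow> supp x \<subseteq> A \<Longrightarrow>
       (\<And>m. m \<in> M \<Longrightarrow> supp (act m x) \<inter> Z = {} \<Longrightarrow> T \<inter> supp ((f ^^ n) (act m x)) = {}) \<Longrightarrow>
       supp ((f ^^ n) x) \<inter> (T <#> M) \<subseteq> B"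
    using confinement[OF H(1) Ms H(3) normal_between[OF H] T Z(1) A] by blast
  show ?thesis
  proof (rule that[OF B(1)])
    fix x n assume x: "x \<in> patterns K s U" "supp x \<subseteq> A"
    have "supp ((f ^^ n) x) \<inter> (T <#> M) \<subseteq> B"
      using Z(2) patterns_act_U[OF x(1)] x(2) subsetD[OF patterns_X x(1)] by (intro B(2)) blast+
    moreover have "x \<in> patterns K \<Delta> U" using x(1) patterns_mono[of s \<Delta> U U K] s by auto
    ultimately show "supp ((f ^^ n) x) \<subseteq> B" using conf[of x n] by blast
  qed
qed

text \<open>
  The group \<open>H'\<close> is generated by \<open>H\<close> and \<open>a\<close>. By \<open>periodic_stability\<close> it suffices that a point \<open>y\<close> with a group of periods \<open>L\<close> of finite
  index in \<open>H\<close> is nilpotent. Stability along \<open>H'\<close> confines \<open>y\<close> to finitely many cosets of \<open>H'\<close>. If some power of \<open>a\<close> lies in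
  \<open>L\<close>, these are finitely many cosets of \<open>L\<close>; otherwise they form slabs indexed by the powers of \<open>a\<close>.
\<close>
lemma cyclic_step:
  assumes H: "subgroup H G" "K \<subseteq> H" "H \<subseteq> M" and H': "subgroup H' G" "H \<subseteq> H'" "H' \<subseteq> M" "a \<in> H'"
    and gen: "\<And>x. x \<in> H' \<Longrightarrow> \<exists>h\<in>H. \<exists>i::int. x = h \<otimes> a [^] i" and st: "stable_along H'"
  shows "stable_along H"
  unfolding stable_along_def
proof (intro allI impI)
  fix s :: real assume s: "0 < s" "s < \<Delta>"
  define t0 where "t0 = (s + \<Delta>) / 2"
  define t1 where "t1 = (t0 + \<Delta>) / 2"
  define \<epsilon> where "\<epsilon> = (\<Delta> - s) / 4"
  have t: "0 < t0" "t0 < t1" "t1 < \<Delta>" "s < t0" "0 < t1" using s by (auto simp: t0_def t1_def field_simps)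
  have \<epsilon>: "0 < \<epsilon>" "4 * \<epsilon> \<le> \<Delta>" "2 * \<epsilon> \<le> \<Delta>" "s + \<epsilon> \<le> t0" "s + \<epsilon> \<le> \<Delta>" using s by (auto simp: \<epsilon>_def t0_def field_simps)
  obtain J where J: "glueing \<epsilon> J" using glueing_exists[OF \<epsilon>(1)] by blast
  have Hc: "H \<subseteq> carrier G" and H'c: "H' \<subseteq> carrier G" using H(1) H'(1) by (simp_all add: subgroup.subset)
  have ac: "a \<in> carrier G" using H'(4) H'c by blast
  have KH': "K \<subseteq> H'" using H H' by blast
  have nil: "nilp y"
    if x: "x \<in> X" "fixed_by K x" "bounded_mod K (supp x)" "suppt s x \<subseteq> U"
      and N: "finite_index_normal N" and y: "y \<in> X" "fixed_by (H \<inter> (K <#> N)) y"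
      and P: "patches (orbit_patches s (H \<inter> (K <#> N)) x)" "separated J (orbit_patches s (H \<inter> (K <#> N)) x)"
        "shadows \<epsilon> J (orbit_patches s (H \<inter> (K <#> N)) x) y"
    for x N y
  proof -
    define L where "L = H \<inter> (K <#> N)"
    have Nn: "N \<lhd> G" "bounded_mod N (carrier G)" using N by (simp_all add: finite_index_normal_def)
    have Ns: "subgroup N G" using Nn(1) by (rule normal_imp_subgroup)
    have KN: "subgroup (K <#> N) G" by (rule normal_imp_subgroup[OF normal_subgroup_set_mult_closed[OF K Nn(1)]])
    have KKN: "K \<subseteq> K <#> N" using subgroup.one_closed[OF Ns] Kc by (force simp: mem_set_mult)
    have NKN: "N \<subseteq> K <#> N"
      using subgroup.one_closed[OF Ks] subgroup.subset[OF Ns] by (force simp: mem_set_mult)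
    have L: "subgroup L G" unfolding L_def by (rule subgroups_Inter_pair[OF H(1) KN])
    have Lc: "L \<subseteq> carrier G" using L by (rule subgroup.subset)
    have KL: "K \<subseteq> L" and LH: "L \<subseteq> H" using H(2) KKN by (auto simp: L_def)
    have LH': "L \<subseteq> H'" and LM: "L \<subseteq> M" using LH H' by blast+
    have "bounded_mod (K <#> N) H"
      by (rule bounded_mod_subset[OF bounded_mod_mono[OF Nn(2) NKN] Hc])
    then have LbH: "bounded_mod L H" unfolding L_def by (rule bounded_mod_Int[OF H(1) KN])
    obtain R where R: "finite R" "R \<subseteq> carrier G" "H \<subseteq> R <#> L" using LbH unfolding bounded_mod_def by blast
    define A where "A = suppt s x"
    have Ac: "A \<subseteq> carrier G" by (simp add: A_def)
    have AU: "A \<subseteq> U" using x(4) by (simp add: A_def)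
    have Ab: "bounded_mod K A"
    proof -
      obtain D where D: "finite D" "D \<subseteq> carrier G" "\<And>x. x \<in> X \<Longrightarrow> suppt s x \<subseteq> D <#> supp x"
        using suppt_supp[OF s(1)] by blast
      show ?thesis unfolding A_def
        by (rule bounded_mod_subset[OF bounded_mod_mult[OF D(1,2) x(3) Kc] D(3)[OF x(1)]])
    qed
    have sat: "A <#> Q \<subseteq> U" if "Q \<subseteq> M" for Q
    proof
      fix g assume "g \<in> A <#> Q"
      then obtain b q where "b \<in> A" "q \<in> Q" "g = b \<otimes> q" unfolding mem_set_mult by blast
      then have "g \<in> U #> q" "q \<in> M" using AU that by (auto simp: r_coset_def)
      then show "g \<in> U" using U(2) by blast
    qed
    have inv_prod: "(A <#> Q) #> q = A <#> Q" if "subgroup Q G" "q \<in> Q" for Q q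
    proof -
      have "(A <#> Q) #> q = A <#> (Q #> q)"
        using that Ac by (intro setmult_rcos_assoc[symmetric]) (auto simp: subgroup.subset subgroup.mem_carrier)
      then show ?thesis using subgroup.rcos_const[OF that(1) is_group that(2)] by simp
    qed
    have bprod: "bounded_mod Q (A <#> Q)" if Q: "subgroup Q G" "K \<subseteq> Q" for Q
    proof -
      obtain F where F: "finite F" "F \<subseteq> carrier G" "A \<subseteq> F <#> K" using Ab unfolding bounded_mod_def by blast
      have Qc: "Q \<subseteq> carrier G" using Q(1) by (rule subgroup.subset)
      have "A <#> Q \<subseteq> (F <#> K) <#> Q" using F by (intro mono_set_mult) auto
      also have "\<dots> = F <#> (K <#> Q)" using F Kc Qc by (simp add: set_mult_assoc)
      also have "\<dots> \<subseteq> F <#> Q"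
      proof (rule mono_set_mult[OF order.refl])
        show "K <#> Q \<subseteq> Q"
        proof
          fix g assume "g \<in> K <#> Q"
          then obtain k q where "k \<in> K" "q \<in> Q" "g = k \<otimes> q" unfolding mem_set_mult by (elim bexE)
          then show "g \<in> Q" using Q by (simp add: subgroup.m_closed subset_iff)
        qed
      qed
      finally show ?thesis by (rule bounded_modI[OF F(1,2)])
    qed
    have AAQ: "A \<subseteq> A <#> Q" if "subgroup Q G" for Q
      using subgroup.one_closed[OF that] Ac by (force simp: mem_set_mult)
    have ycl: "y \<in> closure (patterns K (s + \<epsilon>) (A <#> L))"
    proof -
      let ?P = "orbit_patches s L x"
      have "y \<in> closure (patterns K (s + \<epsilon>) (\<Union>p\<in>?P. snd p))"
      proof (rule glue_in_patterns_closure[OF K J \<epsilon>(1,2) _ \<epsilon>(5)])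
        show "0 \<le> s" using s by simp
        show "separated J ?P" "y \<in> X" "shadows \<epsilon> J ?P y" using P y by (simp_all add: L_def)
        fix p assume p: "p \<in> ?P"
        then obtain l where l: "l \<in> L" "p = translate l (x, suppt s x)" by (auto simp: orbit_patches_def)
        have lc: "l \<in> carrier G" using l Lc by blast
        have sp: "snd p = suppt s (fst p)" by (rule snd_orbit_patches[OF x(1) Lc p])
        show "snd p \<subseteq> carrier G" unfolding sp by simp
        have "x \<in> patterns K s (suppt s x)" using x by (simp add: patterns_def)
        then have fp: "fst p \<in> patterns K s (snd p)" using patterns_act[OF K lc] l(2) by simp
        then show "fst p \<in> closure (patterns K s (snd p))" using closure_subset by blast
        fix k assume k: "k \<in> K"
        have kc: "k \<in> carrier G" using k Kc by blast
        have "act (inv k) (fst p) = fst p"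
          using fp subgroup.m_inv_closed[OF Ks k] by (simp add: patterns_def fixed_by_def)
        then show "snd p #> k = snd p"
          using suppt_act[OF inv_closed[OF kc], of "fst p" s] fp kc by (simp add: sp patterns_def)
      qed
      moreover have "(\<Union>p\<in>?P. snd p) \<subseteq> A <#> L"
      proof
        fix g assume "g \<in> (\<Union>p\<in>?P. snd p)"
        then obtain l where l: "l \<in> L" "g \<in> A #> inv l" by (auto simp: orbit_patches_def A_def)
        then obtain b where "b \<in> A" "g = b \<otimes> inv l" by (auto simp: r_coset_def)
        then show "g \<in> A <#> L" using subgroup.m_inv_closed[OF L l(1)] by (simp add: set_multI)
      qed
      ultimately show ?thesis using patterns_closure_mono[OF order.refl, of "\<Union>p\<in>?P. snd p" "A <#> L" K "s + \<epsilon>"] by blast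
    qed
    have yL: "fixed_by L y" using y(2) by (simp add: L_def)
    obtain B where B: "bounded_mod H' B"
      "\<And>x n. x \<in> patterns K t1 U \<Longrightarrow> supp x \<subseteq> A <#> H' \<Longrightarrow> supp ((f ^^ n) x) \<subseteq> B"
      using stable_along_confines[OF H'(1) KH' H'(3) st t(5,3) bprod[OF H'(1) KH']] by blast
    have conf': "supp ((f ^^ n) z) \<subseteq> B" if "z \<in> closure (patterns K t1 (A <#> H'))" for z n
    proof (rule closure_supp_fn[OF patterns_X _ that])
      fix b assume b: "b \<in> patterns K t1 (A <#> H')"
      then have "b \<in> patterns K t1 U" using patterns_mono[of t1 t1 "A <#> H'" U K] sat[OF H'(3)] by auto
      moreover have "supp b \<subseteq> A <#> H'" using b suppt_antimono[of t1 \<Delta> b] t by (auto simp: patterns_def)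
      ultimately show "supp ((f ^^ n) b) \<subseteq> B" by (rule B(2))
    qed
    have ALH': "A <#> L \<subseteq> A <#> H'" by (rule mono_set_mult[OF order.refl LH'])
    show ?thesis
    proof (cases "\<exists>i::int. i \<noteq> 0 \<and> a [^] i \<in> L")
      case True
      then obtain i0 :: int where "i0 \<noteq> 0" "a [^] i0 \<in> L" by blast
      then have i0: "i0 \<noteq> 0" "a [^] i0 \<in> L" "a [^] (- i0) \<in> L"
        using subgroup.m_inv_closed[OF L, of "a [^] i0"] ac by (simp_all add: int_pow_neg)
      have "\<exists>i::int. i > 0 \<and> a [^] i \<in> L"
      proof (cases "i0 > 0")
        case True then show ?thesis using i0(2) by blast
      next
        case False
        then have "- i0 > 0" using i0(1) by simp
        then show ?thesis using i0(3) by blast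
      qed
      then obtain i :: int where i: "i > 0" "a [^] i \<in> L" by blast
      have "bounded_mod L H'"
      proof (rule bounded_modI)
        let ?R = "\<Union>j\<in>{0..<i}. R #> a [^] j"
        show "finite ?R" using R by (simp add: r_coset_def)
        show "?R \<subseteq> carrier G" using R ac by (auto simp: r_coset_def)
        show "H' \<subseteq> ?R <#> L"
        proof
          fix z assume "z \<in> H'"
          then obtain h j where hj: "h \<in> H" "z = h \<otimes> a [^] (j::int)" using gen by blast
          obtain q l where ql: "q \<in> R" "l \<in> L" "h = q \<otimes> l" using subsetD[OF R(3) hj(1)] unfolding mem_set_mult by (elim bexE)
          have c: "q \<in> carrier G" "l \<in> carrier G" using ql R Lc by auto
          have pM: "a [^] j \<in> M" using H'(3,4) Ms by (simp add: subgroup_int_pow_closed subset_iff)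
          have l': "inv (a [^] j) \<otimes> l \<otimes> a [^] j \<in> L" by (rule normal_between[OF L KL LM pM ql(2)])
          have "a [^] j = a [^] (j mod i + i * (j div i))" by simp
          also have "\<dots> = a [^] (j mod i) \<otimes> (a [^] i) [^] (j div i)"
            using ac int_pow_mult[OF ac, of "j mod i" "i * (j div i)"] int_pow_pow[OF ac, of i "j div i"] by simp
          finally have aj: "a [^] j = a [^] (j mod i) \<otimes> (a [^] i) [^] (j div i)" .
          have aL: "(a [^] i) [^] (j div i) \<in> L" using i(2) L by (simp add: subgroup_int_pow_closed)
          have "z = q \<otimes> a [^] j \<otimes> (inv (a [^] j) \<otimes> l \<otimes> a [^] j)"
            using hj(2) ql(3) c ac by (simp add: m_assoc mult_inv_cancel_left)
          also have "\<dots> = (q \<otimes> a [^] (j mod i)) \<otimes> ((a [^] i) [^] (j div i) \<otimes> (inv (a [^] j) \<otimes> l \<otimes> a [^] j))"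
          proof -
            obtain u where u: "u = inv (a [^] j) \<otimes> l \<otimes> a [^] j" by simp
            have "u \<in> carrier G" using l' u Lc by blast
            then show ?thesis unfolding u[symmetric] unfolding aj using c ac by (simp add: m_assoc)
          qed
          finally have z: "z = (q \<otimes> a [^] (j mod i)) \<otimes> ((a [^] i) [^] (j div i) \<otimes> (inv (a [^] j) \<otimes> l \<otimes> a [^] j))" .
          have "j mod i \<in> {0..<i}" using i(1) by simp
          then have "q \<otimes> a [^] (j mod i) \<in> ?R" using ql(1) by (auto simp: r_coset_def)
          then show "z \<in> ?R <#> L" using subgroup.m_closed[OF L aL l'] z by (simp add: set_multI)
        qed
      qed
      then have "bounded_mod L B" using B(1) Lc by (rule bounded_mod_index)
      moreover have "y \<in> closure (patterns K t1 (A <#> H'))"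
        using ycl patterns_closure_mono[OF _ ALH', of "s + \<epsilon>" t1 K] \<epsilon> t by auto
      ultimately show ?thesis using conf' by (intro confined_imp_nilp[OF y(1) Lc yL]) auto
    next
      case False
      obtain B0 where B0: "finite B0" "B0 \<subseteq> carrier G" "B \<subseteq> B0 <#> H'" using B(1) unfolding bounded_mod_def by blast
      interpret cyclic_confinement G X act zero S f \<Delta> K L H' a t0 t1 "A <#> H'" "B0 <#> R"
      proof (intro cyclic_confinement.intro cyclic_confinement_axioms.intro shadowing_system_axioms)
        show "inv h \<otimes> l \<otimes> h \<in> L" if "h \<in> H'" "l \<in> L" for h l
          using normal_between[OF L KL LM _ that(2)] that(1) H'(3) by blast
        show "a [^] i \<notin> L" if "i \<noteq> 0" for i :: int using False that by blast
        show "t1 \<le> \<Delta>" using t by simp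
        show "A <#> H' \<subseteq> carrier G" using Ac H'c by (simp add: set_mult_closed)
        show "(A <#> H') #> h \<subseteq> A <#> H'" if "h \<in> H'" for h using inv_prod[OF H'(1) that] by simp
        show "finite (B0 <#> R)" "B0 <#> R \<subseteq> carrier G" using B0 R by (simp_all add: set_mult_closed)
        show "supp ((f ^^ n) z) \<subseteq> (\<Union>i::int. ((B0 <#> R) <#> L) #> a [^] i)"
          if "z \<in> closure (patterns K t1 (A <#> H'))" for z n
        proof
          fix g assume "g \<in> supp ((f ^^ n) z)"
          then have "g \<in> B0 <#> H'" using conf'[OF that] B0(3) by blast
          then obtain b h' where bh: "b \<in> B0" "h' \<in> H'" "g = b \<otimes> h'" unfolding mem_set_mult by (elim bexE)
          obtain h i where hi: "h \<in> H" "h' = h \<otimes> a [^] (i::int)" using gen[OF bh(2)] by blast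
          obtain q l where ql: "q \<in> R" "l \<in> L" "h = q \<otimes> l" using subsetD[OF R(3) hi(1)] unfolding mem_set_mult by (elim bexE)
          have c: "b \<in> carrier G" "q \<in> carrier G" "l \<in> carrier G" using bh ql B0 R Lc by auto
          have "g = ((b \<otimes> q) \<otimes> l) \<otimes> a [^] i" using bh(3) hi(2) ql(3) c ac by (simp add: m_assoc)
          moreover have "(b \<otimes> q) \<otimes> l \<in> (B0 <#> R) <#> L" using bh ql by (intro set_multI)
          ultimately show "g \<in> (\<Union>i::int. ((B0 <#> R) <#> L) #> a [^] i)" by (auto simp: r_coset_def)
        qed
      qed (use K L H'(1) KL LH' H'(4) t in \<open>simp_all\<close>)
      have "region (A <#> L)"
        unfolding region_def using ALH' bprod[OF L KL] inv_prod[OF L] by blast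
      moreover have "y \<in> closure (patterns K t0 (A <#> L))"
        using ycl patterns_closure_mono[OF \<epsilon>(4) order.refl, of K "A <#> L"] by blast
      ultimately have "y \<in> finite_patterns t0" using y(1) yL by (auto simp: finite_patterns_def)
      then show ?thesis by (rule finite_patterns_nilp)
    qed
  qed
  obtain Z where Z: "bounded_mod H Z"
    "\<And>x n. x \<in> X \<Longrightarrow> fixed_by K x \<Longrightarrow> bounded_mod K (supp x) \<Longrightarrow> suppt s x \<subseteq> U \<Longrightarrow>
        supp x \<inter> Z = {} \<Longrightarrow> T \<inter> supp ((f ^^ n) x) = {}"
  proof (rule periodic_stability[OF K closed H(1,2) s(1) _ \<epsilon>(1,3) J T])
    show "s \<le> \<Delta>" using s by simp
    show "nilp y" if "x \<in> X" "fixed_by K x" "bounded_mod K (supp x)" "suppt s x \<subseteq> U"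
      "finite_index_normal N" "y \<in> X" "fixed_by (H \<inter> (K <#> N)) y"
      "patches (orbit_patches s (H \<inter> (K <#> N)) x)" "separated J (orbit_patches s (H \<inter> (K <#> N)) x)"
      "shadows \<epsilon> J (orbit_patches s (H \<inter> (K <#> N)) x) y" for x N y
      using nil[OF that] .
  qed blast
  show "\<exists>Z. bounded_mod H Z \<and> (\<forall>x n. x \<in> patterns K s U \<longrightarrow> supp x \<inter> Z = {} \<longrightarrow> T \<inter> supp ((f ^^ n) x) = {})"
    by (rule exI[of _ Z]) (use Z in \<open>simp add: patterns_def\<close>)
qed

lemma finitely_generated_step:
  assumes "finite B" "B \<subseteq> M"
  shows "\<exists>H. subgroup H G \<and> K \<subseteq> H \<and> H \<subseteq> M \<and> B \<subseteq> H \<and> (stable_along H \<longrightarrow> stable_along K)"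
  using assms
proof (induction B rule: finite_induct)
  case empty
  show ?case using Ks KM by (intro exI[of _ K]) auto
next
  case (insert a B)
  then obtain H where H: "subgroup H G" "K \<subseteq> H" "H \<subseteq> M" "B \<subseteq> H" "stable_along H \<longrightarrow> stable_along K" by auto
  have aM: "a \<in> M" using insert.prems by simp
  have ac: "a \<in> carrier G" using aM Mc by blast
  have Hc: "H \<subseteq> carrier G" using H(1) by (rule subgroup.subset)
  define H' where "H' = {h \<otimes> a [^] i | h i. h \<in> H \<and> i \<in> (UNIV :: int set)}"
  have sub: "subgroup H' G" unfolding H'_def by (rule cyclic_extension[OF H(1) Ms H(3) aM normal_between[OF H(1-3)]])
  have HH': "H \<subseteq> H'"
  proof
    fix h assume h: "h \<in> H"
    then have "h = h \<otimes> a [^] (0::int)" using Hc by auto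
    then show "h \<in> H'" using h unfolding H'_def by blast
  qed
  have "a = \<one> \<otimes> a [^] (1::int)" using ac by simp
  then have aH': "a \<in> H'" using subgroup.one_closed[OF H(1)] unfolding H'_def by blast
  have H'M: "H' \<subseteq> M"
    using H(3) aM Ms by (auto simp: H'_def intro!: subgroup.m_closed[OF Ms] subgroup_int_pow_closed)
  have "stable_along H' \<longrightarrow> stable_along H"
    using cyclic_step[OF H(1-3) sub HH' H'M aH'] by (auto simp: H'_def)
  then show ?case using H sub HH' H'M aH' by (intro exI[of _ H']) auto
qed

text \<open>
  In one step a support moves only between cosets of the subgroup generated by \<open>K\<close> and the finite set \<open>B\<close>. Hence stability
  holds trivially along a subgroup \<open>H\<close> containing \<open>B\<close>, and it descends to \<open>K\<close> through finitely many cyclic steps.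
\<close>
lemma abelian_nilp:
  assumes t: "0 < t" "t < \<Delta>" and x: "x \<in> patterns K t U" shows "nilp x"
proof -
  obtain E where E: "finite E" "E \<subseteq> carrier G" "\<And>x. x \<in> X \<Longrightarrow> supp (f x) \<subseteq> E <#> supp x"
    using suppt_fn[OF \<Delta>_pos, of 1] by auto
  define B where "B = (invs T <#> (E <#> T)) \<inter> M"
  have "finite B" "B \<subseteq> M" using E T by (auto simp: B_def)
  then obtain H where H: "subgroup H G" "K \<subseteq> H" "H \<subseteq> M" "B \<subseteq> H" "stable_along H \<longrightarrow> stable_along K"
    using finitely_generated_step by blast
  have Hc: "H \<subseteq> carrier G" using H(1) by (rule subgroup.subset)
  have "stable_along H"
    unfolding stable_along_def
  proof (intro allI impI exI conjI)
    show "bounded_mod H (T <#> H)" by (rule bounded_modI[OF T order.refl])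
    fix s x n assume s: "0 < s" "s < \<Delta>" and x: "x \<in> patterns K s U" "supp x \<inter> (T <#> H) = {}"
    have xX: "x \<in> X" using x(1) patterns_X by blast
    have xD: "x \<in> patterns K \<Delta> U" using x(1) patterns_mono[of s \<Delta> U U K] s by auto
    have "supp ((f ^^ n) x) \<inter> (T <#> H) = {}"
    proof (induction n)
      case 0 then show ?case using x(2) by simp
    next
      case (Suc n)
      show ?case
      proof (rule ccontr)
        assume "supp ((f ^^ Suc n) x) \<inter> (T <#> H) \<noteq> {}"
        then obtain g where g: "g \<in> supp (f ((f ^^ n) x))" "g \<in> T <#> H" by auto
        obtain u h where uh: "u \<in> T" "h \<in> H" "g = u \<otimes> h" using g(2) unfolding mem_set_mult by (elim bexE)
        have "g \<in> E <#> supp ((f ^^ n) x)" by (rule subsetD[OF E(3)[OF fn_closed[OF xX]] g(1)])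
        then obtain e k where ek: "e \<in> E" "k \<in> supp ((f ^^ n) x)" "g = e \<otimes> k" unfolding mem_set_mult by (elim bexE)
        obtain v m where vm: "v \<in> T" "m \<in> M" "k = v \<otimes> m" using subsetD[OF conf[OF xD] ek(2)] unfolding mem_set_mult by (elim bexE)
        have c: "u \<in> carrier G" "h \<in> carrier G" "e \<in> carrier G" "v \<in> carrier G" "m \<in> carrier G"
          using uh ek vm T E Hc Mc by auto
        have "u \<otimes> h = e \<otimes> (v \<otimes> m)" using uh ek vm by simp
        then have "inv u \<otimes> (u \<otimes> h) = inv u \<otimes> (e \<otimes> (v \<otimes> m))" by simp
        then have hm: "h = (inv u \<otimes> (e \<otimes> v)) \<otimes> m" using c by (simp add: inv_mult_cancel_left m_assoc)
        then have b: "inv u \<otimes> (e \<otimes> v) = h \<otimes> inv m" using c by (simp add: m_assoc)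
        have "h \<otimes> inv m \<in> M" using uh vm H(3) Ms by (simp add: subgroup.m_closed subgroup.m_inv_closed subset_iff)
        moreover have "inv u \<otimes> (e \<otimes> v) \<in> invs T <#> (E <#> T)" using uh ek vm by (intro set_multI invsI)
        ultimately have "inv u \<otimes> (e \<otimes> v) \<in> H" using b H(4) by (auto simp: B_def)
        then have "inv (inv u \<otimes> (e \<otimes> v)) \<otimes> h \<in> H" using uh(2) H(1) by (simp add: subgroup.m_closed subgroup.m_inv_closed)
        moreover have "inv (inv u \<otimes> (e \<otimes> v)) \<otimes> h = m"
          using inv_mult_cancel_left[of "inv u \<otimes> (e \<otimes> v)" m] hm c by simp
        ultimately have "k \<in> T <#> H" using vm by (simp add: set_multI)
        then show False using Suc ek(2) by blast
      qed
    qed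
    moreover have "T \<subseteq> T <#> H" using subgroup.one_closed[OF H(1)] T(2) by (force simp: mem_set_mult)
    ultimately show "T \<inter> supp ((f ^^ n) x) = {}" by blast
  qed
  then have st: "stable_along K" using H(5) by blast
  have xD: "x \<in> X" "fixed_by K x" "bounded_mod K (supp x)" using x by (auto simp: patterns_def)
  obtain C where C: "bounded_mod K C"
    "\<And>z n. z \<in> patterns K t U \<Longrightarrow> supp z \<subseteq> supp x \<Longrightarrow> supp ((f ^^ n) z) \<subseteq> C"
    using stable_along_confines[OF Ks order.refl KM st t xD(3)] by blast
  show ?thesis using C(2)[OF x order.refl] by (rule confined_imp_nilp[OF xD(1) Kc xD(2) C(1)])
qed

end

section \<open>Descent along the derived series\<close>

context shadowing_system begin

definition nil_over :: "'g set \<Rightarrow> bool" where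
  "nil_over K \<longleftrightarrow> (\<forall>x\<in>X. fixed_by K x \<longrightarrow> bounded_mod K (supp x) \<longrightarrow> nilp x)"

text \<open>
  Since \<open>K\<close> is closed and of finite index in \<open>D'\<close>, it is cut out of \<open>D'\<close> by a single \<open>K N1\<close>. Then \<open>M = D \<inter> K N1\<close> has finite index in
  \<open>D\<close> and is abelian modulo \<open>K\<close>. The induction hypothesis gives stability along \<open>D\<close>, and thus confinement to cosets
  of \<open>M\<close>.
\<close>
lemma abelian_step:
  assumes D: "D \<lhd> G" "profinitely_closed D" and D': "D' \<lhd> G" "D' \<subseteq> D"
    and comm: "\<And>x y. x \<in> D \<Longrightarrow> y \<in> D \<Longrightarrow> x \<otimes> y \<otimes> inv x \<otimes> inv y \<in> D'"
    and IH: "\<And>L. L \<lhd> G \<Longrightarrow> L \<subseteq> D \<Longrightarrow> profinitely_closed L \<Longrightarrow> bounded_mod L D \<Longrightarrow> nil_over L"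
    and K: "K \<lhd> G" "K \<subseteq> D'" "profinitely_closed K" "bounded_mod K D'"
  shows "nil_over K"
proof -
  have Ks: "subgroup K G" and Ds: "subgroup D G" and D's: "subgroup D' G"
    using K D D' by (simp_all add: normal_imp_subgroup)
  have Kc: "K \<subseteq> carrier G" and Dc: "D \<subseteq> carrier G" and D'c: "D' \<subseteq> carrier G"
    using Ks Ds D's by (simp_all add: subgroup.subset)
  have KD: "K \<subseteq> D" using K D' by blast
  obtain R where R: "finite R" "R \<subseteq> carrier G" "D' \<subseteq> R <#> K" using K(4) unfolding bounded_mod_def by blast
  obtain N1 where N1: "finite_index_normal N1" "\<And>q. q \<in> R \<Longrightarrow> q \<in> K <#> N1 \<Longrightarrow> q \<in> K"
    using profinitely_closed_separates[OF K(3) Kc R(1,2)] by blast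
  have fi: "D \<inter> (K <#> N) \<lhd> G \<and> K \<subseteq> D \<inter> (K <#> N) \<and> profinitely_closed (D \<inter> (K <#> N)) \<and>
      bounded_mod (D \<inter> (K <#> N)) D \<and> subgroup (K <#> N) G" if N: "finite_index_normal N" for N
  proof -
    have Nn: "N \<lhd> G" "bounded_mod N (carrier G)" using N by (simp_all add: finite_index_normal_def)
    have Ns: "subgroup N G" using Nn(1) by (rule normal_imp_subgroup)
    have KN: "K <#> N \<lhd> G" by (rule normal_subgroup_set_mult_closed[OF K(1) Nn(1)])
    have KNs: "subgroup (K <#> N) G" using KN by (rule normal_imp_subgroup)
    have KKN: "K \<subseteq> K <#> N" using subgroup.one_closed[OF Ns] Kc by (force simp: mem_set_mult)
    have NKN: "N \<subseteq> K <#> N"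
      using subgroup.one_closed[OF Ks] subgroup.subset[OF Ns] by (force simp: mem_set_mult)
    have "bounded_mod (K <#> N) D"
      by (rule bounded_mod_subset[OF bounded_mod_mono[OF Nn(2) NKN] Dc])
    then have "bounded_mod (D \<inter> (K <#> N)) D" by (rule bounded_mod_Int[OF Ds KNs])
    then show ?thesis
      using normal_Int[OF D(1) KN] KD KKN profinitely_closed_Int[OF D(2) profinitely_closed_mult[OF K(1) N]] KNs by blast
  qed
  define M where "M = D \<inter> (K <#> N1)"
  have M: "M \<lhd> G" "K \<subseteq> M" "bounded_mod M D" "subgroup (K <#> N1) G" using fi[OF N1(1)] by (auto simp: M_def)
  have Ms: "subgroup M G" using M(1) by (rule normal_imp_subgroup)
  have Mc: "M \<subseteq> carrier G" using Ms by (rule subgroup.subset)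
  have MD: "M \<subseteq> D" by (auto simp: M_def)
  have DK: "d \<in> K" if d: "d \<in> D'" "d \<in> K <#> N1" for d
  proof -
    obtain q k where qk: "q \<in> R" "k \<in> K" "d = q \<otimes> k" using subsetD[OF R(3) d(1)] unfolding mem_set_mult by (elim bexE)
    have c: "q \<in> carrier G" "k \<in> carrier G" using qk R Kc by auto
    have "q = d \<otimes> inv k" using qk(3) c by (simp add: m_assoc)
    moreover have "inv k \<in> K <#> N1"
      using fi[OF N1(1)] subgroup.m_inv_closed[OF Ks qk(2)] by blast
    ultimately have "q \<in> K <#> N1" using d(2) M(4) by (simp add: subgroup.m_closed)
    then have "q \<in> K" using N1(2) qk(1) by blast
    then show ?thesis using qk Ks by (simp add: subgroup.m_closed)
  qed
  have commM: "x \<otimes> y \<otimes> inv x \<otimes> inv y \<in> K" if "x \<in> M" "y \<in> M" for x y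
  proof (rule DK)
    show "x \<otimes> y \<otimes> inv x \<otimes> inv y \<in> D'" using that MD by (intro comm) auto
    show "x \<otimes> y \<otimes> inv x \<otimes> inv y \<in> K <#> N1"
      using that M(4) by (auto simp: M_def intro!: subgroup.m_closed[OF M(4)] subgroup.m_inv_closed[OF M(4)])
  qed
  define \<epsilon> where "\<epsilon> = \<Delta> / 4"
  have \<epsilon>: "0 < \<epsilon>" "2 * \<epsilon> \<le> \<Delta>" using \<Delta>_pos by (auto simp: \<epsilon>_def)
  obtain J where J: "glueing \<epsilon> J" using glueing_exists[OF \<epsilon>(1)] by blast
  have nil: "nilp y"
    if x: "x \<in> X" "fixed_by K x" "bounded_mod K (supp x)" and N: "finite_index_normal N"
      and y: "y \<in> X" "fixed_by (D \<inter> (K <#> N)) y"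
      and P: "separated J (orbit_patches \<Delta> (D \<inter> (K <#> N)) x)" "shadows \<epsilon> J (orbit_patches \<Delta> (D \<inter> (K <#> N)) x) y"
    for x N y
  proof -
    define L where "L = D \<inter> (K <#> N)"
    have L: "L \<lhd> G" "K \<subseteq> L" "profinitely_closed L" "bounded_mod L D" using fi[OF N] by (auto simp: L_def)
    have Ls: "subgroup L G" using L(1) by (rule normal_imp_subgroup)
    have Lc: "L \<subseteq> carrier G" using Ls by (rule subgroup.subset)
    obtain E where E: "finite E" "E \<subseteq> carrier G" "\<And>x. x \<in> X \<Longrightarrow> suppt (\<Delta> / 2) x \<subseteq> E <#> supp x"
      using suppt_supp[of "\<Delta> / 2"] \<Delta>_pos by (metis half_gt_zero)
    have "bounded_mod L (E <#> supp x)"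
      by (rule bounded_mod_mult[OF E(1,2) bounded_mod_mono[OF x(3) L(2)] Lc])
    then obtain Q where Q: "finite Q" "Q \<subseteq> carrier G" "E <#> supp x \<subseteq> Q <#> L" unfolding bounded_mod_def by blast
    have "supp y \<subseteq> Q <#> L"
    proof
      fix g assume g: "g \<in> supp y"
      have gc: "g \<in> carrier G" using g by (rule suppt_closedD)
      obtain p where p: "p \<in> orbit_patches \<Delta> L x" "g \<in> suppt (\<Delta> / 2) (fst p)"
        unfolding L_def by (rule shadows_supp_local[OF P(2,1) \<epsilon>(2) g])
      obtain l where l: "l \<in> L" "fst p = act l x" using p(1) by (auto simp: orbit_patches_def)
      have "g \<otimes> l \<in> suppt (\<Delta> / 2) x" using mem_suppt_act[OF gc subsetD[OF Lc l(1)] x(1)] p(2) l(2) by simp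
      then have "g \<otimes> l \<in> Q <#> L" using E(3)[OF x(1)] Q(3) by blast
      then show "g \<in> Q <#> L" by (rule mult_coset_absorb[OF Ls Q(2) gc l(1)])
    qed
    then have "bounded_mod L (supp y)" by (rule bounded_modI[OF Q(1,2)])
    moreover have "nil_over L" using IH[OF L(1) _ L(3,4)] by (auto simp: L_def)
    ultimately show ?thesis using y by (simp add: nil_over_def L_def)
  qed
  obtain Z where Z: "bounded_mod D Z"
    "\<And>x n. x \<in> X \<Longrightarrow> fixed_by K x \<Longrightarrow> bounded_mod K (supp x) \<Longrightarrow> suppt \<Delta> x \<subseteq> carrier G \<Longrightarrow>
        supp x \<inter> Z = {} \<Longrightarrow> {\<one>} \<inter> supp ((f ^^ n) x) = {}"
  proof (rule periodic_stability[OF K(1,3) Ds KD \<Delta>_pos order.refl \<epsilon> J, of "{\<one>}" "carrier G"])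
    show "nilp y" if "x \<in> X" "fixed_by K x" "bounded_mod K (supp x)" "suppt \<Delta> x \<subseteq> carrier G"
      "finite_index_normal N" "y \<in> X" "fixed_by (D \<inter> (K <#> N)) y"
      "patches (orbit_patches \<Delta> (D \<inter> (K <#> N)) x)" "separated J (orbit_patches \<Delta> (D \<inter> (K <#> N)) x)"
      "shadows \<epsilon> J (orbit_patches \<Delta> (D \<inter> (K <#> N)) x) y" for x N y
      using nil[OF that(1-3) that(5-7) that(9,10)] .
    show "finite {\<one>}" "{\<one>} \<subseteq> carrier G" by simp_all
  qed blast
  show ?thesis
    unfolding nil_over_def
  proof (intro ballI impI)
    fix x assume x: "x \<in> X" "fixed_by K x" "bounded_mod K (supp x)"
    obtain E where E: "finite E" "E \<subseteq> carrier G" "\<And>x. x \<in> X \<Longrightarrow> suppt (\<Delta> / 2) x \<subseteq> E <#> supp x"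
      using suppt_supp[of "\<Delta> / 2"] \<Delta>_pos by (metis half_gt_zero)
    have "bounded_mod K (suppt (\<Delta> / 2) x)"
      by (rule bounded_mod_subset[OF bounded_mod_mult[OF E(1,2) x(3) Kc] E(3)[OF x(1)]])
    then obtain F where F: "finite F" "F \<subseteq> carrier G" "suppt (\<Delta> / 2) x \<subseteq> F <#> K" unfolding bounded_mod_def by blast
    define U where "U = F <#> M"
    have Uc: "U \<subseteq> carrier G" using F Mc by (simp add: U_def set_mult_closed)
    have "U \<subseteq> F <#> D" unfolding U_def by (rule mono_set_mult[OF order.refl MD])
    then have Ub: "bounded_mod D U" by (rule bounded_modI[OF F(1,2)])
    obtain B where B: "bounded_mod D B"
      "\<And>x n. x \<in> X \<Longrightarrow> supp x \<subseteq> U \<Longrightarrow>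
         (\<And>m. m \<in> carrier G \<Longrightarrow> supp (act m x) \<inter> Z = {} \<Longrightarrow> {\<one>} \<inter> supp ((f ^^ n) (act m x)) = {}) \<Longrightarrow>
         supp ((f ^^ n) x) \<inter> ({\<one>} <#> carrier G) \<subseteq> B"
      using confinement[OF Ds subgroup_self Dc normal.inv_op_closed1[OF D(1)] _ _ Z(1) Ub, of "{\<one>}"] by blast
    have "bounded_mod M B" by (rule bounded_mod_index[OF M(3) B(1) Mc])
    then obtain T where T: "finite T" "T \<subseteq> carrier G" "B \<subseteq> T <#> M" unfolding bounded_mod_def by blast
    have "suppt (\<Delta> / 2) x \<subseteq> U"
      using F(3) mono_set_mult[OF order.refl[of F] M(2)] by (auto simp: U_def)
    then have xU: "x \<in> patterns K (\<Delta> / 2) U" using x by (simp add: patterns_def)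
    interpret abelian_confinement G X act zero S f \<Delta> K M U T
    proof (intro abelian_confinement.intro abelian_confinement_axioms.intro shadowing_system_axioms)
      show "U #> m \<subseteq> U" if "m \<in> M" for m
      proof -
        have "U #> m = F <#> (M #> m)" unfolding U_def
          using F Mc that by (intro setmult_rcos_assoc[symmetric]) auto
        then show ?thesis using subgroup.rcos_const[OF Ms is_group that] by (simp add: U_def)
      qed
      fix z n assume z: "z \<in> patterns K \<Delta> U"
      then have zD: "z \<in> X" "fixed_by K z" "bounded_mod K (supp z)" "supp z \<subseteq> U" by (auto simp: patterns_def)
      have "supp ((f ^^ n) z) \<inter> ({\<one>} <#> carrier G) \<subseteq> B"
      proof (rule B(2)[OF zD(1,4)])
        fix m assume m: "m \<in> carrier G" "supp (act m z) \<inter> Z = {}"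
        have "act m z \<in> patterns K \<Delta> (U #> inv m)" by (rule patterns_act[OF K(1) m(1) z])
        then show "{\<one>} \<inter> supp ((f ^^ n) (act m z)) = {}"
          using m(2) by (intro Z(2)) (auto simp: patterns_def)
      qed
      moreover have "{\<one>} <#> carrier G = carrier G" by (auto simp: set_mult_def)
      ultimately have "supp ((f ^^ n) z) \<inter> carrier G \<subseteq> T <#> M" using T(3) by simp
      then show "supp ((f ^^ n) z) \<subseteq> T <#> M" using suppt_closed[of \<Delta> "(f ^^ n) z"] by (simp add: inf.absorb1)
    qed (use K M commM Uc T in \<open>simp_all\<close>)
    show "nilp x" using \<Delta>_pos by (intro abelian_nilp[OF _ _ xU]) auto
  qed
qed

lemma nil_over_finite_index:
  assumes "subgroup K G" "bounded_mod K (carrier G)" shows "nil_over K"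
  unfolding nil_over_def
proof (intro ballI impI)
  fix x assume x: "x \<in> X" "fixed_by K x"
  show "nilp x"
    by (rule confined_imp_nilp[OF x(1) subgroup.subset[OF assms(1)] x(2) assms(2)]) simp
qed

text \<open>
  The induction starts at a normal subgroup of finite index, where all supports are finite modulo the periods.
\<close>
lemma nil_over_trivial:
  assumes rf: "residually_finite G" and vs: "virtually_solvable G"
  shows "nil_over {\<one>}"
proof -
  obtain C n where C: "finite_index_normal C" "(derived G ^^ n) C \<subseteq> {\<one>}"
    using virtually_solvable_core[OF vs] by blast
  have Cn: "C \<lhd> G" "bounded_mod C (carrier G)" using C(1) by (simp_all add: finite_index_normal_def)
  define P where "P j = (derived G ^^ j) C" for j
  have P: "P j \<lhd> G" for j unfolding P_def by (rule derived_normal[OF Cn(1)])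
  have Pc: "P j \<subseteq> carrier G" for j using P by (simp add: normal_imp_subgroup subgroup.subset)
  define D where "D j = profinite_closure (P j)" for j
  have D: "D j \<lhd> G" "profinitely_closed (D j)" for j
    unfolding D_def using profinite_closure_normal[OF P] profinite_closure_closed[OF Pc] by blast+
  have PSuc: "P (Suc j) = derived G (P j)" for j by (simp add: P_def)
  have "nil_over K" if "K \<lhd> G" "K \<subseteq> D j" "profinitely_closed K" "bounded_mod K (D j)" for j K
    using that
  proof (induction j arbitrary: K)
    case 0
    have "C \<subseteq> D 0" using subset_profinite_closure[OF Pc[of 0]] by (simp add: D_def P_def)
    then have "bounded_mod (D 0) (carrier G)" using bounded_mod_mono[OF Cn(2)] by blast
    then have "bounded_mod K (carrier G)"
      using bounded_mod_index[OF 0(4)] 0(1) by (simp add: normal_imp_subgroup subgroup.subset)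
    then show ?case using 0(1) by (intro nil_over_finite_index normal_imp_subgroup)
  next
    case (Suc j)
    have "P (Suc j) \<subseteq> P j" unfolding PSuc by (rule derived_incl[OF order.refl normal_imp_subgroup[OF P]])
    then have sub: "D (Suc j) \<subseteq> D j" unfolding D_def by (rule profinite_closure_mono)
    have comm: "x \<otimes> y \<otimes> inv x \<otimes> inv y \<in> D (Suc j)" if "x \<in> D j" "y \<in> D j" for x y
      using profinite_closure_commutator[OF P] that by (simp add: D_def PSuc)
    show ?case
    proof (rule abelian_step[OF D D(1) sub])
      show "x \<otimes> y \<otimes> inv x \<otimes> inv y \<in> D (Suc j)" if "x \<in> D j" "y \<in> D j" for x y by (rule comm[OF that])
      show "nil_over L" if "L \<lhd> G" "L \<subseteq> D j" "profinitely_closed L" "bounded_mod L (D j)" for L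
        using Suc.IH[OF that] .
    qed (rule Suc.prems)+
  qed
  moreover have "P n = {\<one>}"
    using C(2) subgroup.one_closed[OF normal_imp_subgroup[OF P[of n]]] by (auto simp: P_def)
  then have "D n = {\<one>}" unfolding D_def using residually_finite_closure[OF rf] by simp
  moreover from this have "bounded_mod {\<one>} (D n)"
    by (intro bounded_mod_finite) (auto simp: triv_subgroup)
  ultimately show ?thesis using D[of n] by (metis order.refl)
qed

lemma homoclinic_finite_support:
  assumes "x \<in> homoclinic_points G X act zero" shows "x \<in> X" "finite (supp x)"
proof -
  obtain E where "finite E" "\<forall>g\<in>carrier G - E. dist (act g x) zero < \<Delta>"
    using assms \<Delta>_pos unfolding homoclinic_points_def by blast
  then have "g \<in> E" if "g \<in> supp x" for g
    using that by (cases "g \<in> E") (auto simp: suppt_def dest: bspec[of _ _ g])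
  then have "supp x \<subseteq> E" by blast
  then show "finite (supp x)" using \<open>finite E\<close> finite_subset by blast
  show "x \<in> X" using assms by (simp add: homoclinic_points_def)
qed

text \<open>
  Zero being stable, a point of finite support that has become zero on a certain finite set is zero at the identity ever
  after. By compactness all points reach this state at a bounded time, also at all translates.
\<close>
lemma nilpotent_if_homoclinic_nilpotent:
  assumes nil: "nil_over {\<one>}" and dense: "dense_homoclinic_points G X act zero"
  shows "nilpotent_on X zero f"
proof -
  define Q where "Q = {x \<in> X. finite (supp x)}"
  have XQ: "X \<subseteq> closure Q"
    using dense closure_mono[of "homoclinic_points G X act zero" Q] homoclinic_finite_support
    unfolding dense_homoclinic_points_def Q_def by blast
  have QX: "Q \<subseteq> X" by (auto simp: Q_def)
  have triv: "subgroup {\<one>} G" by (rule triv_subgroup)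
  have Qnil: "bounded_mod {\<one>} (supp x) \<and> nilp x" if "x \<in> Q" for x
  proof -
    have x: "x \<in> X" "finite (supp x)" using that by (auto simp: Q_def)
    have "bounded_mod {\<one>} (supp x)" by (rule bounded_mod_finite[OF x(2) suppt_closed triv])
    moreover have "fixed_by {\<one>} x" using x by (simp add: fixed_by_def)
    ultimately show ?thesis using nil x by (simp add: nil_over_def)
  qed
  have Qf: "(f ^^ n) x \<in> Q" if "x \<in> Q" for x n
  proof -
    obtain E where E: "finite E" "E \<subseteq> carrier G" "\<And>x. x \<in> X \<Longrightarrow> supp ((f ^^ n) x) \<subseteq> E <#> supp x"
      using suppt_fn[OF \<Delta>_pos, of n] by blast
    show ?thesis using that E finite_subset[OF E(3)] by (auto simp: Q_def)
  qed
  have Qact: "act g x \<in> Q" if "x \<in> Q" "g \<in> carrier G" for x g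
    using that by (auto simp: Q_def suppt_act r_coset_def)
  obtain Z where Z: "bounded_mod {\<one>} Z"
    "\<And>x n. x \<in> X \<Longrightarrow> bounded_mod {\<one>} (supp x) \<Longrightarrow> nilp x \<Longrightarrow> supp x \<inter> Z = {} \<Longrightarrow> {\<one>} \<inter> supp ((f ^^ n) x) = {}"
    using stability_of_nilpotent_points[OF triv, of "{\<one>}"] by auto
  obtain F where F: "finite F" "F \<subseteq> carrier G" "Z \<subseteq> F <#> {\<one>}" using Z(1) unfolding bounded_mod_def by blast
  have "F <#> {\<one>} = F"
  proof -
    have "F <#> {\<one>} = (\<lambda>x. x \<otimes> \<one>) ` F" by (auto simp: set_mult_def)
    also have "\<dots> = id ` F" using F(2) by (intro image_cong) auto
    finally show ?thesis by simp
  qed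
  then have ZF: "Z \<subseteq> F" using F(3) by simp
  \<comment> \<open>by compactness all points of \<open>X\<close> enter a region of stability within bounded time\<close>
  define W where "W n = {x \<in> X. \<forall>h\<in>F. dist (act h ((f ^^ n) x)) zero < \<Delta>}" for n
  have Wopen: "openin (top_of_set X) (W n)" for n
  proof -
    have "openin (top_of_set X) {x \<in> X. dist (act h ((f ^^ n) x)) zero \<in> {..<\<Delta>}}" if "h \<in> F" for h
    proof -
      have "continuous_on X (\<lambda>x. dist (act h ((f ^^ n) x)) zero)"
        using that F(2) by (intro continuous_on_dist continuous_on_const continuous_act_fn) auto
      from continuous_openin_preimage_gen[OF this open_lessThan[of \<Delta>]]
      show ?thesis by (simp add: vimage_def Int_def)
    qed
    then have "openin (top_of_set X) (X \<inter> (\<Inter>h\<in>F. {x \<in> X. dist (act h ((f ^^ n) x)) zero \<in> {..<\<Delta>}}))"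
      using openin_INT[OF F(1), of "top_of_set X" "\<lambda>h. {x \<in> X. dist (act h ((f ^^ n) x)) zero \<in> {..<\<Delta>}}"]
      by (simp add: Int_commute)
    moreover have "X \<inter> (\<Inter>h\<in>F. {x \<in> X. dist (act h ((f ^^ n) x)) zero \<in> {..<\<Delta>}}) = W n" by (auto simp: W_def)
    ultimately show ?thesis by simp
  qed
  have Wcover: "X \<subseteq> (\<Union>n. W n)"
  proof
    fix x assume x: "x \<in> X"
    have "eventually (\<lambda>n. dist (act h ((f ^^ n) x)) zero < \<Delta>) sequentially" if "h \<in> F" for h
    proof -
      have hc: "h \<in> carrier G" using that F by blast
      have "(\<lambda>n. (f ^^ n) (act h x)) \<longlonglongrightarrow> zero" using asymp x hc unfolding asymptotically_nilpotent_def by simp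
      from tendstoD[OF this \<Delta>_pos] show ?thesis using fn_act[OF hc x] by simp
    qed
    then have "eventually (\<lambda>n. \<forall>h\<in>F. dist (act h ((f ^^ n) x)) zero < \<Delta>) sequentially"
      using F(1) by (simp add: eventually_ball_finite)
    then obtain n where "\<forall>h\<in>F. dist (act h ((f ^^ n) x)) zero < \<Delta>" unfolding eventually_sequentially by blast
    then show "x \<in> (\<Union>n. W n)" using x by (auto simp: W_def)
  qed
  obtain I where I: "finite I" "X \<subseteq> (\<Union>n\<in>I. W n)"
  proof -
    have "\<forall>n. \<exists>O'. open O' \<and> W n = X \<inter> O'" using Wopen by (simp add: openin_open)
    then obtain O' where O': "\<And>n. open (O' n)" "\<And>n. W n = X \<inter> O' n" by metis
    have cov: "X \<subseteq> (\<Union>n\<in>UNIV. O' n)" using Wcover O' by auto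
    obtain I where "I \<subseteq> UNIV" "finite I" "X \<subseteq> (\<Union>n\<in>I. O' n)"
      by (rule compactE_image[OF compact_space _ cov]) (use O' in auto)
    then show thesis using that[of I] O'(2) by auto
  qed
  obtain N where N: "\<And>n. n \<in> I \<Longrightarrow> n \<le> N" using I(1) by (meson finite_nat_set_iff_bounded_le)
  have "(f ^^ N) x = zero" if x: "x \<in> Q" for x
  proof -
    have "supp ((f ^^ N) x) = {}"
    proof (rule ccontr)
      assume "supp ((f ^^ N) x) \<noteq> {}"
      then obtain g where g: "g \<in> supp ((f ^^ N) x)" by blast
      then have gc: "g \<in> carrier G" by (rule suppt_closedD)
      have gx: "act g x \<in> Q" by (rule Qact[OF x gc])
      obtain n where n: "n \<in> I" "act g x \<in> W n" using I(2) gx QX by blast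
      define u where "u = (f ^^ n) (act g x)"
      have u: "u \<in> Q" unfolding u_def by (rule Qf[OF gx])
      have "supp u \<inter> F = {}" using n(2) by (auto simp: W_def u_def suppt_def)
      then have "supp u \<inter> Z = {}" using ZF by blast
      then have "{\<one>} \<inter> supp ((f ^^ (N - n)) u) = {}"
        using Z(2)[of u "N - n"] u QX Qnil[OF u] by blast
      then have "\<one> \<notin> supp ((f ^^ N) (act g x))"
        using fn_add[of "N - n" n "act g x"] N[OF n(1)] by (simp add: u_def)
      then show False
        using g gc x QX mem_suppt_act[OF one_closed gc, of "(f ^^ N) x" \<Delta>] by (auto simp: fn_act)
    qed
    then show ?thesis using supp_empty[OF fn_closed] x QX by blast
  qed
  then have zeroQ: "Q \<subseteq> {x \<in> X. (f ^^ N) x = zero}" using QX by blast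
  have "closed {x \<in> X. (f ^^ N) x = zero}"
  proof -
    have "closed (X \<inter> (f ^^ N) -` {zero})"
      by (rule continuous_closed_preimage[OF fn_continuous closed_X]) simp
    then show ?thesis by (simp add: vimage_def Int_def)
  qed
  then have "closure Q \<subseteq> {x \<in> X. (f ^^ N) x = zero}" using zeroQ closure_minimal by blast
  then have "(f ^^ N) x = zero" if "x \<in> X" for x using XQ that by blast
  then have "(f ^^ N) ` X = (\<lambda>_. zero) ` X" by (intro image_cong) simp_all
  also have "\<dots> = {zero}" using zero_X by (intro image_constant)
  finally have "(f ^^ N) ` X = {zero}" .
  then show ?thesis by (auto simp: nilpotent_on_def)
qed

end

theorem mainTheorem2:
  fixes G :: "('g, 'm) monoid_scheme"
    and S :: "'g set"
    and X :: "'x::metric_space set"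
    and act :: "'g \<Rightarrow> 'x \<Rightarrow> 'x"
    and zero :: 'x
    and f :: "'x \<Rightarrow> 'x"
  assumes "group G"
    and "finite S" and "generating_set G S"
    and "residually_finite G"
    and "virtually_solvable G"
    and "pointed_dynamical_system G X act zero"
    and "expansive G X act"
    and "shadowing_property G S X act"
    and "dense_homoclinic_points G X act zero"
    and "system_endomorphism G X act zero f"
    and "asymptotically_nilpotent X zero f"
  shows "nilpotent_on X zero f"
proof -
  obtain \<Delta> :: real where \<Delta>: "0 < \<Delta>"
    "\<forall>x\<in>X. \<forall>y\<in>X. (\<forall>g\<in>carrier G. dist (act g x) (act g y) \<le> \<Delta>) \<longrightarrow> x = y"
    using assms(7) by (auto simp: expansive_def)
  interpret shadowing_system G X act zero S f \<Delta>
  proof (intro shadowing_system.intro shadowing_system_axioms.intro)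
    show "S \<subseteq> carrier G" using assms(3) by (simp add: generating_set_def)
  qed (use assms \<Delta> in blast)+
  show ?thesis
    by (rule nilpotent_if_homoclinic_nilpotent[OF nil_over_trivial[OF assms(4,5)] assms(9)])
qed

end
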